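(* Assume that $\gamma=1$. Let $r_{\rm ss}(u)=\bar\tau_+u$ and $$e_{\rm th,ss}(u)=\frac{\bar\tau_+^2}2u(1-u)+(T_+-T_-)u+T_-,\qquad u\in[0,1].$$ Then for any continuous function $G:[0,1]\to\mathbb R$, as $n\to\infty$, $$\frac1n\sum_{x=1}^nG\Big(\frac xn\Big)\mathcal E_x^{\rm mech}\to\int_0^1G(u)\,\tfrac12r_{\rm ss}^2(u)\,\mathrm du,$$ $$\frac1n\sum_{x=1}^nG\Big(\frac xn\Big)\langle\mathcal E_x^{\rm th}\rangle_{\rm ss}\to\int_0^1G(u)\,e_{\rm th,ss}(u)\,\mathrm du,$$ $$\frac1n\sum_{x=1}^nG\Big(\frac xn\Big)\langle\mathcal E_x\rangle_{\rm ss}\to\int_0^1G(u)\Big(e_{\rm th,ss}(u)+\tfrac12r_{\rm ss}^2(u)\Big)\mathrm du.$$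
   Context: Fix $\gamma>0$, $\tilde\gamma>0$, $T_->0$, $T_+>0$ and $\bar\tau_+\in\mathbb R$ (constant in time). For $n\ge1$ let $\Omega_n=\mathbb R^n\times\mathbb R^{n+1}$, with configurations $(\mathbf r,\mathbf p)=(r_1,\dots,r_n,p_0,\dots,p_n)$. Consider the diffusion on $\Omega_n$ with generator $L=n^2\big(A+\frac\gamma2S+\frac{\tilde\gamma}2\tilde S\big)$, where $$A=\sum_{x=1}^n(p_x-p_{x-1})\partial_{r_x}+\sum_{x=1}^{n-1}(r_{x+1}-r_x)\partial_{p_x}+r_1\partial_{p_0}+(\bar\tau_+-r_n)\partial_{p_n},$$ $$S=\sum_{x=0}^{n-1}\mathcal X_x\circ\mathcal X_x,\quad \mathcal X_x=p_{x+1}\partial_{p_x}-p_x\partial_{p_{x+1}},\qquad \tilde S=T_-\partial_{p_0}^2-p_0\partial_{p_0}+T_+\partial_{p_n}^2-p_n\partial_{p_n}.$$ It is known that for each $n$ this dynamics has a unique stationary probability measure $\mu_{\rm ss}$ on $\Omega_n$, and that it has finite second moments. Write $\langle F\rangle_{\rm ss}=\int_{\Omega_n}F\,\mathrm d\mu_{\rm ss}$ (the dependence on $n$ is suppressed). For $x\in\{1,\dots,n\}$: the energy per particle is $\mathcal E_x=\frac12p_x^2+\frac12r_x^2$, the stationary mechanical energy is $\mathcal E_x^{\rm mech}=\frac12\langle r_x\rangle_{\rm ss}^2$, and the thermal energy is $\mathcal E_x^{\rm th}=\mathcal E_x-\mathcal E_x^{\rm mech}=\frac12p_x^2+\frac12\big(r_x^2-\langle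 r_x\rangle_{\rm ss}^2\big)$. *)

theory Defs
  imports "HOL-Probability.Probability"
begin

section \<open>Configurations\<close>

text \<open>
  A configuration of the chain with \<open>n\<close> springs assigns a real number to each of the coordinates
  \<open>r\<^sub>1, \<dots>, r\<^sub>n\<close> (\<open>Elong x\<close>) and \<open>p\<^sub>0, \<dots>, p\<^sub>n\<close> (\<open>Mom x\<close>).  Since \<open>n\<close> varies, the space
  \<open>\<real>\<^sup>n \<times> \<real>\<^sup>n\<^sup>+\<^sup>1\<close> is the set of extensional functions on these coordinates, with the
  product \<open>\<sigma>\<close>-algebra and the (subspace of the) product topology.
\<close>

datatype coord = Elong nat | Mom nat

type_synonym config = "coord \<Rightarrow> real"

definition coords :: "nat \<Rightarrow> coord set" where
  "coords n = Elong ` {1..n} \<union> Mom ` {0..n}"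

definition Omega :: "nat \<Rightarrow> config set" where
  "Omega n = PiE (coords n) (\<lambda>_. UNIV)"

definition config_space :: "nat \<Rightarrow> config measure" where
  "config_space n = PiM (coords n) (\<lambda>_. borel)"


section \<open>Differential operators\<close>

definition pd :: "coord \<Rightarrow> (config \<Rightarrow> real) \<Rightarrow> config \<Rightarrow> real" where
  "pd c F z = deriv (\<lambda>s. F (z(c := s))) (z c)"

definition C1 :: "nat \<Rightarrow> (config \<Rightarrow> real) \<Rightarrow> bool" where
  "C1 n F \<longleftrightarrow> continuous_on (Omega n) F \<and>
     (\<forall>c\<in>coords n.
        (\<forall>z\<in>Omega n. (\<lambda>s. F (z(c := s))) field_differentiable (at (z c))) \<and>
        continuous_on (Omega n) (pd c F))"

definition C2 :: "nat \<Rightarrow> (config \<Rightarrow> real) \<Rightarrow> bool" where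
  "C2 n F \<longleftrightarrow> C1 n F \<and> (\<forall>c\<in>coords n. C1 n (pd c F))"

definition compactly_supported :: "nat \<Rightarrow> (config \<Rightarrow> real) \<Rightarrow> bool" where
  "compactly_supported n F \<longleftrightarrow>
     (\<exists>R. \<forall>z\<in>Omega n. (\<exists>c\<in>coords n. \<bar>z c\<bar> > R) \<longrightarrow> F z = 0)"

definition hamiltonian_op :: "nat \<Rightarrow> real \<Rightarrow> (config \<Rightarrow> real) \<Rightarrow> config \<Rightarrow> real" where
  "hamiltonian_op n \<tau> F z =
     (\<Sum>x = 1..n. (z (Mom x) - z (Mom (x - 1))) * pd (Elong x) F z)
     + (\<Sum>x = 1..<n. (z (Elong (x + 1)) - z (Elong x)) * pd (Mom x) F z)
     + z (Elong 1) * pd (Mom 0) F z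
     + (\<tau> - z (Elong n)) * pd (Mom n) F z"

definition rotation_field :: "nat \<Rightarrow> (config \<Rightarrow> real) \<Rightarrow> config \<Rightarrow> real" where
  "rotation_field x F z =
     z (Mom (x + 1)) * pd (Mom x) F z - z (Mom x) * pd (Mom (x + 1)) F z"

definition exchange_op :: "nat \<Rightarrow> (config \<Rightarrow> real) \<Rightarrow> config \<Rightarrow> real" where
  "exchange_op n F z = (\<Sum>x<n. rotation_field x (rotation_field x F) z)"

definition bath_op :: "nat \<Rightarrow> real \<Rightarrow> real \<Rightarrow> (config \<Rightarrow> real) \<Rightarrow> config \<Rightarrow> real" where
  "bath_op n Tm Tp F z =
     Tm * pd (Mom 0) (pd (Mom 0) F) z - z (Mom 0) * pd (Mom 0) F z
     + Tp * pd (Mom n) (pd (Mom n) F) z - z (Mom n) * pd (Mom n) F z"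

definition generator ::
  "real \<Rightarrow> real \<Rightarrow> real \<Rightarrow> real \<Rightarrow> real \<Rightarrow> nat \<Rightarrow> (config \<Rightarrow> real) \<Rightarrow> config \<Rightarrow> real" where
  "generator \<gamma> \<gamma>' Tm Tp \<tau> n F z =
     (real n)\<^sup>2 * (hamiltonian_op n \<tau> F z + \<gamma> / 2 * exchange_op n F z
                + \<gamma>' / 2 * bath_op n Tm Tp F z)"


section \<open>The diffusion and its stationary measures\<close>

text \<open>
  \<open>P t z\<close> is the law at time \<open>t\<close> of the diffusion started at \<open>z\<close>.  That its generator is \<open>L\<close> is
  expressed by the forward equation \<open>d/dt (P\<^sub>t F) = P\<^sub>t (L F)\<close> for compactly supported \<open>C\<^sup>2\<close>
  functions \<open>F\<close> (that is, the Markov process solves the martingale problem for \<open>L\<close>); at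
  \<open>t = 0\<close> it says that \<open>(P\<^sub>t F - F) / t\<close> tends to \<open>L F\<close>.
\<close>

definition diffusion_semigroup ::
  "nat \<Rightarrow> ((config \<Rightarrow> real) \<Rightarrow> config \<Rightarrow> real) \<Rightarrow> (real \<Rightarrow> config \<Rightarrow> config measure) \<Rightarrow> bool" where
  "diffusion_semigroup n L P \<longleftrightarrow>
     (\<forall>t\<ge>0. P t \<in> config_space n \<rightarrow>\<^sub>M prob_algebra (config_space n)) \<and>
     (\<forall>z\<in>Omega n. P 0 z = return (config_space n) z) \<and>
     (\<forall>s\<ge>0. \<forall>t\<ge>0. \<forall>z\<in>Omega n. P (s + t) z = P s z \<bind> P t) \<and>
     (\<forall>F. C2 n F \<and> compactly_supported n F \<longrightarrow>
        (\<forall>z\<in>Omega n. \<forall>t\<ge>0.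
           ((\<lambda>s. \<integral>w. F w \<partial>(P s z)) has_real_derivative (\<integral>w. L F w \<partial>(P t z)))
             (at t within {0..})))"

definition stationary_measure ::
  "nat \<Rightarrow> (real \<Rightarrow> config \<Rightarrow> config measure) \<Rightarrow> config measure \<Rightarrow> bool" where
  "stationary_measure n P \<mu> \<longleftrightarrow>
     prob_space \<mu> \<and> sets \<mu> = sets (config_space n) \<and> (\<forall>t\<ge>0. \<mu> \<bind> P t = \<mu>)"

definition finite_second_moments :: "nat \<Rightarrow> config measure \<Rightarrow> bool" where
  "finite_second_moments n \<mu> \<longleftrightarrow> (\<forall>c\<in>coords n. integrable \<mu> (\<lambda>z. (z c)\<^sup>2))"


section \<open>Energies and macroscopic profiles\<close>

definition energy :: "nat \<Rightarrow> config \<Rightarrow> real" where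
  "energy x z = 1 / 2 * (z (Mom x))\<^sup>2 + 1 / 2 * (z (Elong x))\<^sup>2"

definition mech_energy :: "config measure \<Rightarrow> nat \<Rightarrow> real" where
  "mech_energy \<mu> x = 1 / 2 * (\<integral>z. z (Elong x) \<partial>\<mu>)\<^sup>2"

definition thermal_energy :: "config measure \<Rightarrow> nat \<Rightarrow> config \<Rightarrow> real" where
  "thermal_energy \<mu> x z = energy x z - mech_energy \<mu> x"

definition r_ss :: "real \<Rightarrow> real \<Rightarrow> real" where
  "r_ss \<tau> u = \<tau> * u"

definition e_th_ss :: "real \<Rightarrow> real \<Rightarrow> real \<Rightarrow> real \<Rightarrow> real" where
  "e_th_ss \<tau> Tm Tp u = \<tau>\<^sup>2 / 2 * u * (1 - u) + (Tp - Tm) * u + Tm"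

end

theory Submission
  imports Defs
begin

text \<open>
  Stationarity, tested on quadratic polynomials with a radial cutoff, gives closed linear equations
  for the first and second moments.  The means are \<open>\<langle>p\<^sub>x\<rangle> = \<tau> / (n + \<gamma>')\<close> and \<open>\<langle>r\<^sub>x\<rangle> \<approx> \<tau> x / n\<close>.
  For \<open>\<gamma> = 1\<close> the constant energy current \<open>J\<close> makes
  \<open>\<langle>r\<^sub>x\<^sup>2\<rangle> + \<langle>p\<^sub>x\<^sub>-\<^sub>1 p\<^sub>x\<rangle> + (\<langle>p\<^sub>x\<^sup>2\<rangle> + \<langle>p\<^sub>x\<^sub>-\<^sub>1\<^sup>2\<rangle>) / 2\<close> an affine function of \<open>x\<close> with slope \<open>- 2 J\<close>, and
  it differs from \<open>2 \<langle>E\<^sub>x\<rangle>\<close> by discrete gradients, because \<open>\<langle>p\<^sub>x\<^sub>-\<^sub>1 p\<^sub>x\<rangle>\<close> is itself one.  The Cauchy-Schwarz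
  inequality at the two ends bounds this profile, hence \<open>J = O(1/n)\<close>, and the gradients vanish weakly.

  The boundary values of the profile involve \<open>\<langle>r\<^sub>1 p\<^sub>0\<rangle>\<close> and \<open>\<langle>r\<^sub>n p\<^sub>n\<rangle>\<close>, which tend to 0 by an
  entropy production argument at the level of covariances: tracing the stationary Lyapunov equation
  against the inverse covariance matrix \<open>K\<close>, every exchange term contributes at least 2, so that
  \<open>T\<^sub>- K(p\<^sub>0, p\<^sub>0) + T\<^sub>+ K(p\<^sub>n, p\<^sub>n) \<le> 2\<close>.  As the boundary temperatures are \<open>T\<^sub>\<plusminus> + O(1/n)\<close>, the boundary
  momenta are uncorrelated with the rest of the chain up to \<open>O(1/n)\<close> in the square.
\<close>

section \<open>Test functions\<close>

text \<open>Why \<open>\<gamma> = 1\<close>: for other values the affine combination of second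
  moments carries the kinetic part with weight \<open>\<gamma>\<^sup>2\<close>. Only equal weights
  make it twice the energy, and then no local equipartition of kinetic and potential energy has to
  be proved. Two obstacles shape the estimates. Interior second moments are never bounded site by
  site: Cauchy-Schwarz and the boundary equations control the two ends and, after telescoping, the
  total energy, so the gradients are small only on average over the chain. Moreover, bounded end
  values give the order of the current but not the limits of the profile: each end value contains a
  position-momentum moment with coefficient \<open>(\<gamma>' - 1) / 2\<close> up to sign, which
  Cauchy-Schwarz merely bounds. The trace inequality settles this because it is lossless in the
  bulk: the damping of each bond costs exactly 2 and its noise returns at least 2, so the baths are
  left with their equilibrium value, and temperature errors of order 1/n leave only that much room
  for a correlation.\<close>

definition has_pd :: "coord \<Rightarrow> (config \<Rightarrow> real) \<Rightarrow> (config \<Rightarrow> real) \<Rightarrow> bool" where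
  "has_pd c F F' \<longleftrightarrow> (\<forall>z. ((\<lambda>s. F (z(c := s))) has_real_derivative F' z) (at (z c)))"

text \<open>\<open>has_pd\<close> ranges over all functions and not only over
  \<open>Omega n\<close>, so that \<open>pd\<close> is identified as a function and can be
  differentiated again.\<close>

lemma pd_eq: "has_pd c F F' \<Longrightarrow> pd c F = F'"
  unfolding has_pd_def pd_def by (auto intro!: ext DERIV_imp_deriv)

lemma has_pd_const: "has_pd c (\<lambda>_. r) (\<lambda>_. 0)"
  unfolding has_pd_def by simp

lemma has_pd_coord: "has_pd c (\<lambda>z. z d) (\<lambda>_. if d = c then 1 else 0)"
  unfolding has_pd_def by auto

lemma has_pd_add:
  "has_pd c f f' \<Longrightarrow> has_pd c g g' \<Longrightarrow> has_pd c (\<lambda>z. f z + g z) (\<lambda>z. f' z + g' z)"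
  unfolding has_pd_def by (auto intro!: DERIV_add)

lemma has_pd_mult:
  assumes "has_pd c f f'" "has_pd c g g'"
  shows "has_pd c (\<lambda>z. f z * g z) (\<lambda>z. f' z * g z + f z * g' z)"
  unfolding has_pd_def
proof
  fix z
  have "((\<lambda>s. f (z(c := s)) * g (z(c := s))) has_real_derivative
      (f' z * g (z(c := z c)) + g' z * f (z(c := z c)))) (at (z c))"
    using assms unfolding has_pd_def by (intro DERIV_mult) auto
  then show "((\<lambda>s. f (z(c := s)) * g (z(c := s))) has_real_derivative
      (f' z * g z + f z * g' z)) (at (z c))"
    by (simp add: mult.commute)
qed

lemma finite_coords [simp]: "finite (coords n)"
  unfolding coords_def by simp

lemma Elong_in_coords [simp]: "Elong x \<in> coords n \<longleftrightarrow> 1 \<le> x \<and> x \<le> n"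
  unfolding coords_def by auto

lemma Mom_in_coords [simp]: "Mom x \<in> coords n \<longleftrightarrow> x \<le> n"
  unfolding coords_def by auto

section \<open>Radial cutoff and the class of test functions\<close>

definition normsq :: "nat \<Rightarrow> config \<Rightarrow> real" where
  "normsq n z = (\<Sum>c\<in>coords n. (z c)\<^sup>2)"

text \<open>A truncated polynomial rather than a smooth bump: derivatives of its powers are explicit
  multiples of lower powers, so every cutoff error has a closed form.\<close>

definition cutoff :: "nat \<Rightarrow> real \<Rightarrow> config \<Rightarrow> real" where
  "cutoff n \<epsilon> z = max 0 (1 - \<epsilon> * normsq n z)"

lemma normsq_nonneg: "normsq n z \<ge> 0"
  unfolding normsq_def by (intro sum_nonneg) auto

lemma square_le_normsq: "c \<in> coords n \<Longrightarrow> (z c)\<^sup>2 \<le> normsq n z"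
  unfolding normsq_def by (rule member_le_sum) auto

lemma DERIV_max_power:
  fixes s :: real
  shows "((\<lambda>s. max 0 s ^ (k + 2)) has_real_derivative (real (k + 2) * max 0 s ^ (k + 1))) (at s)"
proof -
  consider "s > 0" | "s < 0" | "s = 0" by linarith
  then show ?thesis
  proof cases
    case 1
    have "((\<lambda>s. s ^ (k + 2)) has_real_derivative (real (k + 2) * s ^ (k + 1))) (at s)"
      using DERIV_pow[of "k + 2" s] by simp
    then show ?thesis
      using 1 by (rule_tac has_field_derivative_transform_within_open[of "\<lambda>s. s ^ (k + 2)" _ _ "{0<..}"])
        (auto simp: max_def)
  next
    case 2
    have "((\<lambda>s. 0::real) has_real_derivative 0) (at s)"
      by simp
    then show ?thesis
      using 2 by (rule_tac has_field_derivative_transform_within_open[of "\<lambda>s. 0" _ _ "{..<0}"])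
        (auto simp: max_def)
  next
    case 3
    \<comment> \<open>At the kink the difference quotient equals \<open>max 0 h ^ (k + 1)\<close>,
      whose positive exponent forces the limit 0.\<close>
    have "((\<lambda>h::real. max 0 h ^ (k + 1)) \<longlongrightarrow> max 0 0 ^ (k + 1)) (at 0)"
      by (intro tendsto_intros)
    then have "((\<lambda>h::real. max 0 h ^ (k + 2) / h) \<longlongrightarrow> 0) (at 0)"
      by (rule_tac Lim_transform_eventually[where f = "\<lambda>h::real. max 0 h ^ (k + 1)"])
        (auto intro!: eventually_at_filter[THEN iffD2] always_eventually simp: max_def)
    then show ?thesis
      unfolding has_field_derivative_iff using 3 by simp
  qed
qed

lemma has_pd_normsq:
  assumes "c \<in> coords n"
  shows "has_pd c (normsq n) (\<lambda>z. 2 * z c)"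
  unfolding has_pd_def normsq_def
proof
  fix z :: config
  have "((\<lambda>s. \<Sum>d\<in>coords n. ((z(c := s)) d)\<^sup>2) has_real_derivative
      (\<Sum>d\<in>coords n. if d = c then 2 * z c else 0)) (at (z c))"
    by (intro DERIV_sum) (auto intro!: derivative_eq_intros)
  then show "((\<lambda>s. \<Sum>d\<in>coords n. ((z(c := s)) d)\<^sup>2) has_real_derivative 2 * z c) (at (z c))"
    using assms by (simp add: sum.delta)
qed

lemma has_pd_cutoff:
  assumes "c \<in> coords n"
  shows "has_pd c (\<lambda>z. cutoff n \<epsilon> z ^ (k + 2)) (\<lambda>z. (- 2 * \<epsilon> * real (k + 2)) * (z c * cutoff n \<epsilon> z ^ (k + 1)))"
  unfolding has_pd_def cutoff_def
proof
  fix z :: config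
  have N: "((\<lambda>s. normsq n (z(c := s))) has_real_derivative 2 * z c) (at (z c))"
    using has_pd_normsq[OF assms] unfolding has_pd_def by blast
  have "((\<lambda>s. 1 - \<epsilon> * normsq n (z(c := s))) has_real_derivative - (\<epsilon> * (2 * z c))) (at (z c))"
    using N by (auto intro!: derivative_eq_intros)
  from DERIV_chain2[where f = "\<lambda>s. max 0 s ^ (k + 2)", OF DERIV_max_power this]
  show "((\<lambda>s. max 0 (1 - \<epsilon> * normsq n (z(c := s))) ^ (k + 2)) has_real_derivative
      (- 2 * \<epsilon> * real (k + 2)) * (z c * max 0 (1 - \<epsilon> * normsq n z) ^ (k + 1))) (at (z c))"
    by (simp add: algebra_simps)
qed

text \<open>The \<open>j\<close>-th power of the positive part is only \<open>j - 1\<close> times continuously differentiable.\<close>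

inductive smooth :: "nat \<Rightarrow> nat \<Rightarrow> (config \<Rightarrow> real) \<Rightarrow> bool" for n where
  const: "smooth n k (\<lambda>_. r)"
| coord: "c \<in> coords n \<Longrightarrow> smooth n k (\<lambda>z. z c)"
| add: "smooth n k f \<Longrightarrow> smooth n k g \<Longrightarrow> smooth n k (\<lambda>z. f z + g z)"
| mult: "smooth n k f \<Longrightarrow> smooth n k g \<Longrightarrow> smooth n k (\<lambda>z. f z * g z)"
| cutoff: "k < j \<Longrightarrow> smooth n k (\<lambda>z. cutoff n \<epsilon> z ^ j)"

lemma smooth_diff: "smooth n k f \<Longrightarrow> smooth n k g \<Longrightarrow> smooth n k (\<lambda>z. f z - g z)"
  using smooth.add[of n k f "\<lambda>z. (-1) * g z"] smooth.mult[OF smooth.const[of n k "-1"], of g] by simp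

lemma smooth_sum: "finite I \<Longrightarrow> (\<And>i. i \<in> I \<Longrightarrow> smooth n k (f i)) \<Longrightarrow> smooth n k (\<lambda>z. \<Sum>i\<in>I. f i z)"
  by (induction I rule: finite_induct) (auto intro: smooth.intros)

lemma smooth_mono: "smooth n k f \<Longrightarrow> j \<le> k \<Longrightarrow> smooth n j f"
  by (induction rule: smooth.induct) (auto intro: smooth.intros)

text \<open>\<open>smooth\<close> is a syntactic class, so the derivative and its membership are
  produced together, constructor by constructor. One order is spent per derivative; in a product the
  undifferentiated factor is weakened by \<open>smooth_mono\<close>.\<close>

lemma smooth_has_pd_ex:
  assumes "smooth n k f" "k = Suc j" "c \<in> coords n"
  shows "\<exists>f'. smooth n j f' \<and> has_pd c f f'"
  using assms
proof (induction rule: smooth.induct)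
  case (const k r)
  then show ?case using has_pd_const smooth.const by blast
next
  case (coord d k)
  show ?case using has_pd_coord[of c d] smooth.const[of n j "if d = c then 1 else 0"] by blast
next
  case (add k f g)
  then obtain f' g' where "smooth n j f'" "has_pd c f f'" "smooth n j g'" "has_pd c g g'" by blast
  then show ?case using has_pd_add smooth.add by blast
next
  case (mult k f g)
  then obtain f' g' where "smooth n j f'" "has_pd c f f'" "smooth n j g'" "has_pd c g g'" by blast
  moreover have "smooth n j f" "smooth n j g" using mult smooth_mono[of n k _ j] by auto
  ultimately show ?case using has_pd_mult[of c f f' g g'] 
    by (auto intro!: exI[of _ "\<lambda>z. f' z * g z + f z * g' z"] smooth.add smooth.mult)
next
  case (cutoff k i \<epsilon>)
  then have i': "i = (i - 2) + 2" by linarith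
  then obtain l where i: "i = l + 2" by blast
  have "smooth n j (\<lambda>z. (- 2 * \<epsilon> * real (l + 2)) * (z c * cutoff n \<epsilon> z ^ (l + 1)))"
    using cutoff i by (intro smooth.mult smooth.const smooth.coord smooth.cutoff) auto
  then show ?case using has_pd_cutoff[OF cutoff(3), of \<epsilon> l] i by blast
qed

lemma smooth_has_pd: "smooth n (Suc k) f \<Longrightarrow> c \<in> coords n \<Longrightarrow> has_pd c f (pd c f)"
  using smooth_has_pd_ex[of n "Suc k" f k c] pd_eq by blast

lemma smooth_pd: "smooth n (Suc k) f \<Longrightarrow> c \<in> coords n \<Longrightarrow> smooth n k (pd c f)"
  using smooth_has_pd_ex[of n "Suc k" f k c] pd_eq by blast

lemma continuous_on_cutoff: "continuous_on A (cutoff n \<epsilon>)"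
  unfolding cutoff_def normsq_def
  by (intro continuous_intros continuous_on_product_coordinates[THEN continuous_on_subset]) auto

lemma smooth_continuous_on: "smooth n k f \<Longrightarrow> continuous_on A f"
proof (induction rule: smooth.induct)
  case (coord c k)
  then show ?case by (intro continuous_on_product_coordinates[THEN continuous_on_subset]) auto
next
  case (cutoff k j \<epsilon>)
  then show ?case using continuous_on_cutoff by (intro continuous_intros)
qed (auto intro!: continuous_intros)

lemma coord_measurable [measurable]: "c \<in> coords n \<Longrightarrow> (\<lambda>z. z c) \<in> borel_measurable (config_space n)"
  unfolding config_space_def by (rule measurable_component_singleton)

lemma cutoff_measurable [measurable]: "cutoff n \<epsilon> \<in> borel_measurable (config_space n)"
  unfolding cutoff_def normsq_def by measurable

lemma smooth_measurable: "smooth n k f \<Longrightarrow> f \<in> borel_measurable (config_space n)"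
  by (induction rule: smooth.induct) auto

lemma smooth_C1:
  assumes "smooth n (Suc k) f"
  shows "C1 n f"
proof -
  have "(\<lambda>s. f (z(c := s))) field_differentiable (at (z c))" if "c \<in> coords n" for c z
    using smooth_has_pd[OF assms that] unfolding has_pd_def field_differentiable_def by blast
  moreover have "continuous_on (Omega n) (pd c f)" if "c \<in> coords n" for c
    using smooth_pd[OF assms that] smooth_continuous_on by blast
  ultimately show ?thesis
    unfolding C1_def using smooth_continuous_on[OF assms] by blast
qed

lemma smooth_C2: "smooth n 2 f \<Longrightarrow> C2 n f"
  unfolding C2_def using smooth_C1[of n 1 f] smooth_C1[of n 0] smooth_pd[of n 1 f]
  by (auto simp: numeral_2_eq_2)

lemma compactly_supported_cutoff:
  assumes "\<epsilon> > 0" "j > 0"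
  shows "compactly_supported n (\<lambda>z. f z * cutoff n \<epsilon> z ^ j)"
proof -
  \<comment> \<open>The summand 1 in the radius ensures \<open>1 \<le> \<bar>z c\<bar>\<close>, so
    the lower bound \<open>1 / \<epsilon>\<close> passes to the square.\<close>
  have "cutoff n \<epsilon> z = 0" if "c \<in> coords n" "\<bar>z c\<bar> > 1 + 1 / \<epsilon>" for z c
  proof -
    have "1 / \<epsilon> \<le> \<bar>z c\<bar> * 1" using that by simp
    also have "\<dots> \<le> \<bar>z c\<bar> * \<bar>z c\<bar>"
      using that assms by (intro mult_left_mono) (auto intro: order_trans[of 1 "1 + 1 / \<epsilon>"])
    also have "\<dots> = (z c)\<^sup>2" by (simp add: power2_eq_square)
    also have "\<dots> \<le> normsq n z" using that square_le_normsq by blast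
    finally have "1 \<le> \<epsilon> * normsq n z" using assms by (simp add: field_simps)
    then show ?thesis unfolding cutoff_def by simp
  qed
  then show ?thesis using assms unfolding compactly_supported_def
    by (auto intro!: exI[of _ "1 + 1 / \<epsilon>"])
qed

section \<open>Stationarity\<close>

lemma space_config_space: "space (config_space n) = Omega n"
  unfolding config_space_def Omega_def by (simp add: space_PiM)

lemma (in prob_space) abs_expectation_le:
  fixes f :: "'a \<Rightarrow> real"
  assumes "f \<in> borel_measurable M" "\<And>x. x \<in> space M \<Longrightarrow> \<bar>f x\<bar> \<le> K"
  shows "\<bar>\<integral>x. f x \<partial>M\<bar> \<le> K"
proof -
  have int: "integrable M f"
    using assms by (intro integrable_const_bound[of _ K]) auto
  have "\<bar>\<integral>x. f x \<partial>M\<bar> \<le> (\<integral>x. \<bar>f x\<bar> \<partial>M)"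
    by (rule integral_abs_bound)
  also have "\<dots> \<le> (\<integral>x. K \<partial>M)"
    using int assms by (intro integral_mono) auto
  finally show ?thesis by (simp add: prob_space)
qed

text \<open>By invariance the difference quotients of the semigroup acting on \<open>F\<close>
  integrate to 0. The forward equation makes them converge pointwise to \<open>L F\<close>, and the
  bound \<open>K\<close> on \<open>L F\<close>, inherited by its averages under
  \<open>P t z\<close>, dominates them.\<close>

lemma stationary_generator_integral:
  assumes semi: "diffusion_semigroup n L P" and stat: "stationary_measure n P \<mu>"
    and F: "C2 n F" "compactly_supported n F"
    and F_meas [measurable]: "F \<in> borel_measurable (config_space n)"
    and LF_meas [measurable]: "L F \<in> borel_measurable (config_space n)"
    and F_bound: "\<And>z. z \<in> Omega n \<Longrightarrow> \<bar>F z\<bar> \<le> B"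
    and LF_bound: "\<And>z. z \<in> Omega n \<Longrightarrow> \<bar>L F z\<bar> \<le> K"
  shows "(\<integral>z. L F z \<partial>\<mu>) = 0"
proof -
  interpret prob_space \<mu> using stat unfolding stationary_measure_def by blast
  have sets_\<mu> [measurable_cong]: "sets \<mu> = sets (config_space n)"
    and inv: "\<And>t. t \<ge> 0 \<Longrightarrow> \<mu> \<bind> P t = \<mu>"
    using stat unfolding stationary_measure_def by auto
  have space_\<mu>: "space \<mu> = Omega n"
    using sets_eq_imp_space_eq[OF sets_\<mu>] space_config_space by simp
  have P_meas: "P t \<in> config_space n \<rightarrow>\<^sub>M prob_algebra (config_space n)" if "t \<ge> 0" for t
    using semi that unfolding diffusion_semigroup_def by blast
  have P_prob: "prob_space (P t z)" and P_sets: "sets (P t z) = sets (config_space n)"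
    if "t \<ge> 0" "z \<in> Omega n" for t z
    using measurable_space[OF P_meas[OF that(1)], of z] that(2) space_config_space
    by (auto simp: space_prob_algebra)
  have P_sub: "P t \<in> \<mu> \<rightarrow>\<^sub>M subprob_algebra (config_space n)" if "t \<ge> 0" for t
    using measurable_prob_algebraD[OF P_meas[OF that]] measurable_cong_sets[OF sets_\<mu> refl] by blast
  define u where "u t z = (\<integral>w. F w \<partial>(P t z))" for t z
  have u_deriv: "((\<lambda>s. u s z) has_real_derivative (\<integral>w. L F w \<partial>(P t z))) (at t within {0..})"
    if "z \<in> Omega n" "t \<ge> 0" for z t
    using semi F that unfolding diffusion_semigroup_def u_def by blast
  have P0: "P 0 z = return (config_space n) z" if "z \<in> Omega n" for z
    using semi that unfolding diffusion_semigroup_def by blast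
  have u0: "u 0 z = F z" if "z \<in> Omega n" for z
    unfolding u_def P0[OF that] using that space_config_space by (intro integral_return) auto
  have LF0: "(\<integral>w. L F w \<partial>(P 0 z)) = L F z" if "z \<in> Omega n" for z
    unfolding P0[OF that] using that space_config_space by (intro integral_return) auto
  have PLF_bound: "\<bar>\<integral>w. L F w \<partial>(P t z)\<bar> \<le> K" if "z \<in> Omega n" "t \<ge> 0" for z t
  proof -
    interpret p: prob_space "P t z" using P_prob that by blast
    note sets = P_sets[OF that(2,1)]
    show ?thesis
    proof (rule p.abs_expectation_le)
      show "L F \<in> borel_measurable (P t z)"
        using LF_meas measurable_cong_sets[OF sets refl] by blast
    qed (use LF_bound sets_eq_imp_space_eq[OF sets] space_config_space in auto)
  qed
  have u_lip: "\<bar>u t z - u 0 z\<bar> \<le> K * t" if "z \<in> Omega n" "t \<ge> 0" for z t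
    using field_differentiable_bound[of "{0..}" "\<lambda>s. u s z" "\<lambda>t. \<integral>w. L F w \<partial>(P t z)" K t 0]
      u_deriv PLF_bound that by auto
  have u_int: "(\<integral>z. u t z \<partial>\<mu>) = (\<integral>z. F z \<partial>\<mu>)" if "t \<ge> 0" for t
  proof -
    have "(\<integral>z. F z \<partial>(\<mu> \<bind> P t)) = (\<integral>z. u t z \<partial>\<mu>)"
      unfolding u_def
    proof (rule integral_bind[OF F_meas _ P_sub[OF that], where B = B and B' = 1])
      show "AE x in \<mu>. emeasure (P t x) (space (P t x)) \<le> ennreal 1"
        using P_prob[OF that] space_\<mu> by (auto intro!: AE_I2 simp: prob_space.emeasure_space_1)
    qed (use F_bound space_config_space finite_measure_axioms in auto)
    then show ?thesis using inv[OF that] by simp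
  qed
  have u_meas [measurable]: "u t \<in> borel_measurable \<mu>" if "t \<ge> 0" for t
    unfolding u_def
    using measurable_compose[OF P_sub[OF that] integral_measurable_subprob_algebra[OF F_meas]] by simp
  define h where "h k = 1 / real (Suc k)" for k
  define D where "D k z = (u (h k) z - u 0 z) / h k" for k z
  have h_pos: "h k > 0" for k unfolding h_def by simp
  have u_bound: "\<bar>u t z\<bar> \<le> B" if "z \<in> Omega n" "t \<ge> 0" for z t
  proof -
    interpret p: prob_space "P t z" using P_prob that by blast
    note sets = P_sets[OF that(2,1)]
    show ?thesis unfolding u_def
    proof (rule p.abs_expectation_le)
      show "F \<in> borel_measurable (P t z)"
        using F_meas measurable_cong_sets[OF sets refl] by blast
    qed (use F_bound sets_eq_imp_space_eq[OF sets] space_config_space in auto)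
  qed
  have u_integrable: "integrable \<mu> (u t)" if "t \<ge> 0" for t
    using u_meas[OF that] u_bound that space_\<mu> by (intro integrable_const_bound[of _ B]) auto
  have D_zero: "(\<integral>z. D k z \<partial>\<mu>) = 0" for k
    unfolding D_def using u_int[of "h k"] u_int[of 0] h_pos[of k] u_integrable[of "h k"] u_integrable[of 0]
    by simp
  have "(\<lambda>k. \<integral>z. D k z \<partial>\<mu>) \<longlonglongrightarrow> (\<integral>z. L F z \<partial>\<mu>)"
  proof (rule integral_dominated_convergence[where w = "\<lambda>_. K"])
    show "L F \<in> borel_measurable \<mu>" by measurable
    show "D k \<in> borel_measurable \<mu>" for k
      unfolding D_def using u_meas[of "h k"] u_meas[of 0] h_pos[of k] by simp
    show "integrable \<mu> (\<lambda>_. K)" by simp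
    show "AE z in \<mu>. norm (D k z) \<le> K" for k
      using u_lip[of _ "h k"] h_pos[of k] space_\<mu> unfolding D_def
      by (auto intro!: AE_I2 simp: field_simps)
    show "AE z in \<mu>. (\<lambda>k. D k z) \<longlonglongrightarrow> L F z"
    proof (rule AE_I2)
      fix z assume "z \<in> space \<mu>"
      then have z: "z \<in> Omega n" using space_\<mu> by simp
      have "((\<lambda>t. (u t z - u 0 z) / (t - 0)) \<longlongrightarrow> L F z) (at 0 within {0..})"
        using u_deriv[OF z, of 0] LF0[OF z] unfolding has_field_derivative_iff by simp
      moreover have "filterlim h (at 0 within {0..}) sequentially"
        unfolding filterlim_at h_def using LIMSEQ_inverse_real_of_nat
        by (auto simp: inverse_eq_divide)
      ultimately show "(\<lambda>k. D k z) \<longlonglongrightarrow> L F z"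
        unfolding D_def using filterlim_compose[of "\<lambda>t. (u t z - u 0 z) / (t - 0)"] by fastforce
    qed
  qed
  then show ?thesis unfolding D_zero using LIMSEQ_unique tendsto_const by blast
qed

section \<open>Growth classes matching finite second moments\<close>

definition quad_growth :: "nat \<Rightarrow> (config \<Rightarrow> real) \<Rightarrow> bool" where
  "quad_growth n f \<longleftrightarrow> (\<exists>K. \<forall>z. \<bar>f z\<bar> \<le> K * (1 + normsq n z))"

text \<open>Encoded through the square, so that products reduce to
  \<open>2 a b \<le> a\<^sup>2 + b\<^sup>2\<close> and no square root of the norm appears.\<close>

definition lin_growth :: "nat \<Rightarrow> (config \<Rightarrow> real) \<Rightarrow> bool" where
  "lin_growth n f \<longleftrightarrow> quad_growth n (\<lambda>z. (f z)\<^sup>2)"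

lemma quad_growth_const: "quad_growth n (\<lambda>_. r)"
  unfolding quad_growth_def using normsq_nonneg
  by (auto intro!: exI[of _ "\<bar>r\<bar>"] simp: algebra_simps)

lemma quad_growth_mono: "quad_growth n g \<Longrightarrow> (\<And>z. \<bar>f z\<bar> \<le> \<bar>g z\<bar>) \<Longrightarrow> quad_growth n f"
  unfolding quad_growth_def by (meson order_trans)

lemma quad_growth_add: "quad_growth n f \<Longrightarrow> quad_growth n g \<Longrightarrow> quad_growth n (\<lambda>z. f z + g z)"
  unfolding quad_growth_def
proof (elim exE)
  fix K K' assume "\<forall>z. \<bar>f z\<bar> \<le> K * (1 + normsq n z)" "\<forall>z. \<bar>g z\<bar> \<le> K' * (1 + normsq n z)"
  then have "\<bar>f z + g z\<bar> \<le> (K + K') * (1 + normsq n z)" for z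
    by (smt (verit) distrib_right)
  then show "\<exists>K. \<forall>z. \<bar>f z + g z\<bar> \<le> K * (1 + normsq n z)" by blast
qed

lemma quad_growth_cmult: "quad_growth n f \<Longrightarrow> quad_growth n (\<lambda>z. r * f z)"
  unfolding quad_growth_def
proof (elim exE)
  fix K assume *: "\<forall>z. \<bar>f z\<bar> \<le> K * (1 + normsq n z)"
  have "\<bar>r * f z\<bar> \<le> (\<bar>r\<bar> * K) * (1 + normsq n z)" for z
    using mult_left_mono[OF *[rule_format, of z], of "\<bar>r\<bar>"] by (simp add: abs_mult mult.assoc)
  then show "\<exists>K. \<forall>z. \<bar>r * f z\<bar> \<le> K * (1 + normsq n z)" by blast
qed

lemma quad_growth_sum:
  "finite I \<Longrightarrow> (\<And>i. i \<in> I \<Longrightarrow> quad_growth n (f i)) \<Longrightarrow> quad_growth n (\<lambda>z. \<Sum>i\<in>I. f i z)"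
  by (induction I rule: finite_induct) (auto intro: quad_growth_const quad_growth_add)

lemma lin_growth_const: "lin_growth n (\<lambda>_. r)"
  unfolding lin_growth_def by (rule quad_growth_const)

lemma lin_growth_coord:
  assumes "c \<in> coords n"
  shows "lin_growth n (\<lambda>z. z c)"
  unfolding lin_growth_def quad_growth_def
proof (intro exI[of _ 1] allI)
  fix z
  show "\<bar>(z c)\<^sup>2\<bar> \<le> 1 * (1 + normsq n z)"
    using square_le_normsq[OF assms, of z] by simp
qed

lemma quad_growth_mult: "lin_growth n f \<Longrightarrow> lin_growth n g \<Longrightarrow> quad_growth n (\<lambda>z. f z * g z)"
  unfolding lin_growth_def
proof (rule quad_growth_mono[OF quad_growth_add])
  show "\<bar>f z * g z\<bar> \<le> \<bar>(f z)\<^sup>2 + (g z)\<^sup>2\<bar>" for z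
  proof -
    have "2 * (\<bar>f z\<bar> * \<bar>g z\<bar>) \<le> (f z)\<^sup>2 + (g z)\<^sup>2" "0 \<le> \<bar>f z\<bar> * \<bar>g z\<bar>"
      using sum_squares_bound[of "\<bar>f z\<bar>" "\<bar>g z\<bar>"] by simp_all
    then show ?thesis unfolding abs_mult by linarith
  qed
qed

lemma lin_growth_add: "lin_growth n f \<Longrightarrow> lin_growth n g \<Longrightarrow> lin_growth n (\<lambda>z. f z + g z)"
proof -
  assume "lin_growth n f" "lin_growth n g"
  then have "quad_growth n (\<lambda>z. ((f z)\<^sup>2 + (g z)\<^sup>2) + 2 * (f z * g z))"
    by (intro quad_growth_add quad_growth_cmult quad_growth_mult) (auto simp: lin_growth_def)
  then show ?thesis unfolding lin_growth_def by (simp add: power2_sum algebra_simps)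
qed

lemma lin_growth_cmult: "lin_growth n f \<Longrightarrow> lin_growth n (\<lambda>z. r * f z)"
  unfolding lin_growth_def power_mult_distrib by (rule quad_growth_cmult)

lemma lin_growth_diff: "lin_growth n f \<Longrightarrow> lin_growth n g \<Longrightarrow> lin_growth n (\<lambda>z. f z - g z)"
  using lin_growth_add[of n f "\<lambda>z. (-1) * g z"] lin_growth_cmult[of n g "-1"] by simp

lemma lin_imp_quad_growth: "lin_growth n f \<Longrightarrow> quad_growth n f"
  using quad_growth_mult[OF _ lin_growth_const[of n 1], of f] by simp

lemma quad_growth_integrable:
  assumes "quad_growth n f" "f \<in> borel_measurable (config_space n)"
    and "prob_space \<mu>" "sets \<mu> = sets (config_space n)" "finite_second_moments n \<mu>"
  shows "integrable \<mu> f"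
proof -
  interpret prob_space \<mu> by fact
  obtain K where K: "\<And>z. \<bar>f z\<bar> \<le> K * (1 + normsq n z)"
    using assms(1) unfolding quad_growth_def by blast
  have "integrable \<mu> (normsq n)"
    using assms(5) unfolding finite_second_moments_def normsq_def[abs_def] by auto
  then have "integrable \<mu> (\<lambda>z. K * (1 + normsq n z))" by auto
  then show ?thesis
  proof (rule Bochner_Integration.integrable_bound)
    show "f \<in> borel_measurable \<mu>" using assms(2,4) measurable_cong_sets by blast
    show "AE z in \<mu>. norm (f z) \<le> norm (K * (1 + normsq n z))"
      using K by (auto intro!: AE_I2 intro: order_trans[OF _ abs_ge_self])
  qed
qed

section \<open>Removing the cutoff\<close>

lemma pd_mult:
  assumes "smooth n (Suc k) f" "smooth n (Suc k) g" "c \<in> coords n"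
  shows "pd c (\<lambda>z. f z * g z) = (\<lambda>z. pd c f z * g z + f z * pd c g z)"
  using assms by (intro pd_eq has_pd_mult smooth_has_pd)

lemma pd_cmult:
  assumes "smooth n (Suc k) f" "c \<in> coords n"
  shows "pd c (\<lambda>z. r * f z) = (\<lambda>z. r * pd c f z)"
  using pd_mult[OF smooth.const assms, of r] pd_eq[OF has_pd_const[of c r]] by simp

lemma pd_add:
  assumes "smooth n (Suc k) f" "smooth n (Suc k) g" "c \<in> coords n"
  shows "pd c (\<lambda>z. f z + g z) = (\<lambda>z. pd c f z + pd c g z)"
  using assms by (intro pd_eq has_pd_add smooth_has_pd)

lemma pd_coord: "pd c (\<lambda>z. z d) = (\<lambda>_. if d = c then 1 else 0)"
  by (intro pd_eq has_pd_coord)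

lemma pd_const: "pd c (\<lambda>_. r) = (\<lambda>_. 0)"
  by (intro pd_eq has_pd_const)

lemma pd_cutoff:
  assumes "c \<in> coords n"
  shows "pd c (\<lambda>z. cutoff n \<epsilon> z ^ (k + 2)) = (\<lambda>z. (- 2 * \<epsilon> * real (k + 2)) * (z c * cutoff n \<epsilon> z ^ (k + 1)))"
  by (intro pd_eq has_pd_cutoff assms)

lemma smooth_rotation_field:
  assumes "smooth n (Suc k) f" "x < n"
  shows "smooth n k (rotation_field x f)"
  unfolding rotation_field_def[abs_def] using assms
  by (intro smooth_diff smooth.mult smooth.coord smooth_pd) auto

lemma rotation_field_mult:
  assumes "smooth n (Suc k) f" "smooth n (Suc k) g" "x < n"
  shows "rotation_field x (\<lambda>z. f z * g z) = (\<lambda>z. rotation_field x f z * g z + f z * rotation_field x g z)"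
  unfolding rotation_field_def[abs_def] using assms
  by (simp add: pd_mult[OF assms(1,2)] algebra_simps)

text \<open>The exchange noise preserves the kinetic energy, so a radial cutoff passes through it.\<close>

lemma rotation_field_cutoff:
  assumes "x < n"
  shows "rotation_field x (\<lambda>z. cutoff n \<epsilon> z ^ (k + 2)) = (\<lambda>_. 0)"
  unfolding rotation_field_def[abs_def] using assms
  by (simp add: pd_cutoff[of _ n] del: power_Suc add_2_eq_Suc add_2_eq_Suc')

lemma exchange_op_cutoff:
  assumes q: "smooth n 2 q"
  shows "exchange_op n (\<lambda>z. q z * cutoff n \<epsilon> z ^ 3) z = exchange_op n q z * cutoff n \<epsilon> z ^ 3"
proof -
  have q1: "smooth n (Suc 1) q" using q by (simp add: numeral_2_eq_2)
  have \<psi>: "smooth n (Suc 1) (\<lambda>z. cutoff n \<epsilon> z ^ 3)" "smooth n (Suc 0) (\<lambda>z. cutoff n \<epsilon> z ^ 3)"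
    by (auto intro: smooth.cutoff)
  have rot: "rotation_field x (\<lambda>z. cutoff n \<epsilon> z ^ 3) = (\<lambda>_. 0)" if "x < n" for x
    using rotation_field_cutoff[OF that, of \<epsilon> 1] by (simp add: numeral_3_eq_3)
  have "rotation_field x (rotation_field x (\<lambda>z. q z * cutoff n \<epsilon> z ^ 3)) z
      = rotation_field x (rotation_field x q) z * cutoff n \<epsilon> z ^ 3" if x: "x < n" for x
    using rotation_field_mult[OF q1 \<psi>(1) x] rot[OF x]
      rotation_field_mult[OF smooth_rotation_field[OF q1 x, unfolded One_nat_def] \<psi>(2) x] by simp
  then show ?thesis unfolding exchange_op_def by (simp add: sum_distrib_right)
qed

lemma hamiltonian_op_mult:
  assumes "smooth n (Suc k) f" "smooth n (Suc k) g" "n \<ge> 1"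
  shows "hamiltonian_op n \<tau> (\<lambda>z. f z * g z) z =
    hamiltonian_op n \<tau> f z * g z + f z * hamiltonian_op n \<tau> g z"
proof -
  note pm = pd_mult[OF assms(1,2)]
  have "(\<Sum>x = 1..n. (z (Mom x) - z (Mom (x - 1))) * pd (Elong x) (\<lambda>z. f z * g z) z) =
      (\<Sum>x = 1..n. (z (Mom x) - z (Mom (x - 1))) * pd (Elong x) f z) * g z +
      f z * (\<Sum>x = 1..n. (z (Mom x) - z (Mom (x - 1))) * pd (Elong x) g z)"
    unfolding sum_distrib_left sum_distrib_right sum.distrib[symmetric]
    by (intro sum.cong) (auto simp: pm algebra_simps)
  moreover have "(\<Sum>x = 1..<n. (z (Elong (x + 1)) - z (Elong x)) * pd (Mom x) (\<lambda>z. f z * g z) z) =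
      (\<Sum>x = 1..<n. (z (Elong (x + 1)) - z (Elong x)) * pd (Mom x) f z) * g z +
      f z * (\<Sum>x = 1..<n. (z (Elong (x + 1)) - z (Elong x)) * pd (Mom x) g z)"
    unfolding sum_distrib_left sum_distrib_right sum.distrib[symmetric]
    by (intro sum.cong) (auto simp: pm algebra_simps)
  moreover have "pd (Mom 0) (\<lambda>z. f z * g z) z = pd (Mom 0) f z * g z + f z * pd (Mom 0) g z"
    "pd (Mom n) (\<lambda>z. f z * g z) z = pd (Mom n) f z * g z + f z * pd (Mom n) g z"
    by (simp_all add: pm)
  ultimately show ?thesis unfolding hamiltonian_op_def by (simp add: algebra_simps)
qed

lemma hamiltonian_op_cong_scale:
  assumes "n \<ge> 1" "\<And>c. c \<in> coords n \<Longrightarrow> pd c f z = r * pd c g z"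
  shows "hamiltonian_op n \<tau> f z = r * hamiltonian_op n \<tau> g z"
proof -
  have "(\<Sum>x = 1..n. (z (Mom x) - z (Mom (x - 1))) * pd (Elong x) f z) =
      r * (\<Sum>x = 1..n. (z (Mom x) - z (Mom (x - 1))) * pd (Elong x) g z)"
    unfolding sum_distrib_left by (intro sum.cong) (auto simp: assms(2))
  moreover have "(\<Sum>x = 1..<n. (z (Elong (x + 1)) - z (Elong x)) * pd (Mom x) f z) =
      r * (\<Sum>x = 1..<n. (z (Elong (x + 1)) - z (Elong x)) * pd (Mom x) g z)"
    unfolding sum_distrib_left by (intro sum.cong) (auto simp: assms(2))
  ultimately show ?thesis
    unfolding hamiltonian_op_def by (simp add: assms algebra_simps)
qed

lemma hamiltonian_op_cutoff:
  assumes "n \<ge> 1"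
  shows "hamiltonian_op n \<tau> (\<lambda>z. cutoff n \<epsilon> z ^ 3) z = - 3 * \<epsilon> * cutoff n \<epsilon> z ^ 2 * hamiltonian_op n \<tau> (normsq n) z"
proof (rule hamiltonian_op_cong_scale[OF assms])
  fix c assume c: "c \<in> coords n"
  show "pd c (\<lambda>z. cutoff n \<epsilon> z ^ 3) z = - 3 * \<epsilon> * cutoff n \<epsilon> z ^ 2 * pd c (normsq n) z"
    using fun_cong[OF pd_cutoff[OF c, of \<epsilon> 1], of z] pd_eq[OF has_pd_normsq[OF c]]
    by (simp add: numeral_3_eq_3 numeral_2_eq_2 algebra_simps)
qed

lemma smooth_hamiltonian_op:
  assumes "smooth n (Suc k) F" "n \<ge> 1"
  shows "smooth n k (hamiltonian_op n \<tau> F)"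
  unfolding hamiltonian_op_def[abs_def] using assms
  by (intro smooth.add smooth_sum smooth.mult smooth_diff smooth.coord smooth.const smooth_pd) auto

lemma smooth_exchange_op:
  assumes "smooth n (Suc (Suc k)) F"
  shows "smooth n k (exchange_op n F)"
  unfolding exchange_op_def[abs_def] using assms
  by (intro smooth_sum smooth_rotation_field) auto

lemma smooth_bath_op:
  assumes "smooth n (Suc (Suc k)) F"
  shows "smooth n k (bath_op n Tm Tp F)"
  unfolding bath_op_def[abs_def] using assms smooth_mono[OF assms, of "Suc k"]
  by (intro smooth.add smooth.mult smooth_diff smooth.coord smooth.const smooth_pd) auto

lemma smooth_generator:
  assumes "smooth n (Suc (Suc k)) F" "n \<ge> 1"
  shows "smooth n k (generator \<gamma> \<gamma>' Tm Tp \<tau> n F)"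
  unfolding generator_def[abs_def] using assms smooth_mono[OF assms(1), of "Suc k"]
  by (intro smooth.add smooth.mult smooth.const smooth_hamiltonian_op smooth_exchange_op smooth_bath_op) auto

section \<open>Error terms produced by the cutoff\<close>

definition bath_error :: "nat \<Rightarrow> real \<Rightarrow> coord \<Rightarrow> (config \<Rightarrow> real) \<Rightarrow> real \<Rightarrow> config \<Rightarrow> real" where
  "bath_error n T c q \<epsilon> z =
     T * (- 12 * cutoff n \<epsilon> z * (z c * pd c q z) - 6 * cutoff n \<epsilon> z * q z + 24 * \<epsilon> * ((z c)\<^sup>2 * q z))
     + 6 * cutoff n \<epsilon> z * ((z c)\<^sup>2 * q z)"

text \<open>One factor \<open>\<epsilon> * cutoff n \<epsilon> z\<close> is left outside, to be
  paired with one power of the norm in \<open>normsq_cut_bound\<close>. The exchange noise leaves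
  nothing here; the Hamiltonian part does, because the boundary tension does not conserve the
  norm.\<close>

definition cutoff_error ::
  "real \<Rightarrow> real \<Rightarrow> real \<Rightarrow> real \<Rightarrow> nat \<Rightarrow> (config \<Rightarrow> real) \<Rightarrow> real \<Rightarrow> config \<Rightarrow> real" where
  "cutoff_error \<gamma>' Tm Tp \<tau> n q \<epsilon> z =
     (real n)\<^sup>2 * (- 3 * cutoff n \<epsilon> z * (q z * hamiltonian_op n \<tau> (normsq n) z)
       + \<gamma>' / 2 * (bath_error n Tm (Mom 0) q \<epsilon> z + bath_error n Tp (Mom n) q \<epsilon> z))"

lemma bath_term_cutoff:
  fixes \<epsilon> :: real
  assumes q: "smooth n 2 q" and c: "c \<in> coords n"
  defines "F \<equiv> (\<lambda>z. q z * cutoff n \<epsilon> z ^ 3)"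
  shows "T * pd c (pd c F) z - z c * pd c F z =
    (T * pd c (pd c q) z - z c * pd c q z) * cutoff n \<epsilon> z ^ 3 + \<epsilon> * (cutoff n \<epsilon> z * bath_error n T c q \<epsilon> z)"
proof -
  have q2: "smooth n (Suc (Suc 0)) q" and q1: "smooth n (Suc 0) q"
    using q smooth_mono[OF q, of 1] by (simp_all add: numeral_2_eq_2)
  have s: "smooth n (Suc (Suc 0)) (\<lambda>z. cutoff n \<epsilon> z ^ 3)" "smooth n (Suc 0) (\<lambda>z. cutoff n \<epsilon> z ^ 3)"
    "smooth n (Suc 0) (\<lambda>z. cutoff n \<epsilon> z ^ 2)" by (auto intro: smooth.cutoff)
  have p\<psi>: "pd c (\<lambda>z. cutoff n \<epsilon> z ^ 3) = (\<lambda>z. (- 6 * \<epsilon>) * (z c * cutoff n \<epsilon> z ^ 2))"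
    using pd_cutoff[OF c, of \<epsilon> 1] by (simp add: numeral_3_eq_3 numeral_2_eq_2)
  have p2: "pd c (\<lambda>z. cutoff n \<epsilon> z ^ 2) = (\<lambda>z. (- 4 * \<epsilon>) * (z c * cutoff n \<epsilon> z))"
    using pd_cutoff[OF c, of \<epsilon> 0] by (simp add: numeral_2_eq_2)
  have zc: "smooth n (Suc 0) (\<lambda>z. z c)" using c by (rule smooth.coord)
  have pp\<psi>: "pd c (\<lambda>z. (- 6 * \<epsilon>) * (z c * cutoff n \<epsilon> z ^ 2)) =
      (\<lambda>z. (- 6 * \<epsilon>) * (cutoff n \<epsilon> z ^ 2 + z c * ((- 4 * \<epsilon>) * (z c * cutoff n \<epsilon> z))))"
    unfolding pd_cmult[OF smooth.mult[OF zc s(3)] c] pd_mult[OF zc s(3) c] p2 pd_coord by simp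
  have pF: "pd c F = (\<lambda>z. pd c q z * cutoff n \<epsilon> z ^ 3 + q z * ((- 6 * \<epsilon>) * (z c * cutoff n \<epsilon> z ^ 2)))"
    unfolding F_def pd_mult[OF q2 s(1) c] p\<psi> ..
  have spsi: "smooth n (Suc 0) (\<lambda>z. (- 6 * \<epsilon>) * (z c * cutoff n \<epsilon> z ^ 2))"
    by (intro smooth.mult smooth.const zc s)
  have ppF: "pd c (pd c F) z = pd c (pd c q) z * cutoff n \<epsilon> z ^ 3 + 2 * (pd c q z * ((- 6 * \<epsilon>) * (z c * cutoff n \<epsilon> z ^ 2)))
      + q z * ((- 6 * \<epsilon>) * (cutoff n \<epsilon> z ^ 2 + z c * ((- 4 * \<epsilon>) * (z c * cutoff n \<epsilon> z))))"
    unfolding pF pd_add[OF smooth.mult[OF smooth_pd[OF q2 c] s(2)] smooth.mult[OF q1 spsi] c]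
      pd_mult[OF smooth_pd[OF q2 c] s(2) c] pd_mult[OF q1 spsi c] p\<psi> pp\<psi> by simp
  show ?thesis
    unfolding ppF fun_cong[OF pF] bath_error_def by (simp add: algebra_simps power2_eq_square power3_eq_cube)
qed

lemma generator_cutoff:
  assumes q: "smooth n 2 q" and n: "n \<ge> 1"
  shows "generator \<gamma> \<gamma>' Tm Tp \<tau> n (\<lambda>z. q z * cutoff n \<epsilon> z ^ 3) z =
    generator \<gamma> \<gamma>' Tm Tp \<tau> n q z * cutoff n \<epsilon> z ^ 3 + \<epsilon> * (cutoff n \<epsilon> z * cutoff_error \<gamma>' Tm Tp \<tau> n q \<epsilon> z)"
proof -
  have s: "smooth n (Suc 1) (\<lambda>z. cutoff n \<epsilon> z ^ 3)" by (auto intro: smooth.cutoff)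
  have q': "smooth n (Suc 1) q" using q by (simp add: numeral_2_eq_2)
  have b: "bath_op n Tm Tp F z = (Tm * pd (Mom 0) (pd (Mom 0) F) z - z (Mom 0) * pd (Mom 0) F z)
      + (Tp * pd (Mom n) (pd (Mom n) F) z - z (Mom n) * pd (Mom n) F z)" for F
    unfolding bath_op_def by simp
  show ?thesis
    unfolding generator_def hamiltonian_op_mult[OF q' s n] hamiltonian_op_cutoff[OF n] exchange_op_cutoff[OF q]
      b bath_term_cutoff[OF q, of "Mom 0" Tm \<epsilon>, simplified] 
      bath_term_cutoff[OF q, of "Mom n" Tp \<epsilon>, simplified] cutoff_error_def
    by (simp add: algebra_simps power2_eq_square power3_eq_cube)
qed

lemma cutoff_nonneg: "0 \<le> cutoff n \<epsilon> z"
  unfolding cutoff_def by simp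

lemma cutoff_le_one: "\<epsilon> \<ge> 0 \<Longrightarrow> cutoff n \<epsilon> z \<le> 1"
  unfolding cutoff_def using normsq_nonneg[of n z] by auto

text \<open>On the support of the cutoff \<open>\<epsilon> * normsq n z \<le> 1\<close>. Thus the
  factor \<open>\<epsilon>\<close> pays for one of the two powers of \<open>1 + normsq n z\<close>
  in the error, and the remaining power is integrable.\<close>

lemma normsq_cut_bound:
  fixes n :: nat and \<epsilon> :: real and z :: config
  assumes "0 < \<epsilon>" "\<epsilon> \<le> 1"
  shows "\<epsilon> * ((1 + normsq n z) * cutoff n \<epsilon> z) \<le> 2"
proof (cases "cutoff n \<epsilon> z = 0")
  case False
  then have "\<epsilon> * normsq n z \<le> 1" unfolding cutoff_def by (auto simp: max_def split: if_splits)
  then have *: "\<epsilon> * (1 + normsq n z) \<le> 2" using assms by (simp add: algebra_simps)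
  have "(\<epsilon> * (1 + normsq n z)) * cutoff n \<epsilon> z \<le> 2 * 1"
    using * cutoff_nonneg[of n \<epsilon> z] cutoff_le_one[of \<epsilon> n z] assms by (intro mult_mono) auto
  then show ?thesis by simp
qed simp

lemma abs_mult_le:
  fixes a b :: real
  shows "\<bar>a\<bar> \<le> A \<Longrightarrow> \<bar>b\<bar> \<le> B \<Longrightarrow> \<bar>a * b\<bar> \<le> A * B"
  unfolding abs_mult by (rule mult_mono) auto

lemma growth_constant_nonneg:
  fixes x K W :: real
  shows "\<bar>x\<bar> \<le> K * W \<Longrightarrow> W > 0 \<Longrightarrow> K \<ge> 0"
  using zero_le_mult_iff[of K W] abs_ge_zero[of x] by linarith

text \<open>A quadratic \<open>q\<close> meets a quadratic factor from differentiating the cutoff,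
  hence the squared norm factor. The constant must be uniform in \<open>\<epsilon>\<close>;
  \<open>\<epsilon> \<le> 1\<close> controls the term from the second derivative of the
  cutoff.\<close>

lemma cutoff_error_bound:
  assumes n: "n \<ge> 1" and qg: "quad_growth n q"
    and pq: "\<And>c. c \<in> coords n \<Longrightarrow> quad_growth n (\<lambda>z. z c * pd c q z)"
  obtains K where "\<And>\<epsilon> z. 0 < \<epsilon> \<Longrightarrow> \<epsilon> \<le> 1 \<Longrightarrow>
    \<bar>cutoff_error \<gamma>' Tm Tp \<tau> n q \<epsilon> z\<bar> \<le> K * (1 + normsq n z)\<^sup>2"
proof -
  have pdN: "pd c (normsq n) z = 2 * z c" if "c \<in> coords n" for c z
    using pd_eq[OF has_pd_normsq[OF that]] by simp
  have "quad_growth n (hamiltonian_op n \<tau> (normsq n))"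
    unfolding hamiltonian_op_def[abs_def]
    using n by (intro quad_growth_add quad_growth_sum quad_growth_mult lin_growth_diff lin_growth_coord
        lin_growth_const) (auto simp: pdN intro!: lin_growth_cmult lin_growth_coord)
  then obtain K1 where K1: "\<And>z. \<bar>hamiltonian_op n \<tau> (normsq n) z\<bar> \<le> K1 * (1 + normsq n z)"
    unfolding quad_growth_def by blast
  obtain K0 where K0: "\<And>z. \<bar>q z\<bar> \<le> K0 * (1 + normsq n z)"
    using qg unfolding quad_growth_def by blast
  have K0_nonneg: "K0 \<ge> 0"
    using growth_constant_nonneg[OF K0[of undefined]] normsq_nonneg[of n undefined] by simp
  have B: "\<exists>K. \<forall>\<epsilon> z. 0 < \<epsilon> \<longrightarrow> \<epsilon> \<le> 1 \<longrightarrow> \<bar>bath_error n T c q \<epsilon> z\<bar> \<le> K * (1 + normsq n z)\<^sup>2"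
    if c: "c \<in> coords n" for T c
  proof -
    obtain K2 where K2: "\<And>z. \<bar>z c * pd c q z\<bar> \<le> K2 * (1 + normsq n z)"
      using pq[OF c] unfolding quad_growth_def by blast
    have K2_nonneg: "K2 \<ge> 0"
      using growth_constant_nonneg[OF K2[of undefined]] normsq_nonneg[of n undefined] by simp
    show ?thesis
    proof (intro exI allI impI)
      fix \<epsilon> :: real and z assume \<epsilon>: "0 < \<epsilon>" "\<epsilon> \<le> 1"
      define W where "W = 1 + normsq n z"
      have W: "W \<ge> 1" "W \<le> W\<^sup>2" "(z c)\<^sup>2 \<le> W"
        unfolding W_def using normsq_nonneg[of n z] square_le_normsq[OF c, of z]
        by (auto simp: power2_eq_square algebra_simps)
      define u where "u = cutoff n \<epsilon> z"
      have u: "\<bar>u\<bar> \<le> 1" unfolding u_def using cutoff_nonneg[of n \<epsilon> z] cutoff_le_one[of \<epsilon> n z] \<epsilon> by simp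
      have lin: "\<bar>u * (z c * pd c q z)\<bar> \<le> 1 * (K2 * W)" "\<bar>u * q z\<bar> \<le> 1 * (K0 * W)"
        unfolding W_def by (rule abs_mult_le[OF u K2], rule abs_mult_le[OF u K0])
      have "\<bar>(z c)\<^sup>2 * q z\<bar> \<le> W * (K0 * W)"
        using K0 W W_def by (intro abs_mult_le) auto
      then have quad: "\<bar>(z c)\<^sup>2 * q z\<bar> \<le> K0 * W\<^sup>2" by (simp add: power2_eq_square mult.left_commute mult.commute)
      have "\<bar>\<epsilon>\<bar> \<le> 1" using \<epsilon> by simp
      then have e: "\<bar>\<epsilon> * ((z c)\<^sup>2 * q z)\<bar> \<le> 1 * (K0 * W\<^sup>2)"
        using quad by (rule abs_mult_le)
      have u3: "\<bar>u * ((z c)\<^sup>2 * q z)\<bar> \<le> 1 * (K0 * W\<^sup>2)"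
        using u quad by (rule abs_mult_le)
      have l2: "K2 * W \<le> K2 * W\<^sup>2" "K0 * W \<le> K0 * W\<^sup>2" using K2_nonneg K0_nonneg W
        by (auto intro!: mult_left_mono)
      have "\<bar>- 12 * (u * (z c * pd c q z)) - 6 * (u * q z) + 24 * (\<epsilon> * ((z c)\<^sup>2 * q z))\<bar>
          \<le> 12 * (K2 * W\<^sup>2) + 30 * (K0 * W\<^sup>2)"
        using lin e l2 by linarith
      then have "\<bar>T * (- 12 * (u * (z c * pd c q z)) - 6 * (u * q z) + 24 * (\<epsilon> * ((z c)\<^sup>2 * q z)))\<bar>
          \<le> \<bar>T\<bar> * (12 * (K2 * W\<^sup>2) + 30 * (K0 * W\<^sup>2))"
        by (intro abs_mult_le) auto
      then have "\<bar>T * (- 12 * (u * (z c * pd c q z)) - 6 * (u * q z) + 24 * (\<epsilon> * ((z c)\<^sup>2 * q z)))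
            + 6 * (u * ((z c)\<^sup>2 * q z))\<bar>
          \<le> \<bar>T\<bar> * (12 * (K2 * W\<^sup>2) + 30 * (K0 * W\<^sup>2)) + 6 * (K0 * W\<^sup>2)"
        using u3 by linarith
      then show "\<bar>bath_error n T c q \<epsilon> z\<bar> \<le> (\<bar>T\<bar> * (12 * K2 + 30 * K0) + 6 * K0) * (1 + normsq n z)\<^sup>2"
        unfolding bath_error_def u_def[symmetric] W_def[symmetric] by (simp add: algebra_simps)
    qed
  qed
  obtain A where A: "\<And>\<epsilon> z. 0 < \<epsilon> \<Longrightarrow> \<epsilon> \<le> 1 \<Longrightarrow> \<bar>bath_error n Tm (Mom 0) q \<epsilon> z\<bar> \<le> A * (1 + normsq n z)\<^sup>2"
    using B[of "Mom 0" Tm] by auto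
  obtain A' where A': "\<And>\<epsilon> z. 0 < \<epsilon> \<Longrightarrow> \<epsilon> \<le> 1 \<Longrightarrow> \<bar>bath_error n Tp (Mom n) q \<epsilon> z\<bar> \<le> A' * (1 + normsq n z)\<^sup>2"
    using B[of "Mom n" Tp] by auto
  show ?thesis
  proof (rule that)
    fix \<epsilon> :: real and z assume \<epsilon>: "0 < \<epsilon>" "\<epsilon> \<le> 1"
    define W where "W = 1 + normsq n z"
    define u where "u = cutoff n \<epsilon> z"
    have u: "\<bar>u\<bar> \<le> 1" unfolding u_def using cutoff_nonneg[of n \<epsilon> z] cutoff_le_one[of \<epsilon> n z] \<epsilon> by simp
    have "\<bar>u * (q z * hamiltonian_op n \<tau> (normsq n) z)\<bar> \<le> 1 * ((K0 * W) * (K1 * W))"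
      using K0 K1 u unfolding W_def by (intro abs_mult_le) auto
    then have 1: "\<bar>u * (q z * hamiltonian_op n \<tau> (normsq n) z)\<bar> \<le> K0 * K1 * W\<^sup>2"
      by (simp add: power2_eq_square mult_ac)
    have "\<bar>bath_error n Tm (Mom 0) q \<epsilon> z + bath_error n Tp (Mom n) q \<epsilon> z\<bar> \<le> A * W\<^sup>2 + A' * W\<^sup>2"
      using A[OF \<epsilon>, of z] A'[OF \<epsilon>, of z] unfolding W_def by linarith
    then have 2: "\<bar>\<gamma>' / 2 * (bath_error n Tm (Mom 0) q \<epsilon> z + bath_error n Tp (Mom n) q \<epsilon> z)\<bar>
        \<le> \<bar>\<gamma>' / 2\<bar> * (A * W\<^sup>2 + A' * W\<^sup>2)"
      by (intro abs_mult_le) auto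
    have "\<bar>- 3 * u * (q z * hamiltonian_op n \<tau> (normsq n) z)
       + \<gamma>' / 2 * (bath_error n Tm (Mom 0) q \<epsilon> z + bath_error n Tp (Mom n) q \<epsilon> z)\<bar>
      \<le> 3 * (K0 * K1 * W\<^sup>2) + \<bar>\<gamma>' / 2\<bar> * (A * W\<^sup>2 + A' * W\<^sup>2)"
      using 1 2 by (simp add: mult.assoc)
    then have "\<bar>cutoff_error \<gamma>' Tm Tp \<tau> n q \<epsilon> z\<bar>
        \<le> (real n)\<^sup>2 * (3 * (K0 * K1 * W\<^sup>2) + \<bar>\<gamma>' / 2\<bar> * (A * W\<^sup>2 + A' * W\<^sup>2))"
      unfolding cutoff_error_def u_def[symmetric] by (intro abs_mult_le) auto
    then show "\<bar>cutoff_error \<gamma>' Tm Tp \<tau> n q \<epsilon> z\<bar> \<le>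
        ((real n)\<^sup>2 * (3 * K0 * K1 + \<bar>\<gamma>' / 2\<bar> * (A + A'))) * (1 + normsq n z)\<^sup>2"
      unfolding W_def[symmetric] by (simp add: algebra_simps add_divide_distrib)
  qed
qed

text \<open>The cutoff error is of fourth order, but with its prefactor it is at most
  \<open>2 * K * (1 + normsq n z)\<close> for all \<open>\<epsilon> \<le> 1\<close>, and it vanishes
  pointwise as \<open>\<epsilon>\<close> tends to 0. Dominated convergence thus needs second moments
  only.\<close>

lemma stationary_quadratic:
  assumes semi: "diffusion_semigroup n (generator \<gamma> \<gamma>' Tm Tp \<tau> n) P"
    and stat: "stationary_measure n P \<mu>" and mom: "finite_second_moments n \<mu>" and n: "n \<ge> 1"
    and q: "smooth n 2 q" "quad_growth n q"
    and pq: "\<And>c. c \<in> coords n \<Longrightarrow> quad_growth n (\<lambda>z. z c * pd c q z)"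
    and Lq: "quad_growth n (generator \<gamma> \<gamma>' Tm Tp \<tau> n q)"
  shows "(\<integral>z. generator \<gamma> \<gamma>' Tm Tp \<tau> n q z \<partial>\<mu>) = 0"
proof -
  interpret prob_space \<mu> using stat unfolding stationary_measure_def by blast
  have sets_\<mu>: "sets \<mu> = sets (config_space n)" using stat unfolding stationary_measure_def by auto
  have meas_\<mu>: "f \<in> borel_measurable \<mu>" if "f \<in> borel_measurable (config_space n)" for f :: "config \<Rightarrow> real"
    using that measurable_cong_sets[OF sets_\<mu> refl] by blast
  let ?L = "generator \<gamma> \<gamma>' Tm Tp \<tau> n"
  obtain K where K: "\<And>\<epsilon> z. 0 < \<epsilon> \<Longrightarrow> \<epsilon> \<le> 1 \<Longrightarrow>
      \<bar>cutoff_error \<gamma>' Tm Tp \<tau> n q \<epsilon> z\<bar> \<le> K * (1 + normsq n z)\<^sup>2"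
    using cutoff_error_bound[OF n q(2) pq] by metis
  have K_nonneg: "K \<ge> 0"
    using growth_constant_nonneg[OF K[of 1 undefined]] normsq_nonneg[of n undefined] by simp
  obtain K0 where K0: "\<And>z. \<bar>q z\<bar> \<le> K0 * (1 + normsq n z)"
    using q(2) unfolding quad_growth_def by blast
  obtain K1 where K1: "\<And>z. \<bar>?L q z\<bar> \<le> K1 * (1 + normsq n z)"
    using Lq unfolding quad_growth_def by blast
  have "K0 \<ge> 0" "K1 \<ge> 0"
    using growth_constant_nonneg[OF K0[of undefined]] growth_constant_nonneg[OF K1[of undefined]]
      normsq_nonneg[of n undefined] by simp_all
  define F where "F \<epsilon> z = q z * cutoff n \<epsilon> z ^ 3" for \<epsilon> z
  have F_smooth: "smooth n 2 (F \<epsilon>)" for \<epsilon>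
    unfolding F_def[abs_def] by (intro smooth.mult smooth.cutoff q) auto
  have q_meas: "?L q \<in> borel_measurable \<mu>"
    using q(1) unfolding numeral_2_eq_2 by (intro meas_\<mu> smooth_measurable[OF smooth_generator[OF _ n]])
  have LF_meas: "?L (F \<epsilon>) \<in> borel_measurable (config_space n)" for \<epsilon>
    using F_smooth unfolding numeral_2_eq_2 by (intro smooth_measurable[OF smooth_generator[OF _ n]])
  have LF: "?L (F \<epsilon>) z = ?L q z * cutoff n \<epsilon> z ^ 3 + \<epsilon> * (cutoff n \<epsilon> z * cutoff_error \<gamma>' Tm Tp \<tau> n q \<epsilon> z)" for \<epsilon> z
    unfolding F_def[abs_def] by (rule generator_cutoff[OF q(1) n])
  have cut3: "cutoff n \<epsilon> z ^ 3 \<le> cutoff n \<epsilon> z" "0 \<le> cutoff n \<epsilon> z ^ 3" "cutoff n \<epsilon> z ^ 3 \<le> 1" if "0 < \<epsilon>" for \<epsilon> z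
    using cutoff_nonneg[of n \<epsilon> z] cutoff_le_one[of \<epsilon> n z] that power_decreasing[of 1 3 "cutoff n \<epsilon> z"] power_le_one[of "cutoff n \<epsilon> z" 3] by auto
  have err: "\<bar>\<epsilon> * (cutoff n \<epsilon> z * cutoff_error \<gamma>' Tm Tp \<tau> n q \<epsilon> z)\<bar>
      \<le> K * (1 + normsq n z) * (\<epsilon> * ((1 + normsq n z) * cutoff n \<epsilon> z))" if "0 < \<epsilon>" "\<epsilon> \<le> 1" for \<epsilon> z
  proof -
    have "\<epsilon> * cutoff n \<epsilon> z * \<bar>cutoff_error \<gamma>' Tm Tp \<tau> n q \<epsilon> z\<bar> \<le> \<epsilon> * cutoff n \<epsilon> z * (K * (1 + normsq n z)\<^sup>2)"
      using K[OF that] that cutoff_nonneg[of n \<epsilon> z] cutoff_le_one[of \<epsilon> n z] by (intro mult_left_mono) auto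
    then show ?thesis using that cutoff_nonneg[of n \<epsilon> z] cutoff_le_one[of \<epsilon> n z] by (simp add: abs_mult power2_eq_square mult_ac)
  qed
  have err2: "\<bar>\<epsilon> * (cutoff n \<epsilon> z * cutoff_error \<gamma>' Tm Tp \<tau> n q \<epsilon> z)\<bar> \<le> 2 * K * (1 + normsq n z)"
    if "0 < \<epsilon>" "\<epsilon> \<le> 1" for \<epsilon> z
  proof -
    have "K * (1 + normsq n z) * (\<epsilon> * ((1 + normsq n z) * cutoff n \<epsilon> z)) \<le> K * (1 + normsq n z) * 2"
      using normsq_cut_bound[OF that] K_nonneg normsq_nonneg[of n z] by (intro mult_left_mono) auto
    then show ?thesis using err[OF that, of z] by (simp add: algebra_simps)
  qed
  have growth_cutoff: "A * ((1 + normsq n z) * cutoff n \<epsilon> z) \<le> A * (2 / \<epsilon>)" if "0 < \<epsilon>" "\<epsilon> \<le> 1" "A \<ge> 0" for \<epsilon> z A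
    using normsq_cut_bound[OF that(1,2)] that
    by (intro mult_left_mono) (auto simp: field_simps)
  \<comment> \<open>These bounds may blow up like \<open>1 / \<epsilon>\<close>: they serve only to
    admit \<open>F \<epsilon>\<close> as a test function.\<close>
  have zero: "(\<integral>z. ?L (F \<epsilon>) z \<partial>\<mu>) = 0" if \<epsilon>: "0 < \<epsilon>" "\<epsilon> \<le> 1" for \<epsilon>
  proof (rule stationary_generator_integral[OF semi stat])
    show "C2 n (F \<epsilon>)" by (rule smooth_C2[OF F_smooth])
    show "compactly_supported n (F \<epsilon>)"
      unfolding F_def[abs_def] using \<epsilon> by (intro compactly_supported_cutoff) auto
    show "F \<epsilon> \<in> borel_measurable (config_space n)" by (rule smooth_measurable[OF F_smooth])
    show "?L (F \<epsilon>) \<in> borel_measurable (config_space n)" by (rule LF_meas)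
    have mono: "A * (1 + normsq n z) * cutoff n \<epsilon> z ^ 3 \<le> A * (1 + normsq n z) * cutoff n \<epsilon> z"
      if "A \<ge> 0" for A z
      using cut3[OF \<epsilon>(1)] that normsq_nonneg[of n z] by (intro mult_left_mono) auto
    show "\<bar>F \<epsilon> z\<bar> \<le> K0 * (2 / \<epsilon>)" for z
    proof -
      have "\<bar>F \<epsilon> z\<bar> \<le> (K0 * (1 + normsq n z)) * cutoff n \<epsilon> z ^ 3"
        unfolding F_def using K0[of z] cut3[OF \<epsilon>(1), of z] by (intro abs_mult_le) auto
      also have "\<dots> \<le> K0 * (1 + normsq n z) * cutoff n \<epsilon> z" by (rule mono[OF \<open>K0 \<ge> 0\<close>])
      also have "\<dots> \<le> K0 * (2 / \<epsilon>)" using growth_cutoff[OF \<epsilon> \<open>K0 \<ge> 0\<close>] by (simp add: mult.assoc)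
      finally show ?thesis .
    qed
    show "\<bar>?L (F \<epsilon>) z\<bar> \<le> K1 * (2 / \<epsilon>) + (2 * K) * (2 / \<epsilon>)" for z
    proof -
      have "\<bar>?L q z * cutoff n \<epsilon> z ^ 3\<bar> \<le> (K1 * (1 + normsq n z)) * cutoff n \<epsilon> z ^ 3"
        using K1[of z] cut3[OF \<epsilon>(1), of z] by (intro abs_mult_le) auto
      also have "\<dots> \<le> K1 * (1 + normsq n z) * cutoff n \<epsilon> z" by (rule mono[OF \<open>K1 \<ge> 0\<close>])
      also have "\<dots> \<le> K1 * (2 / \<epsilon>)" using growth_cutoff[OF \<epsilon> \<open>K1 \<ge> 0\<close>] by (simp add: mult.assoc)
      finally have 1: "\<bar>?L q z * cutoff n \<epsilon> z ^ 3\<bar> \<le> K1 * (2 / \<epsilon>)" .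
      have 2: "\<bar>\<epsilon> * (cutoff n \<epsilon> z * cutoff_error \<gamma>' Tm Tp \<tau> n q \<epsilon> z)\<bar> \<le> (2 * K) * (2 / \<epsilon>)"
      proof (cases "cutoff n \<epsilon> z = 0")
        case False
        then have "\<epsilon> * normsq n z \<le> 1" unfolding cutoff_def by (auto simp: max_def split: if_splits)
        then have "1 + normsq n z \<le> 2 / \<epsilon>" using \<epsilon> by (simp add: field_simps)
        then have "2 * K * (1 + normsq n z) \<le> (2 * K) * (2 / \<epsilon>)"
          using K_nonneg by (intro mult_left_mono) auto
        then show ?thesis using err2[OF \<epsilon>, of z] by linarith
      qed (use K_nonneg \<epsilon> in auto)
      show ?thesis unfolding LF using 1 2 by linarith
    qed
  qed
  define e where "e k = 1 / real (Suc k)" for k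
  have e: "0 < e k" "e k \<le> 1" for k unfolding e_def by auto
  have e_lim: "e \<longlonglongrightarrow> 0" unfolding e_def[abs_def]
    using LIMSEQ_inverse_real_of_nat by (simp add: inverse_eq_divide)
  have "(\<lambda>k. \<integral>z. ?L (F (e k)) z \<partial>\<mu>) \<longlonglongrightarrow> (\<integral>z. ?L q z \<partial>\<mu>)"
  proof (rule integral_dominated_convergence[where w = "\<lambda>z. (K1 + 2 * K) * (1 + normsq n z)"])
    show "?L q \<in> borel_measurable \<mu>" by (rule q_meas)
    show "?L (F (e k)) \<in> borel_measurable \<mu>" for k using LF_meas meas_\<mu> by blast
    show "integrable \<mu> (\<lambda>z. (K1 + 2 * K) * (1 + normsq n z))"
      using mom unfolding finite_second_moments_def normsq_def by auto
    show "AE z in \<mu>. norm (?L (F (e k)) z) \<le> (K1 + 2 * K) * (1 + normsq n z)" for k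
    proof (rule AE_I2)
      fix z
      have "\<bar>?L q z * cutoff n (e k) z ^ 3\<bar> \<le> (K1 * (1 + normsq n z)) * 1"
        using K1[of z] cut3[OF e(1), of k z] by (intro abs_mult_le) auto
      then show "norm (?L (F (e k)) z) \<le> (K1 + 2 * K) * (1 + normsq n z)"
        unfolding LF using err2[OF e, of k z] by (simp add: algebra_simps)
    qed
    show "AE z in \<mu>. (\<lambda>k. ?L (F (e k)) z) \<longlonglongrightarrow> ?L q z"
    proof (rule AE_I2)
      fix z
      have "(\<lambda>k. max 0 (1 - e k * normsq n z)) \<longlonglongrightarrow> max 0 (1 - 0 * normsq n z)"
        by (intro tendsto_intros e_lim)
      then have cut_lim: "(\<lambda>k. cutoff n (e k) z) \<longlonglongrightarrow> 1" unfolding cutoff_def by simp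
      have "(\<lambda>k. e k * (cutoff n (e k) z * cutoff_error \<gamma>' Tm Tp \<tau> n q (e k) z)) \<longlonglongrightarrow> 0"
      proof (rule Lim_null_comparison)
        show "(\<lambda>k. e k * (K * (1 + normsq n z) * ((1 + normsq n z) * cutoff n (e k) z))) \<longlonglongrightarrow> 0"
          using tendsto_mult[OF e_lim tendsto_mult[OF tendsto_const[of "K * (1 + normsq n z)"]
                tendsto_mult[OF tendsto_const[of "1 + normsq n z"] cut_lim]]] by simp
        show "\<forall>\<^sub>F k in sequentially. norm (e k * (cutoff n (e k) z * cutoff_error \<gamma>' Tm Tp \<tau> n q (e k) z))
            \<le> e k * (K * (1 + normsq n z) * ((1 + normsq n z) * cutoff n (e k) z))"
          using err[OF e] by (intro always_eventually) (auto simp: mult_ac)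
      qed
      moreover have "(\<lambda>k. ?L q z * cutoff n (e k) z ^ 3) \<longlonglongrightarrow> ?L q z * 1 ^ 3"
        by (intro tendsto_intros cut_lim)
      ultimately show "(\<lambda>k. ?L (F (e k)) z) \<longlonglongrightarrow> ?L q z"
        unfolding LF using tendsto_add by fastforce
    qed
  qed
  then show ?thesis unfolding zero[OF e] using LIMSEQ_unique tendsto_const by blast
qed

section \<open>Moment equations\<close>

definition force :: "nat \<Rightarrow> real \<Rightarrow> coord \<Rightarrow> config \<Rightarrow> real" where
  "force n \<tau> c z = (case c of
     Elong x \<Rightarrow> z (Mom x) - z (Mom (x - 1))
   | Mom x \<Rightarrow> (if x = n then \<tau> else z (Elong (x + 1))) - (if x = 0 then 0 else z (Elong x)))"

text \<open>The number of exchange bonds touching the coordinate. Coordinates are eigenfunctions of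
  the exchange operator, with minus this number as eigenvalue.\<close>

definition exchange_degree :: "nat \<Rightarrow> coord \<Rightarrow> real" where
  "exchange_degree n c = (case c of
     Elong x \<Rightarrow> 0
   | Mom x \<Rightarrow> (if x < n then 1 else 0) + (if x > 0 then 1 else 0))"

definition damping :: "nat \<Rightarrow> real \<Rightarrow> real \<Rightarrow> coord \<Rightarrow> real" where
  "damping n \<gamma> \<gamma>' c = \<gamma> / 2 * exchange_degree n c
     + \<gamma>' / 2 * ((if c = Mom 0 then 1 else 0) + (if c = Mom n then 1 else 0))"

definition drift :: "nat \<Rightarrow> real \<Rightarrow> real \<Rightarrow> real \<Rightarrow> coord \<Rightarrow> config \<Rightarrow> real" where
  "drift n \<gamma> \<gamma>' \<tau> c z = force n \<tau> c z - damping n \<gamma> \<gamma>' c * z c"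

text \<open>The image of the coordinate \<open>c\<close> under the rotation field of bond
  \<open>y\<close>. Products of two of them form the carre du champ of the exchange noise.\<close>

definition rot :: "nat \<Rightarrow> coord \<Rightarrow> config \<Rightarrow> real" where
  "rot y c z = (if c = Mom y then z (Mom (Suc y)) else 0) - (if c = Mom (Suc y) then z (Mom y) else 0)"

lemma sum_coords:
  fixes f :: "coord \<Rightarrow> 'a::comm_monoid_add"
  shows "(\<Sum>c\<in>coords n. f c) = (\<Sum>x = 1..n. f (Elong x)) + (\<Sum>x = 0..n. f (Mom x))"
proof -
  have "(\<Sum>c\<in>coords n. f c) = (\<Sum>c\<in>Elong ` {1..n}. f c) + (\<Sum>c\<in>Mom ` {0..n}. f c)"
    unfolding coords_def by (intro sum.union_disjoint) auto
  also have "\<dots> = (\<Sum>x = 1..n. f (Elong x)) + (\<Sum>x = 0..n. f (Mom x))"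
    by (simp add: sum.reindex inj_on_def)
  finally show ?thesis .
qed

lemma hamiltonian_op_force:
  assumes "n \<ge> 1"
  shows "hamiltonian_op n \<tau> F z = (\<Sum>c\<in>coords n. force n \<tau> c z * pd c F z)"
proof -
  have "{0..n} = insert 0 (insert n {1..<n})" using assms by auto
  then have "(\<Sum>x = 0..n. force n \<tau> (Mom x) z * pd (Mom x) F z) =
      z (Elong 1) * pd (Mom 0) F z + ((\<tau> - z (Elong n)) * pd (Mom n) F z
        + (\<Sum>x = 1..<n. (z (Elong (x + 1)) - z (Elong x)) * pd (Mom x) F z))"
    using assms by (simp add: force_def)
  then show ?thesis
    unfolding hamiltonian_op_def sum_coords by (simp add: force_def)
qed

lemma hamiltonian_op_coord:
  assumes "n \<ge> 1" "a \<in> coords n"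
  shows "hamiltonian_op n \<tau> (\<lambda>z. z a) z = force n \<tau> a z"
  unfolding hamiltonian_op_force[OF assms(1)] pd_coord using assms(2)
  by (simp add: if_distrib[of "(*) _"] sum.delta cong: if_cong)

lemma rotation_field_coord: "rotation_field y (\<lambda>z. z a) = rot y a"
  unfolding rotation_field_def[abs_def] pd_coord rot_def[abs_def] by auto

text \<open>On its own plane a rotation generator squares to minus the identity; on other
  coordinates it vanishes.\<close>

lemma rotation_field_rot:
  "rotation_field y (rot y a) z = - ((if a = Mom y then 1 else 0) + (if a = Mom (Suc y) then 1 else 0)) * z a"
proof -
  consider "a = Mom y" | "a = Mom (Suc y)" | "a \<noteq> Mom y" "a \<noteq> Mom (Suc y)" by blast
  then show ?thesis
  proof cases
    case 1
    then have "rot y a = (\<lambda>z. z (Mom (Suc y)))" unfolding rot_def by auto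
    then show ?thesis using 1 by (simp add: rotation_field_coord) (simp add: rot_def)
  next
    case 2
    then have r: "rot y a = (\<lambda>z. (-1) * z (Mom y))" unfolding rot_def by auto
    have "pd c (\<lambda>z. (-1) * z (Mom y)) z = - pd c (\<lambda>z. z (Mom y)) z" for c
      using pd_cmult[OF smooth.coord[of "Mom y" "Suc (Suc y)" "Suc 0"], of c "-1"]
        pd_eq[OF has_pd_mult[OF has_pd_const has_pd_coord], of c "-1" "Mom y"] pd_coord by simp
    then show ?thesis using 2 unfolding r rotation_field_def by (simp add: pd_coord)
  next
    case 3
    then have "rot y a = (\<lambda>z. 0)" unfolding rot_def by auto
    then show ?thesis using 3 by (simp add: rotation_field_def pd_const)
  qed
qed

lemma sum_exchange_degree:
  assumes "a \<in> coords n"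
  shows "(\<Sum>y<n. (if a = Mom y then 1 else 0) + (if a = Mom (Suc y) then 1 else (0::real))) = exchange_degree n a"
proof (cases a)
  case (Mom x)
  have "(\<Sum>y<n. if x = Suc y then 1 else (0::real)) = (\<Sum>y<n. if x > 0 \<and> x - 1 = y then 1 else 0)"
    by (intro sum.cong) auto
  then have "(\<Sum>y<n. if x = Suc y then 1 else (0::real)) = (if x > 0 then 1 else 0)"
    using assms Mom by (cases "x > 0") (auto simp: sum.delta)
  moreover have "(\<Sum>y<n. if x = y then 1 else (0::real)) = (if x < n then 1 else 0)"
    by (simp add: sum.delta')
  ultimately show ?thesis using Mom by (simp add: sum.distrib exchange_degree_def)
qed (simp add: exchange_degree_def)

lemma smooth_if:
  "(Q \<Longrightarrow> smooth n k f) \<Longrightarrow> (\<not> Q \<Longrightarrow> smooth n k g) \<Longrightarrow> smooth n k (\<lambda>z. if Q then f z else g z)"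
  by (cases Q) simp_all

lemma lin_growth_if:
  "(Q \<Longrightarrow> lin_growth n f) \<Longrightarrow> (\<not> Q \<Longrightarrow> lin_growth n g) \<Longrightarrow> lin_growth n (\<lambda>z. if Q then f z else g z)"
  by (cases Q) simp_all

lemma smooth_rot: "y < n \<Longrightarrow> a \<in> coords n \<Longrightarrow> smooth n k (rot y a)"
  unfolding rot_def[abs_def] by (intro smooth_diff smooth_if smooth.coord smooth.const) auto

lemma exchange_op_prod:
  assumes a: "a \<in> coords n" and b: "b \<in> coords n"
  shows "exchange_op n (\<lambda>z. z a * z b) z =
    - exchange_degree n a * (z a * z b) - exchange_degree n b * (z a * z b) + 2 * (\<Sum>y<n. rot y a z * rot y b z)"
proof -
  let ?d = "\<lambda>a y. (if a = Mom y then 1 else 0) + (if a = Mom (Suc y) then 1 else (0::real))"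
  have lin: "(\<Sum>y<n. - d y * X - e y * X + 2 * r y) = - (\<Sum>y<n. d y) * X - (\<Sum>y<n. e y) * X + 2 * (\<Sum>y<n. r y)"
    for d e r :: "nat \<Rightarrow> real" and X
    by (simp add: sum.distrib sum_subtractf sum_distrib_left sum_distrib_right sum_negf)
  have add: "rotation_field y (\<lambda>z. f z + g z) z = rotation_field y f z + rotation_field y g z"
    if "smooth n 1 f" "smooth n 1 g" "y < n" for f g y
    unfolding rotation_field_def using that by (simp add: pd_add[of n 0] algebra_simps)
  have "rotation_field y (rotation_field y (\<lambda>z. z a * z b)) z =
      - ?d a y * (z a * z b) - ?d b y * (z a * z b) + 2 * (rot y a z * rot y b z)" if y: "y < n" for y
  proof -
    have s: "smooth n (Suc 0) (\<lambda>z. z a)" "smooth n (Suc 0) (\<lambda>z. z b)"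
      using a b by (auto intro: smooth.coord)
    have r: "smooth n (Suc 0) (rot y a)" "smooth n (Suc 0) (rot y b)" using smooth_rot y a b by auto
    have "rotation_field y (rotation_field y (\<lambda>z. z a * z b)) z =
        rotation_field y (\<lambda>z. rot y a z * z b + z a * rot y b z) z"
      unfolding rotation_field_mult[OF s y] rotation_field_coord ..
    also have "\<dots> = rotation_field y (\<lambda>z. rot y a z * z b) z + rotation_field y (\<lambda>z. z a * rot y b z) z"
      using s r y by (intro add smooth.mult) auto
    also have "\<dots> = - ?d a y * (z a * z b) - ?d b y * (z a * z b) + 2 * (rot y a z * rot y b z)"
      unfolding rotation_field_mult[OF r(1) s(2) y] rotation_field_mult[OF s(1) r(2) y]
        rotation_field_coord rotation_field_rot by (simp add: algebra_simps)
    finally show ?thesis .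
  qed
  then have "exchange_op n (\<lambda>z. z a * z b) z =
      (\<Sum>y<n. - ?d a y * (z a * z b) - ?d b y * (z a * z b) + 2 * (rot y a z * rot y b z))"
    unfolding exchange_op_def by (intro sum.cong) auto
  also have "\<dots> = - (\<Sum>y<n. ?d a y) * (z a * z b) - (\<Sum>y<n. ?d b y) * (z a * z b)
      + 2 * (\<Sum>y<n. rot y a z * rot y b z)"
    by (rule lin)
  finally show ?thesis unfolding sum_exchange_degree[OF a] sum_exchange_degree[OF b] .
qed

lemma exchange_op_coord:
  assumes a: "a \<in> coords n"
  shows "exchange_op n (\<lambda>z. z a) z = - exchange_degree n a * z a"
proof -
  have "exchange_op n (\<lambda>z. z a) z =
     (\<Sum>y<n. - ((if a = Mom y then 1 else 0) + (if a = Mom (Suc y) then 1 else 0)) * z a)"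
    unfolding exchange_op_def rotation_field_coord rotation_field_rot ..
  also have "\<dots> = - (\<Sum>y<n. (if a = Mom y then 1 else 0) + (if a = Mom (Suc y) then 1 else 0)) * z a"
    unfolding sum_distrib_right sum_negf[symmetric] by simp
  finally show ?thesis unfolding sum_exchange_degree[OF a] .
qed

lemma generator_coord:
  assumes n: "n \<ge> 1" and a: "a \<in> coords n"
  shows "generator \<gamma> \<gamma>' Tm Tp \<tau> n (\<lambda>z. z a) z = (real n)\<^sup>2 * drift n \<gamma> \<gamma>' \<tau> a z"
  unfolding generator_def hamiltonian_op_coord[OF n a] exchange_op_coord[OF a] bath_op_def pd_coord pd_const
    drift_def damping_def
  using n by (auto simp: algebra_simps)

lemma pd_prod: "pd c (\<lambda>z. z a * z b) = (\<lambda>z. (if a = c then 1 else 0) * z b + z a * (if b = c then 1 else 0))"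
  by (intro pd_eq has_pd_mult has_pd_coord)

lemma pd_pd_prod: "pd c (pd c (\<lambda>z. z a * z b)) = (\<lambda>z. if a = c \<and> b = c then 2 else 0)"
proof -
  have "has_pd c (\<lambda>z. (if a = c then 1 else 0) * z b + z a * (if b = c then 1 else 0))
     (\<lambda>z. (0 * z b + (if a = c then 1 else 0) * (if b = c then 1 else 0)) +
          ((if a = c then 1 else 0) * (if b = c then 1 else 0) + z a * 0))"
    by (intro has_pd_add has_pd_mult has_pd_coord has_pd_const)
  from pd_eq[OF this] show ?thesis unfolding pd_prod by auto
qed

text \<open>The mixed term of the second-order Leibniz rule and the second derivative of a square
  both carry a factor 2, which cancels the halves in \<open>\<gamma> / 2\<close> and
  \<open>\<gamma>' / 2\<close>.\<close>

lemma generator_prod: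
  assumes n: "n \<ge> 1" and a: "a \<in> coords n" and b: "b \<in> coords n"
  shows "generator \<gamma> \<gamma>' Tm Tp \<tau> n (\<lambda>z. z a * z b) z = (real n)\<^sup>2 *
    (drift n \<gamma> \<gamma>' \<tau> a z * z b + z a * drift n \<gamma> \<gamma>' \<tau> b z + \<gamma> * (\<Sum>y<n. rot y a z * rot y b z)
     + \<gamma>' * ((if a = Mom 0 \<and> b = Mom 0 then Tm else 0) + (if a = Mom n \<and> b = Mom n then Tp else 0)))"
proof -
  have s: "smooth n (Suc 0) (\<lambda>z. z a)" "smooth n (Suc 0) (\<lambda>z. z b)"
    using a b by (auto intro: smooth.coord)
  have B: "bath_op n Tm Tp (\<lambda>z. z a * z b) z =
      2 * ((if a = Mom 0 \<and> b = Mom 0 then Tm else 0) + (if a = Mom n \<and> b = Mom n then Tp else 0))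
      - ((if a = Mom 0 then 1 else 0) + (if a = Mom n then 1 else 0)) * (z a * z b)
      - ((if b = Mom 0 then 1 else 0) + (if b = Mom n then 1 else 0)) * (z a * z b)"
    unfolding bath_op_def pd_pd_prod unfolding pd_prod using n by (auto simp: algebra_simps)
  show ?thesis
    unfolding generator_def hamiltonian_op_mult[OF s n] hamiltonian_op_coord[OF n a]
      hamiltonian_op_coord[OF n b] exchange_op_prod[OF a b] B drift_def damping_def
    by (simp add: field_simps)
qed

lemma lin_growth_drift:
  assumes "n \<ge> 1" "a \<in> coords n"
  shows "lin_growth n (drift n \<gamma> \<gamma>' \<tau> a)"
proof -
  have "lin_growth n (force n \<tau> a)"
    unfolding force_def[abs_def] using assms
    by (cases a) (auto intro!: lin_growth_diff lin_growth_if lin_growth_coord lin_growth_const)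
  then show ?thesis
    unfolding drift_def[abs_def] using assms by (intro lin_growth_diff lin_growth_cmult lin_growth_coord)
qed

lemma smooth_drift:
  assumes "n \<ge> 1" "a \<in> coords n"
  shows "smooth n k (drift n \<gamma> \<gamma>' \<tau> a)"
proof -
  have "smooth n k (force n \<tau> a)"
    unfolding force_def[abs_def] using assms
    by (cases a) (auto intro!: smooth_diff smooth_if smooth.coord smooth.const)
  then show ?thesis
    unfolding drift_def[abs_def] using assms by (intro smooth_diff smooth.mult smooth.const smooth.coord)
qed

lemma lin_growth_rot: "y < n \<Longrightarrow> lin_growth n (rot y a)"
  unfolding rot_def[abs_def]
  by (intro lin_growth_diff lin_growth_if lin_growth_coord lin_growth_const) auto

text \<open>The mean of \<open>rot y a z * rot y b z\<close>, written through a matrix of second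
  moments so that it can also be evaluated at the identity matrix and split over sums.\<close>

definition exchange_noise :: "(coord \<Rightarrow> coord \<Rightarrow> real) \<Rightarrow> nat \<Rightarrow> coord \<Rightarrow> coord \<Rightarrow> real" where
  "exchange_noise M y a b =
     (if a = Mom y \<and> b = Mom y then M (Mom (Suc y)) (Mom (Suc y)) else 0)
     + (if a = Mom (Suc y) \<and> b = Mom (Suc y) then M (Mom y) (Mom y) else 0)
     - (if a = Mom y \<and> b = Mom (Suc y) \<or> a = Mom (Suc y) \<and> b = Mom y then M (Mom y) (Mom (Suc y)) else 0)"

definition bath_noise :: "nat \<Rightarrow> real \<Rightarrow> real \<Rightarrow> coord \<Rightarrow> coord \<Rightarrow> real" where
  "bath_noise n Tm Tp a b =
     (if a = Mom 0 \<and> b = Mom 0 then Tm else 0) + (if a = Mom n \<and> b = Mom n then Tp else 0)"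

text \<open>
  The drift is affine: multiplying it by \<open>z b\<close> and averaging turns the boundary tension \<open>\<tau>\<close> into
  \<open>\<tau> * m b\<close>.
\<close>

definition moment_system ::
  "nat \<Rightarrow> real \<Rightarrow> real \<Rightarrow> real \<Rightarrow> real \<Rightarrow> real \<Rightarrow> (coord \<Rightarrow> real) \<Rightarrow> (coord \<Rightarrow> coord \<Rightarrow> real) \<Rightarrow> bool" where
  "moment_system n \<gamma> \<gamma>' Tm Tp \<tau> m M \<longleftrightarrow>
     (\<forall>a\<in>coords n. drift n \<gamma> \<gamma>' \<tau> a m = 0) \<and>
     (\<forall>a\<in>coords n. \<forall>b\<in>coords n.
        drift n \<gamma> \<gamma>' (\<tau> * m b) a (\<lambda>d. M d b) + drift n \<gamma> \<gamma>' (\<tau> * m a) b (\<lambda>d. M d a)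
        + \<gamma> * (\<Sum>y<n. exchange_noise M y a b) + \<gamma>' * bath_noise n Tm Tp a b = 0) \<and>
     (\<forall>a b. M a b = M b a) \<and>
     (\<forall>w. 0 \<le> (\<Sum>a\<in>coords n. \<Sum>b\<in>coords n. w a * w b * (M a b - m a * m b)))"

lemma drift_scale: "drift n \<gamma> \<gamma>' \<tau> a z * r = drift n \<gamma> \<gamma>' (\<tau> * r) a (\<lambda>d. z d * r)"
  unfolding drift_def force_def by (cases a) (auto simp: algebra_simps)

lemma integral_drift:
  assumes "n \<ge> 1" "a \<in> coords n" "\<And>d. d \<in> coords n \<Longrightarrow> integrable \<mu> (f d)" "integrable \<mu> g"
  shows "(\<integral>z. drift n \<gamma> \<gamma>' (g z) a (\<lambda>d. f d z) \<partial>\<mu>) =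
    drift n \<gamma> \<gamma>' (\<integral>z. g z \<partial>\<mu>) a (\<lambda>d. \<integral>z. f d z \<partial>\<mu>)"
  unfolding drift_def force_def using assms by (cases a) auto

lemma stationary_moment_system:
  assumes semi: "diffusion_semigroup n (generator \<gamma> \<gamma>' Tm Tp \<tau> n) P"
    and stat: "stationary_measure n P \<mu>" and fin: "finite_second_moments n \<mu>" and n: "n \<ge> 1"
  shows "moment_system n \<gamma> \<gamma>' Tm Tp \<tau> (\<lambda>a. \<integral>z. z a \<partial>\<mu>) (\<lambda>a b. \<integral>z. z a * z b \<partial>\<mu>)"
proof -
  interpret prob_space \<mu> using stat unfolding stationary_measure_def by blast
  have sets_\<mu>: "sets \<mu> = sets (config_space n)" using stat unfolding stationary_measure_def by auto
  have int: "integrable \<mu> f" if "quad_growth n f" "smooth n 0 f" for f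
    using quad_growth_integrable[OF that(1) smooth_measurable[OF that(2)]] prob_space_axioms sets_\<mu> fin .
  have int1: "integrable \<mu> (\<lambda>z. z a)" if "a \<in> coords n" for a
    using that by (intro int lin_imp_quad_growth lin_growth_coord smooth.coord)
  have int2: "integrable \<mu> (\<lambda>z. z a * z b)" if "a \<in> coords n" "b \<in> coords n" for a b
    using that by (intro int quad_growth_mult lin_growth_coord smooth.coord smooth.mult)
  define m where "m a = (\<integral>z. z a \<partial>\<mu>)" for a
  define M where "M a b = (\<integral>z. z a * z b \<partial>\<mu>)" for a b
  have sym: "M a b = M b a" for a b unfolding M_def by (simp add: mult.commute)
  have mean: "drift n \<gamma> \<gamma>' \<tau> a m = 0" if a: "a \<in> coords n" for a
  proof -
    have "(\<integral>z. generator \<gamma> \<gamma>' Tm Tp \<tau> n (\<lambda>z. z a) z \<partial>\<mu>) = 0"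
    proof (rule stationary_quadratic[OF semi stat fin n])
      show "quad_growth n (\<lambda>z. z c * pd c (\<lambda>z. z a) z)" if "c \<in> coords n" for c
        unfolding pd_coord using that by (intro quad_growth_mult lin_growth_coord lin_growth_const)
      show "quad_growth n (generator \<gamma> \<gamma>' Tm Tp \<tau> n (\<lambda>z. z a))"
        unfolding generator_coord[OF n a, abs_def]
        by (intro quad_growth_cmult lin_imp_quad_growth lin_growth_drift n a)
    qed (auto intro: smooth.coord lin_imp_quad_growth lin_growth_coord a)
    then have "(\<integral>z. drift n \<gamma> \<gamma>' \<tau> a z \<partial>\<mu>) = 0"
      unfolding generator_coord[OF n a] using n by simp
    then show ?thesis
      using integral_drift[OF n a, of \<mu> "\<lambda>d z. z d" "\<lambda>_. \<tau>" \<gamma> \<gamma>'] int1 unfolding m_def by (simp add: prob_space)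
  qed
  have second: "drift n \<gamma> \<gamma>' (\<tau> * m b) a (\<lambda>d. M d b) + drift n \<gamma> \<gamma>' (\<tau> * m a) b (\<lambda>d. M d a)
        + \<gamma> * (\<Sum>y<n. exchange_noise M y a b) + \<gamma>' * bath_noise n Tm Tp a b = 0"
    if a: "a \<in> coords n" and b: "b \<in> coords n" for a b
  proof -
    have gp: "generator \<gamma> \<gamma>' Tm Tp \<tau> n (\<lambda>z. z a * z b) z = (real n)\<^sup>2 *
      (drift n \<gamma> \<gamma>' (\<tau> * z b) a (\<lambda>d. z d * z b) + drift n \<gamma> \<gamma>' (\<tau> * z a) b (\<lambda>d. z d * z a)
       + \<gamma> * (\<Sum>y<n. rot y a z * rot y b z) + \<gamma>' * bath_noise n Tm Tp a b)" for z
      unfolding generator_prod[OF n a b] drift_scale[symmetric] bath_noise_def by simp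
    have "(\<integral>z. generator \<gamma> \<gamma>' Tm Tp \<tau> n (\<lambda>z. z a * z b) z \<partial>\<mu>) = 0"
    proof (rule stationary_quadratic[OF semi stat fin n])
      show "quad_growth n (\<lambda>z. z c * pd c (\<lambda>z. z a * z b) z)" if "c \<in> coords n" for c
        unfolding pd_prod
        by (intro quad_growth_mult lin_growth_add)
          (auto intro!: lin_imp_quad_growth lin_growth_coord lin_growth_const simp: that a b)
      show "quad_growth n (generator \<gamma> \<gamma>' Tm Tp \<tau> n (\<lambda>z. z a * z b))"
        unfolding generator_prod[OF n a b, abs_def]
        by (intro quad_growth_cmult quad_growth_add quad_growth_sum quad_growth_mult quad_growth_const
            lin_growth_drift lin_growth_coord lin_growth_rot n a b) auto
    qed (intro smooth.mult smooth.coord quad_growth_mult lin_growth_coord a b)+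
    moreover have i1: "integrable \<mu> (\<lambda>z. drift n \<gamma> \<gamma>' (\<tau> * z b) a (\<lambda>d. z d * z b))"
      "integrable \<mu> (\<lambda>z. drift n \<gamma> \<gamma>' (\<tau> * z a) b (\<lambda>d. z d * z a))"
      unfolding drift_scale[symmetric] using a b n
      by (auto intro!: int quad_growth_mult lin_growth_drift lin_growth_coord smooth.mult smooth_drift smooth.coord)
    moreover have i2: "integrable \<mu> (\<lambda>z. rot y a z * rot y b z)" if "y < n" for y
      using that a b by (intro int quad_growth_mult lin_growth_rot smooth.mult smooth_rot)
    moreover have i3: "integrable \<mu> (\<lambda>z. \<Sum>y<n. rot y a z * rot y b z)"
      using i2 by (intro Bochner_Integration.integrable_sum) auto
    ultimately have "drift n \<gamma> \<gamma>' (\<integral>z. \<tau> * z b \<partial>\<mu>) a (\<lambda>d. M d b)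
        + drift n \<gamma> \<gamma>' (\<integral>z. \<tau> * z a \<partial>\<mu>) b (\<lambda>d. M d a)
        + \<gamma> * (\<Sum>y<n. \<integral>z. rot y a z * rot y b z \<partial>\<mu>) + \<gamma>' * bath_noise n Tm Tp a b = 0"
      unfolding gp M_def using n int1 int2 a b
      by (simp add: integral_drift prob_space)
    moreover have "(\<integral>z. rot y a z * rot y b z \<partial>\<mu>) = exchange_noise M y a b" if "y < n" for y
    proof -
      have "(\<lambda>z. rot y a z * rot y b z) = (\<lambda>z. exchange_noise (\<lambda>a b. z a * z b) y a b)"
        unfolding rot_def exchange_noise_def by (auto simp: fun_eq_iff)
      then show ?thesis
        unfolding exchange_noise_def M_def using that int2 by auto
    qed
    ultimately show ?thesis unfolding m_def by simp
  qed
  have psd: "0 \<le> (\<Sum>a\<in>coords n. \<Sum>b\<in>coords n. w a * w b * (M a b - m a * m b))" for w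
  proof -
    have cov: "(\<integral>z. (z a - m a) * (z b - m b) \<partial>\<mu>) = M a b - m a * m b"
      and cov_int: "integrable \<mu> (\<lambda>z. (z a - m a) * (z b - m b))"
      if "a \<in> coords n" "b \<in> coords n" for a b
    proof -
      have eq: "(\<lambda>z. (z a - m a) * (z b - m b)) = (\<lambda>z. z a * z b - m b * z a - m a * z b + m a * m b)"
        by (auto simp: algebra_simps)
      show "integrable \<mu> (\<lambda>z. (z a - m a) * (z b - m b))"
        unfolding eq using that int1 int2 by auto
      show "(\<integral>z. (z a - m a) * (z b - m b) \<partial>\<mu>) = M a b - m a * m b"
        unfolding eq M_def using that int1 int2 by (simp add: prob_space m_def[symmetric] algebra_simps)
    qed
    have "0 \<le> (\<integral>z. (\<Sum>a\<in>coords n. w a * (z a - m a))\<^sup>2 \<partial>\<mu>)"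
      by (intro Bochner_Integration.integral_nonneg) auto
    also have "\<dots> = (\<integral>z. (\<Sum>a\<in>coords n. \<Sum>b\<in>coords n. w a * w b * ((z a - m a) * (z b - m b))) \<partial>\<mu>)"
      unfolding power2_eq_square sum_product by (simp add: mult_ac)
    also have "\<dots> = (\<Sum>a\<in>coords n. \<Sum>b\<in>coords n. w a * w b * (M a b - m a * m b))"
      using cov cov_int by (simp add: Bochner_Integration.integral_sum)
    finally show ?thesis .
  qed
  show ?thesis
    using mean second sym psd unfolding moment_system_def m_def M_def by blast
qed

section \<open>Inverse of the covariance matrix\<close>

definition quad_form :: "'a set \<Rightarrow> ('a \<Rightarrow> 'a \<Rightarrow> real) \<Rightarrow> ('a \<Rightarrow> real) \<Rightarrow> real" where
  "quad_form I C w = (\<Sum>a\<in>I. \<Sum>b\<in>I. w a * w b * C a b)"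

lemma quad_form_alt: "quad_form I C w = (\<Sum>a\<in>I. w a * (\<Sum>b\<in>I. C a b * w b))"
  unfolding quad_form_def by (simp add: sum_distrib_left mult_ac)

text \<open>Bordering: indices are added one at a time. \<open>u\<close> solves the old system with
  the new column as right-hand side, \<open>s\<close> is the Schur complement, and \<open>K'\<close>
  is the usual block inverse; only \<open>s > 0\<close> uses positivity.\<close>

lemma positive_definite_inverse:
  fixes C :: "'a \<Rightarrow> 'a \<Rightarrow> real"
  assumes "finite I" and sym: "\<And>a b. C a b = C b a"
    and "\<And>w. (\<exists>a\<in>I. w a \<noteq> 0) \<Longrightarrow> quad_form I C w > 0"
  shows "\<exists>K. (\<forall>a b. K a b = K b a) \<and>
    (\<forall>a\<in>I. \<forall>b\<in>I. (\<Sum>c\<in>I. K a c * C c b) = (if a = b then 1 else 0))"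
  using assms(1,3)
proof (induction I rule: finite_induct)
  case (insert i I)
  have "quad_form I C w > 0" if w: "\<exists>a\<in>I. w a \<noteq> 0" for w
  proof -
    have "quad_form (insert i I) C (w(i := 0)) > 0"
      using w insert.hyps by (intro insert.prems) auto
    also have "quad_form (insert i I) C (w(i := 0)) = quad_form I C (w(i := 0))"
      unfolding quad_form_def using insert.hyps by simp
    also have "\<dots> = quad_form I C w"
      unfolding quad_form_def using insert.hyps by (intro sum.cong refl) auto
    finally show ?thesis .
  qed
  then obtain K where K_sym: "\<And>a b. K a b = K b a"
    and K: "\<And>a b. a \<in> I \<Longrightarrow> b \<in> I \<Longrightarrow> (\<Sum>c\<in>I. K a c * C c b) = (if a = b then 1 else 0)"
    using insert.IH by blast
  define u where "u a = (\<Sum>b\<in>I. K a b * C b i)" for a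
  define s where "s = C i i - (\<Sum>a\<in>I. C i a * u a)"
  have Cu: "(\<Sum>c\<in>I. C b c * u c) = C b i" if "b \<in> I" for b
  proof -
    have "(\<Sum>c\<in>I. C b c * u c) = (\<Sum>d\<in>I. (\<Sum>c\<in>I. K d c * C c b) * C d i)"
      unfolding u_def sum_distrib_left sum_distrib_right
      by (subst sum.swap) (simp add: mult_ac sym[of b] K_sym)
    also have "\<dots> = (\<Sum>d\<in>I. if d = b then C d i else 0)"
      using that by (intro sum.cong) (auto simp: K)
    finally show ?thesis using that insert.hyps by (simp add: sum.delta)
  qed
  \<comment> \<open>At the vector that is 1 at \<open>i\<close> and \<open>- u\<close> on
    \<open>I\<close> the form collapses to the Schur complement.\<close>
  have "quad_form (insert i I) C (\<lambda>a. if a = i then 1 else - u a) > 0"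
    by (rule insert.prems) auto
  also have "quad_form (insert i I) C (\<lambda>a. if a = i then 1 else - u a) =
      (C i i - (\<Sum>b\<in>I. C i b * u b)) + (\<Sum>a\<in>I. - u a * (C a i - (\<Sum>b\<in>I. C a b * u b)))"
  proof -
    have r: "(\<Sum>b\<in>insert i I. C a b * (if b = i then 1 else - u b)) = C a i - (\<Sum>b\<in>I. C a b * u b)" for a
    proof -
      have "(\<Sum>b\<in>I. C a b * (if b = i then 1 else - u b)) = (\<Sum>b\<in>I. - (C a b * u b))"
        using insert.hyps by (intro sum.cong) auto
      then show ?thesis using insert.hyps by (simp add: sum_negf)
    qed
    have "(\<Sum>a\<in>I. (if a = i then 1 else - u a) * (C a i - (\<Sum>b\<in>I. C a b * u b))) =
        (\<Sum>a\<in>I. - u a * (C a i - (\<Sum>b\<in>I. C a b * u b)))"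
      using insert.hyps by (intro sum.cong) auto
    then show ?thesis unfolding quad_form_alt r using insert.hyps by simp
  qed
  finally have s_pos: "s > 0" unfolding s_def by (simp add: Cu)
  define K' where "K' a b =
    (if a = i \<and> b = i then 1 / s else if a = i then - u b / s else if b = i then - u a / s
     else K a b + u a * u b / s)" for a b
  have "(\<Sum>c\<in>insert i I. K' a c * C c b) = (if a = b then 1 else 0)"
    if a: "a \<in> insert i I" and b: "b \<in> insert i I" for a b
  proof (cases "a = i")
    case True
    have "(\<Sum>c\<in>I. K' i c * C c b) = (\<Sum>c\<in>I. - (C b c * u c) / s)"
      using insert.hyps by (intro sum.cong) (auto simp: K'_def sym[of b])
    also have "\<dots> = - (\<Sum>c\<in>I. C b c * u c) / s"
      by (simp add: sum_negf sum_divide_distrib)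
    finally have "(\<Sum>c\<in>insert i I. K' a c * C c b) = (C i b - (\<Sum>c\<in>I. C b c * u c)) / s"
      using insert.hyps True by (simp add: K'_def diff_divide_distrib)
    then show ?thesis
      using b True s_pos Cu[of b] sym[of i b] unfolding s_def by (cases "b = i") auto
  next
    case False
    then have aI: "a \<in> I" using a by simp
    have "(\<Sum>c\<in>I. K' a c * C c b) = (\<Sum>c\<in>I. K a c * C c b + u a / s * (C b c * u c))"
      using insert.hyps False by (intro sum.cong) (auto simp: K'_def sym[of b] algebra_simps)
    also have "\<dots> = (\<Sum>c\<in>I. K a c * C c b) + u a / s * (\<Sum>c\<in>I. C b c * u c)"
      by (simp add: sum.distrib sum_distrib_left)
    finally have "(\<Sum>c\<in>insert i I. K' a c * C c b) =
        (\<Sum>c\<in>I. K a c * C c b) + u a / s * ((\<Sum>c\<in>I. C b c * u c) - C i b)"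
      using insert.hyps False by (simp add: K'_def algebra_simps)
    moreover have "(\<Sum>c\<in>I. K a c * C c b) + u a / s * ((\<Sum>c\<in>I. C b c * u c) - C i b) = (if a = b then 1 else 0)"
    proof (cases "b = i")
      case True
      have "(\<Sum>c\<in>I. K a c * C c i) = u a" "(\<Sum>c\<in>I. C i c * u c) = C i i - s"
        unfolding u_def s_def by simp_all
      then show ?thesis using True False s_pos by simp
    next
      case False
      then have "b \<in> I" using b by simp
      then show ?thesis using K[OF aI] Cu sym[of i b] by simp
    qed
    ultimately show ?thesis by simp
  qed
  moreover have "K' a b = K' b a" for a b unfolding K'_def by (auto simp: K_sym)
  ultimately show ?case by blast
qed auto

text \<open>For \<open>v\<close> with entries \<open>\<alpha>\<close>, \<open>\<beta>\<close> and a
  vector \<open>\<sigma>\<close> with entries \<open>s\<close>, \<open>t\<close> at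
  \<open>x\<close>, \<open>y\<close>, this is the variational bound
  \<open>2 <v, \<sigma>> - <\<sigma>, C \<sigma>> \<le> <v, K v>\<close>, obtained by expanding the
  form of \<open>C\<close> at \<open>K v - \<sigma>\<close>.\<close>

lemma inverse_form_lower_bound:
  fixes C K :: "'a \<Rightarrow> 'a \<Rightarrow> real" and \<alpha> \<beta> s t :: real
  assumes fin: "finite I" and sym: "\<And>a b. C a b = C b a" and K_sym: "\<And>a b. K a b = K b a"
    and K: "\<And>a b. a \<in> I \<Longrightarrow> b \<in> I \<Longrightarrow> (\<Sum>c\<in>I. K a c * C c b) = (if a = b then 1 else 0)"
    and psd: "\<And>w. quad_form I C w \<ge> 0"
    and xy: "x \<in> I" "y \<in> I" "x \<noteq> y"
  shows "2 * (\<alpha> * s + \<beta> * t) - (s\<^sup>2 * C x x + 2 * s * t * C x y + t\<^sup>2 * C y y)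
    \<le> \<alpha>\<^sup>2 * K x x + 2 * \<alpha> * \<beta> * K x y + \<beta>\<^sup>2 * K y y"
proof -
  define e where "e p q c = (if c = x then p else 0) + (if c = y then q else (0::real))" for p q :: real and c
  define w where "w c = (\<alpha> * K x c + \<beta> * K y c) - e s t c" for c
  have e_sum: "(\<Sum>c\<in>I. f c * e p q c) = p * f x + q * f y" for f p q
  proof -
    have "(\<Sum>c\<in>I. f c * e p q c) = (\<Sum>c\<in>I. if c = x then p * f c else 0) + (\<Sum>c\<in>I. if c = y then q * f c else 0)"
      unfolding e_def sum.distrib[symmetric] by (intro sum.cong) (auto simp: algebra_simps)
    then show ?thesis using fin xy by (simp add: sum.delta)
  qed
  have Cw: "(\<Sum>b\<in>I. C a b * w b) = e \<alpha> \<beta> a - (s * C a x + t * C a y)" if a: "a \<in> I" for a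
  proof -
    have "(\<Sum>b\<in>I. C a b * w b) =
        (\<alpha> * (\<Sum>b\<in>I. K x b * C b a) + \<beta> * (\<Sum>b\<in>I. K y b * C b a)) - (\<Sum>b\<in>I. C a b * e s t b)"
      unfolding w_def sum_distrib_left sum.distrib[symmetric] sum_subtractf[symmetric]
      by (intro sum.cong) (auto simp: sym[of a] algebra_simps)
    then show ?thesis
      using K[OF xy(1) a] K[OF xy(2) a] unfolding e_sum by (auto simp: e_def)
  qed
  have Cwx: "(\<Sum>b\<in>I. w b * C b x) = \<alpha> - (s * C x x + t * C x y)"
    and Cwy: "(\<Sum>b\<in>I. w b * C b y) = \<beta> - (s * C x y + t * C y y)"
  proof -
    have swap: "(\<Sum>b\<in>I. w b * C b a) = (\<Sum>b\<in>I. C a b * w b)" for a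
      by (intro sum.cong refl) (metis sym mult.commute)
    have "e \<alpha> \<beta> x = \<alpha>" "e \<alpha> \<beta> y = \<beta>" unfolding e_def using xy(3) by auto
    then show "(\<Sum>b\<in>I. w b * C b x) = \<alpha> - (s * C x x + t * C x y)"
      "(\<Sum>b\<in>I. w b * C b y) = \<beta> - (s * C x y + t * C y y)"
      unfolding swap Cw[OF xy(1)] Cw[OF xy(2)] sym[of y x] by simp_all
  qed
  have "0 \<le> quad_form I C w" by (rule psd)
  also have "quad_form I C w = (\<Sum>a\<in>I. w a * e \<alpha> \<beta> a - (s * (w a * C a x) + t * (w a * C a y)))"
    unfolding quad_form_alt by (intro sum.cong refl) (simp only: Cw, simp add: algebra_simps)
  also have "\<dots> = (\<alpha> * w x + \<beta> * w y) - (s * (\<Sum>a\<in>I. w a * C a x) + t * (\<Sum>a\<in>I. w a * C a y))"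
    by (simp add: sum_subtractf sum.distrib sum_distrib_left e_sum)
  also have "\<dots> = (\<alpha>\<^sup>2 * K x x + 2 * \<alpha> * \<beta> * K x y + \<beta>\<^sup>2 * K y y)
      - (2 * (\<alpha> * s + \<beta> * t) - (s\<^sup>2 * C x x + 2 * s * t * C x y + t\<^sup>2 * C y y))"
    unfolding Cwx Cwy using xy(3) by (simp add: w_def e_def K_sym[of y x] power2_eq_square algebra_simps)
  finally show ?thesis by simp
qed

text \<open>Optimizing \<open>s\<close> and \<open>t\<close> shows that a two by two block of the
  inverse dominates the inverse of the block. The second bound pairs this with the adjugate of the
  block: with \<open>g\<close>, \<open>h\<close>, \<open>c\<close> its entries and \<open>D\<close>
  its determinant, \<open>h\<^sup>2 + 2 c\<^sup>2 + g\<^sup>2 - 2 D = (g - h)\<^sup>2 + 4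
  c\<^sup>2\<close> is nonnegative.\<close>

lemma inverse_block_bounds:
  fixes C K :: "'a \<Rightarrow> 'a \<Rightarrow> real"
  assumes fin: "finite I" and sym: "\<And>a b. C a b = C b a" and K_sym: "\<And>a b. K a b = K b a"
    and K: "\<And>a b. a \<in> I \<Longrightarrow> b \<in> I \<Longrightarrow> (\<Sum>c\<in>I. K a c * C c b) = (if a = b then 1 else 0)"
    and psd: "\<And>w. quad_form I C w \<ge> 0"
    and xy: "x \<in> I" "y \<in> I" "x \<noteq> y"
    and D: "C x x * C y y - (C x y)\<^sup>2 > 0" and Cyy: "C y y > 0"
  shows "C y y / (C x x * C y y - (C x y)\<^sup>2) \<le> K x x"
    and "2 \<le> C y y * K x x - 2 * C x y * K x y + C x x * K y y"
proof -
  let ?D = "C x x * C y y - (C x y)\<^sup>2"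
  note lower = inverse_form_lower_bound[OF fin sym K_sym K psd xy]
  have optimal: "(C y y * \<alpha>\<^sup>2 - 2 * C x y * \<alpha> * \<beta> + C x x * \<beta>\<^sup>2) / ?D
      \<le> \<alpha>\<^sup>2 * K x x + 2 * \<alpha> * \<beta> * K x y + \<beta>\<^sup>2 * K y y" for \<alpha> \<beta>
  proof -
    \<comment> \<open>The maximizer of the lower bound, given by Cramer's rule.\<close>
    define s where "s = (C y y * \<alpha> - C x y * \<beta>) / ?D"
    define t where "t = (C x x * \<beta> - C x y * \<alpha>) / ?D"
    have "s * C x x + t * C x y = (\<alpha> * ?D) / ?D"
      unfolding s_def t_def times_divide_eq_left add_divide_distrib[symmetric]
      by (rule arg_cong[where f = "\<lambda>x. x / ?D"]) (simp add: power2_eq_square algebra_simps)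
    moreover have "s * C x y + t * C y y = (\<beta> * ?D) / ?D"
      unfolding s_def t_def times_divide_eq_left add_divide_distrib[symmetric]
      by (rule arg_cong[where f = "\<lambda>x. x / ?D"]) (simp add: power2_eq_square algebra_simps)
    ultimately have 1: "s * C x x + t * C x y = \<alpha>" "s * C x y + t * C y y = \<beta>"
      using D by simp_all
    have "s\<^sup>2 * C x x + 2 * s * t * C x y + t\<^sup>2 * C y y
        = s * (s * C x x + t * C x y) + t * (s * C x y + t * C y y)"
      by (simp add: power2_eq_square algebra_simps)
    then have "2 * (\<alpha> * s + \<beta> * t) - (s\<^sup>2 * C x x + 2 * s * t * C x y + t\<^sup>2 * C y y) = \<alpha> * s + \<beta> * t"
      unfolding 1 by (simp add: algebra_simps)
    moreover have "\<alpha> * s + \<beta> * t = (C y y * \<alpha>\<^sup>2 - 2 * C x y * \<alpha> * \<beta> + C x x * \<beta>\<^sup>2) / ?D"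
      unfolding s_def t_def by (simp add: add_divide_distrib[symmetric] power2_eq_square algebra_simps)
    ultimately show ?thesis using lower[of \<alpha> s \<beta> t] by (simp only:)
  qed
  show "C y y / ?D \<le> K x x" using optimal[of 1 0] by simp
  let ?g = "C x x" and ?h = "C y y" and ?c = "C x y"
  \<comment> \<open>\<open>?h\<close> times the adjugate is the sum of the rank-one forms of
    \<open>(?h, - ?c)\<close> and of \<open>(0, 1)\<close> with weights 1 and \<open>?D\<close>, so
    \<open>optimal\<close> applies to each.\<close>
  have "?h * ((?h * K x x - 2 * ?c * K x y + ?g * K y y)) =
      ((?h)\<^sup>2 * K x x + 2 * ?h * (- ?c) * K x y + (- ?c)\<^sup>2 * K y y) + ?D * K y y"
    by (simp add: power2_eq_square algebra_simps)
  also have "\<dots> \<ge> (?h * ?h\<^sup>2 - 2 * ?c * ?h * (- ?c) + ?g * (- ?c)\<^sup>2) / ?D + ?D * (?g / ?D)"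
    using optimal[of ?h "- ?c"] optimal[of 0 1] D by (intro add_mono mult_left_mono) auto
  finally have *: "(?h * ?h\<^sup>2 - 2 * ?c * ?h * (- ?c) + ?g * (- ?c)\<^sup>2) / ?D + ?D * (?g / ?D)
     \<le> ?h * ((?h * K x x - 2 * ?c * K x y + ?g * K y y))" .
  have "?h\<^sup>2 + 2 * ?c\<^sup>2 + ?g\<^sup>2 = 2 * ?D + ((?g - ?h)\<^sup>2 + 4 * ?c\<^sup>2)"
    by (simp add: power2_eq_square algebra_simps)
  moreover have "0 \<le> (?g - ?h)\<^sup>2 + 4 * ?c\<^sup>2" by simp
  ultimately have "2 * ?D \<le> ?h\<^sup>2 + 2 * ?c\<^sup>2 + ?g\<^sup>2" by linarith
  then have "2 * ?D * ?h \<le> (?h\<^sup>2 + 2 * ?c\<^sup>2 + ?g\<^sup>2) * ?h"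
    using Cyy by (intro mult_right_mono) auto
  also have "\<dots> = (?h * ?h\<^sup>2 - 2 * ?c * ?h * (- ?c) + ?g * (- ?c)\<^sup>2) + ?D * ?g"
    by (simp add: power2_eq_square algebra_simps)
  also have "\<dots> = ((?h * ?h\<^sup>2 - 2 * ?c * ?h * (- ?c) + ?g * (- ?c)\<^sup>2) / ?D + ?D * (?g / ?D)) * ?D"
  proof -
    have "X + d * g = (X / d + d * (g / d)) * d" if "d > 0" for X d g :: real
      using that by (simp add: field_simps)
    then show ?thesis using D by blast
  qed
  also have "\<dots> \<le> (?h * ((?h * K x x - 2 * ?c * K x y + ?g * K y y))) * ?D"
    using * D by (intro mult_right_mono) auto
  finally have "2 * (?D * ?h) \<le> (?h * K x x - 2 * ?c * K x y + ?g * K y y) * (?D * ?h)"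
    by (simp add: algebra_simps)
  then show "2 \<le> ?h * K x x - 2 * ?c * K x y + ?g * K y y"
    using D Cyy by (simp add: mult_le_cancel_right)
qed

section \<open>Linear structure of the Lyapunov equation and its trace\<close>

lemma drift_add: "drift n \<gamma> \<gamma>' (s + t) a (\<lambda>d. f d + g d) = drift n \<gamma> \<gamma>' s a f + drift n \<gamma> \<gamma>' t a g"
  unfolding drift_def force_def by (cases a) (auto simp: algebra_simps)

lemma drift_zero: "drift n \<gamma> \<gamma>' 0 a (\<lambda>_. 0) = 0"
  unfolding drift_def force_def by (cases a) auto

lemma drift_sum:
  assumes "finite I"
  shows "drift n \<gamma> \<gamma>' 0 a (\<lambda>d. \<Sum>b\<in>I. k b * f b d) = (\<Sum>b\<in>I. k b * drift n \<gamma> \<gamma>' 0 a (f b))"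
  using assms
proof (induction I rule: finite_induct)
  case empty
  show ?case using drift_zero by simp
next
  case (insert i I)
  have "drift n \<gamma> \<gamma>' (0 + 0) a (\<lambda>d. k i * f i d + (\<Sum>b\<in>I. k b * f b d)) =
      drift n \<gamma> \<gamma>' 0 a (\<lambda>d. k i * f i d) + (\<Sum>b\<in>I. k b * drift n \<gamma> \<gamma>' 0 a (f b))"
    unfolding drift_add insert.IH ..
  moreover have "drift n \<gamma> \<gamma>' 0 a (\<lambda>d. k i * f i d) = k i * drift n \<gamma> \<gamma>' 0 a (f i)"
    using drift_scale[of n \<gamma> \<gamma>' 0 a "f i" "k i"] by (simp add: mult.commute)
  ultimately show ?case using insert.hyps by simp
qed

lemma drift_cong:
  assumes "n \<ge> 1" "a \<in> coords n" "\<And>d. d \<in> coords n \<Longrightarrow> f d = g d"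
  shows "drift n \<gamma> \<gamma>' \<tau> a f = drift n \<gamma> \<gamma>' \<tau> a g"
  unfolding drift_def force_def using assms by (cases a) auto

text \<open>Without tension the Hamiltonian field is linear with an antisymmetric matrix: its
  diagonal vanishes, and it contributes nothing to the balance of the identity covariance.\<close>

lemma force_antisymmetric:
  assumes "n \<ge> 1" "a \<in> coords n" "b \<in> coords n"
  shows "force n 0 a (\<lambda>d. if d = b then 1 else 0) + force n 0 b (\<lambda>d. if d = a then 1 else 0) = 0"
  unfolding force_def using assms by (cases a; cases b) auto

lemma exchange_noise_add: "exchange_noise (\<lambda>a b. M a b + N a b) y a b = exchange_noise M y a b + exchange_noise N y a b"
  unfolding exchange_noise_def by auto

lemma sum_exchange_noise_delta:
  assumes "a \<in> coords n"
  shows "(\<Sum>y<n. exchange_noise (\<lambda>a b. if a = b then 1 else 0) y a b) = (if a = b then exchange_degree n a else 0)"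
proof (cases "a = b")
  case True
  have "(\<Sum>y<n. exchange_noise (\<lambda>a b. if a = b then 1 else 0) y a b) =
     (\<Sum>y<n. (if a = Mom y then 1 else 0) + (if a = Mom (Suc y) then 1 else (0::real)))"
    using True by (intro sum.cong) (auto simp: exchange_noise_def)
  then show ?thesis using sum_exchange_degree[OF assms] True by simp
next
  case False
  then show ?thesis by (auto intro!: sum.neutral simp: exchange_noise_def)
qed

text \<open>Each of the \<open>n\<close> bonds is counted at both its ends with weight
  \<open>\<gamma> / 2\<close>, and each of the two baths once with weight
  \<open>\<gamma>' / 2\<close>.\<close>

lemma sum_damping:
  assumes "n \<ge> 1"
  shows "(\<Sum>a\<in>coords n. damping n \<gamma> \<gamma>' a) = \<gamma> * real n + \<gamma>'"
proof -
  have "(\<Sum>x = 0..n. if x < n then 1 else (0::real)) = real n"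
    using sum.inter_filter[of "{0..n}" "\<lambda>_. 1::real" "\<lambda>x. x < n", symmetric]
    by (simp add: Collect_conj_eq[symmetric] conj_commute) (smt (verit) Collect_cong card_Collect_less_nat less_or_eq_imp_le)
  moreover have "(\<Sum>x = 0..n. if x > 0 then 1 else (0::real)) = real n"
    by (induction n) auto
  ultimately have "(\<Sum>x = 0..n. exchange_degree n (Mom x)) = 2 * real n"
    unfolding exchange_degree_def by (simp add: sum.distrib)
  moreover have "(\<Sum>x = 0..n. (if Mom x = Mom 0 then 1 else 0) + (if Mom x = Mom n then 1 else (0::real))) = 2"
    by (simp add: sum.distrib sum.delta)
  ultimately have "(\<Sum>x = 0..n. damping n \<gamma> \<gamma>' (Mom x)) = \<gamma> * real n + \<gamma>'"
    unfolding damping_def sum.distrib[where A = "{0..n}"] sum_distrib_left[symmetric] by simp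
  moreover have "(\<Sum>x = 1..n. damping n \<gamma> \<gamma>' (Elong x)) = 0"
    by (simp add: damping_def exchange_degree_def)
  ultimately show ?thesis unfolding sum_coords by simp
qed

lemma sum_pair_delta:
  fixes K :: "'a \<Rightarrow> 'a \<Rightarrow> real"
  assumes "finite I" "x \<in> I" "y \<in> I"
  shows "(\<Sum>a\<in>I. \<Sum>b\<in>I. K a b * (if a = x \<and> b = y then r else 0)) = K x y * r"
proof -
  have "(\<Sum>a\<in>I. \<Sum>b\<in>I. K a b * (if a = x \<and> b = y then r else 0))
      = (\<Sum>a\<in>I. if a = x then (\<Sum>b\<in>I. if b = y then K x b * r else 0) else 0)"
    by (intro sum.cong) (auto intro!: sum.cong)
  then show ?thesis using assms by (simp add: sum.delta)
qed

lemma exchange_noise_trace: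
  assumes "y < n" "\<And>a b. K a b = K b a"
  shows "(\<Sum>a\<in>coords n. \<Sum>b\<in>coords n. K a b * exchange_noise M y a b) =
    M (Mom (Suc y)) (Mom (Suc y)) * K (Mom y) (Mom y) - 2 * M (Mom y) (Mom (Suc y)) * K (Mom y) (Mom (Suc y))
    + M (Mom y) (Mom y) * K (Mom (Suc y)) (Mom (Suc y))"
proof -
  let ?x = "Mom y" and ?y = "Mom (Suc y)"
  let ?d = "\<lambda>p q r a b. if a = p \<and> b = q then r else (0::real)"
  have "(\<Sum>a\<in>coords n. \<Sum>b\<in>coords n. K a b * exchange_noise M y a b) =
     (\<Sum>a\<in>coords n. \<Sum>b\<in>coords n. K a b * ?d ?x ?x (M ?y ?y) a b + K a b * ?d ?y ?y (M ?x ?x) a b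
       - (K a b * ?d ?x ?y (M ?x ?y) a b + K a b * ?d ?y ?x (M ?x ?y) a b))"
    by (intro sum.cong refl) (auto simp: exchange_noise_def)
  also have "\<dots> = K ?x ?x * M ?y ?y + K ?y ?y * M ?x ?x - (K ?x ?y * M ?x ?y + K ?y ?x * M ?x ?y)"
    unfolding sum.distrib sum_subtractf using assms(1) by (simp add: sum_pair_delta)
  finally show ?thesis using assms(2)[of ?y ?x] by (simp add: algebra_simps)
qed

lemma bath_noise_trace:
  assumes "n \<ge> 1"
  shows "(\<Sum>a\<in>coords n. \<Sum>b\<in>coords n. K a b * bath_noise n Tm Tp a b) =
    Tm * K (Mom 0) (Mom 0) + Tp * K (Mom n) (Mom n)"
proof -
  have "(\<Sum>a\<in>coords n. \<Sum>b\<in>coords n. K a b * bath_noise n Tm Tp a b) =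
     (\<Sum>a\<in>coords n. \<Sum>b\<in>coords n. K a b * (if a = Mom 0 \<and> b = Mom 0 then Tm else 0)
       + K a b * (if a = Mom n \<and> b = Mom n then Tp else 0))"
    by (simp only: bath_noise_def distrib_left)
  also have "\<dots> = K (Mom 0) (Mom 0) * Tm + K (Mom n) (Mom n) * Tp"
    unfolding sum.distrib by (simp add: sum_pair_delta)
  finally show ?thesis by (simp add: mult.commute)
qed

definition cov1 :: "(coord \<Rightarrow> real) \<Rightarrow> (coord \<Rightarrow> coord \<Rightarrow> real) \<Rightarrow> coord \<Rightarrow> coord \<Rightarrow> real" where
  "cov1 m M a b = M a b - m a * m b + (if a = b then 1 else 0)"

text \<open>
  The identity is the covariance at equilibrium temperature 1, so adding it to the centered
  covariance only raises both bath temperatures by 1, and makes the matrix invertible.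
\<close>

lemma cov1_balance:
  assumes n: "n \<ge> 1" and ms: "moment_system n \<gamma> \<gamma>' Tm Tp \<tau> m M"
    and a: "a \<in> coords n" and b: "b \<in> coords n"
  shows "drift n \<gamma> \<gamma>' 0 a (\<lambda>d. cov1 m M d b) + drift n \<gamma> \<gamma>' 0 b (\<lambda>d. cov1 m M d a)
    + \<gamma> * (\<Sum>y<n. exchange_noise (\<lambda>a b. M a b + (if a = b then 1 else 0)) y a b)
    + \<gamma>' * bath_noise n (Tm + 1) (Tp + 1) a b = 0"
proof -
  let ?\<delta> = "\<lambda>b d. if d = b then 1 else (0::real)"
  have split: "drift n \<gamma> \<gamma>' 0 a (\<lambda>d. cov1 m M d b) =
      drift n \<gamma> \<gamma>' (\<tau> * m b) a (\<lambda>d. M d b) + drift n \<gamma> \<gamma>' 0 a (?\<delta> b)"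
    if a: "a \<in> coords n" for a b
  proof -
    have "drift n \<gamma> \<gamma>' \<tau> a m = 0" using ms a unfolding moment_system_def by blast
    then have "drift n \<gamma> \<gamma>' (\<tau> * - m b) a (\<lambda>d. m d * - m b) = 0"
      unfolding drift_scale[symmetric] by simp
    then show ?thesis
      using drift_add[of n \<gamma> \<gamma>' "\<tau> * m b" "\<tau> * - m b" a "\<lambda>d. M d b" "\<lambda>d. m d * - m b"]
        drift_add[of n \<gamma> \<gamma>' 0 0 a "\<lambda>d. M d b - m d * m b" "?\<delta> b"]
      by (simp add: cov1_def)
  qed
  have delta: "drift n \<gamma> \<gamma>' 0 a (?\<delta> b) + drift n \<gamma> \<gamma>' 0 b (?\<delta> a)
      + \<gamma> * (\<Sum>y<n. exchange_noise (\<lambda>a b. if a = b then 1 else 0) y a b) + \<gamma>' * bath_noise n 1 1 a b = 0"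
    using force_antisymmetric[OF n a b] n unfolding sum_exchange_noise_delta[OF a] drift_def
    by (auto simp: damping_def bath_noise_def algebra_simps)
  have bath: "bath_noise n (Tm + 1) (Tp + 1) a b = bath_noise n Tm Tp a b + bath_noise n 1 1 a b"
    unfolding bath_noise_def by auto
  have "drift n \<gamma> \<gamma>' (\<tau> * m b) a (\<lambda>d. M d b) + drift n \<gamma> \<gamma>' (\<tau> * m a) b (\<lambda>d. M d a)
        + \<gamma> * (\<Sum>y<n. exchange_noise M y a b) + \<gamma>' * bath_noise n Tm Tp a b = 0"
    using ms a b unfolding moment_system_def by blast
  then show ?thesis
    using delta unfolding split[OF a] split[OF b] exchange_noise_add sum.distrib bath
    by (simp add: algebra_simps)
qed

lemma cov1_quad_form:
  assumes ms: "moment_system n \<gamma> \<gamma>' Tm Tp \<tau> m M"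
  shows "quad_form (coords n) (cov1 m M) w \<ge> (\<Sum>a\<in>coords n. (w a)\<^sup>2)"
proof -
  have "quad_form (coords n) (cov1 m M) w =
      (\<Sum>a\<in>coords n. \<Sum>b\<in>coords n. w a * w b * (M a b - m a * m b)) +
      (\<Sum>a\<in>coords n. \<Sum>b\<in>coords n. if b = a then w a * w b else 0)"
    unfolding quad_form_def cov1_def sum.distrib[symmetric]
    by (intro sum.cong refl) (auto simp: algebra_simps)
  also have "(\<Sum>a\<in>coords n. \<Sum>b\<in>coords n. if b = a then w a * w b else 0) = (\<Sum>a\<in>coords n. (w a)\<^sup>2)"
    by (intro sum.cong refl) (simp add: power2_eq_square)
  finally show ?thesis using ms unfolding moment_system_def by simp
qed

lemma quad_form_two:
  assumes "finite I" "x \<in> I" "y \<in> I" "x \<noteq> y"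
  shows "quad_form I C (\<lambda>a. if a = x then p else if a = y then q else 0) =
    p\<^sup>2 * C x x + p * q * C x y + p * q * C y x + q\<^sup>2 * C y y"
proof -
  let ?w = "\<lambda>a. if a = x then p else if a = y then q else 0"
  have e: "(\<Sum>c\<in>I. ?w c * f c) = p * f x + q * f y" for f :: "'a \<Rightarrow> real"
  proof -
    have "(\<Sum>c\<in>I. ?w c * f c) = (\<Sum>c\<in>{x, y}. ?w c * f c)"
      using assms by (intro sum.mono_neutral_right) auto
    then show ?thesis using assms(4) by auto
  qed
  have "(\<Sum>b\<in>I. C a b * ?w b) = p * C a x + q * C a y" for a
    using e[of "C a"] by (simp add: mult.commute)
  then show ?thesis
    unfolding quad_form_alt e by (simp add: power2_eq_square algebra_simps)
qed

text \<open>At the vector \<open>(h, - c)\<close> the form equals \<open>h\<close> times the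
  determinant.\<close>

lemma discriminant_pos:
  fixes g c h :: real
  assumes form: "\<And>p q. p\<^sup>2 * g + 2 * p * q * c + q\<^sup>2 * h \<ge> p\<^sup>2 + q\<^sup>2"
  shows "g * h - c\<^sup>2 > 0" "h > 0"
proof -
  have h: "h \<ge> 1" using form[of 0 1] by simp
  then show "h > 0" by simp
  have "h * (g * h - c\<^sup>2) = h\<^sup>2 * g + 2 * h * (- c) * c + (- c)\<^sup>2 * h"
    by (simp add: power2_eq_square algebra_simps)
  also have "\<dots> \<ge> h\<^sup>2 + (- c)\<^sup>2" by (rule form)
  finally have "h * (g * h - c\<^sup>2) > 0" using h by (smt (verit) zero_le_power2 zero_less_power)
  then show "g * h - c\<^sup>2 > 0" using h by (simp add: zero_less_mult_iff)
qed

lemma cov1_block: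
  assumes ms: "moment_system n \<gamma> \<gamma>' Tm Tp \<tau> m M"
    and xy: "x \<in> coords n" "y \<in> coords n" "x \<noteq> y"
  shows "cov1 m M x x * cov1 m M y y - (cov1 m M x y)\<^sup>2 > 0" "cov1 m M y y > 0"
proof -
  have "p\<^sup>2 * cov1 m M x x + 2 * p * q * cov1 m M x y + q\<^sup>2 * cov1 m M y y \<ge> p\<^sup>2 + q\<^sup>2" for p q
  proof -
    let ?w = "\<lambda>a. if a = x then p else if a = y then q else 0"
    have "(\<Sum>a\<in>coords n. (?w a)\<^sup>2) = (\<Sum>a\<in>{x, y}. (?w a)\<^sup>2)"
      using xy by (intro sum.mono_neutral_right) auto
    then have "(\<Sum>a\<in>coords n. (?w a)\<^sup>2) = p\<^sup>2 + q\<^sup>2" using xy(3) by auto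
    moreover have "cov1 m M y x = cov1 m M x y"
      using ms unfolding moment_system_def cov1_def by (auto simp: mult.commute)
    ultimately show ?thesis
      using cov1_quad_form[OF ms, of ?w] unfolding quad_form_two[OF finite_coords xy] by (simp add: algebra_simps)
  qed
  then show "cov1 m M x x * cov1 m M y y - (cov1 m M x y)\<^sup>2 > 0" "cov1 m M y y > 0"
    using discriminant_pos by blast+
qed

text \<open>\<open>cov1_balance\<close> is traced against the inverse \<open>K\<close> of
  \<open>C\<close>. The two drift terms give exactly
  \<open>- 2 * (\<gamma> * real n + \<gamma>')\<close> and the bonds at least
  \<open>2 * \<gamma> * real n\<close>, so the bulk cancels. What remains bounds the two end entries
  of \<open>K\<close>, which \<open>inverse_block_bounds\<close> estimates from below by blocks with
  arbitrary partners \<open>y\<close> and \<open>z\<close>.\<close>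

lemma boundary_precision_bound:
  assumes n: "n \<ge> 1" and \<gamma>: "\<gamma> > 0" "\<gamma>' > 0" and T: "Tm > 0" "Tp > 0"
    and ms: "moment_system n \<gamma> \<gamma>' Tm Tp \<tau> m M"
    and y: "y \<in> coords n" "y \<noteq> Mom 0" and z: "z \<in> coords n" "z \<noteq> Mom n"
  defines "C \<equiv> cov1 m M"
  shows "(Tm + 1) * (C y y / (C (Mom 0) (Mom 0) * C y y - (C (Mom 0) y)\<^sup>2))
    + (Tp + 1) * (C z z / (C (Mom n) (Mom n) * C z z - (C (Mom n) z)\<^sup>2)) \<le> 2"
proof -
  have M_sym: "M a b = M b a" for a b using ms unfolding moment_system_def by blast
  have C_sym: "C a b = C b a" for a b unfolding C_def cov1_def by (simp add: M_sym[of a b] mult.commute)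
  have psd: "quad_form (coords n) C w \<ge> 0" for w
    using cov1_quad_form[OF ms, of w] sum_nonneg[of "coords n" "\<lambda>a. (w a)\<^sup>2"] unfolding C_def by simp
  have pd: "quad_form (coords n) C w > 0" if w: "\<exists>a\<in>coords n. w a \<noteq> 0" for w
  proof -
    have "(\<Sum>a\<in>coords n. (w a)\<^sup>2) > 0"
      using w by (auto intro!: sum_pos2)
    then show ?thesis using cov1_quad_form[OF ms, of w] unfolding C_def by simp
  qed
  obtain K where K_sym: "\<And>a b. K a b = K b a"
    and K: "\<And>a b. a \<in> coords n \<Longrightarrow> b \<in> coords n \<Longrightarrow> (\<Sum>c\<in>coords n. K a c * C c b) = (if a = b then 1 else 0)"
    using positive_definite_inverse[OF finite_coords[of n] C_sym pd] by blast
  note block = inverse_block_bounds[OF finite_coords C_sym K_sym K psd]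
  define N where "N a b = M a b + (if a = b then 1 else (0::real))" for a b
  define D where "D a b = drift n \<gamma> \<gamma>' 0 a (\<lambda>d. C d b)" for a b
  have trace_drift: "(\<Sum>a\<in>coords n. \<Sum>b\<in>coords n. K a b * D a b) = - (\<gamma> * real n + \<gamma>')"
  proof -
    \<comment> \<open>Contracting with \<open>K\<close> turns the drift of the columns of
      \<open>C\<close> into the drift of a unit vector, whose diagonal part is the damping
      alone.\<close>
    have "(\<Sum>b\<in>coords n. K a b * D a b) = - damping n \<gamma> \<gamma>' a" if a: "a \<in> coords n" for a
    proof -
      have "(\<Sum>b\<in>coords n. K a b * D a b) = drift n \<gamma> \<gamma>' 0 a (\<lambda>d. \<Sum>b\<in>coords n. K a b * C d b)"
        unfolding D_def by (rule drift_sum[symmetric]) simp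
      also have "\<dots> = drift n \<gamma> \<gamma>' 0 a (\<lambda>d. if d = a then 1 else 0)"
      proof (rule drift_cong[OF n a])
        fix d assume d: "d \<in> coords n"
        have "(\<Sum>b\<in>coords n. K a b * C d b) = (\<Sum>b\<in>coords n. K a b * C b d)"
          by (intro sum.cong refl) (metis C_sym)
        then show "(\<Sum>b\<in>coords n. K a b * C d b) = (if d = a then 1 else 0)"
          unfolding K[OF a d] by auto
      qed
      also have "\<dots> = - damping n \<gamma> \<gamma>' a"
        using force_antisymmetric[OF n a a] unfolding drift_def by simp
      finally show ?thesis .
    qed
    then show ?thesis using sum_damping[OF n, of \<gamma> \<gamma>'] by (simp add: sum_negf)
  qed
  have "(\<Sum>a\<in>coords n. \<Sum>b\<in>coords n. K a b * D b a) = (\<Sum>a\<in>coords n. \<Sum>b\<in>coords n. K a b * D a b)"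
    by (subst sum.swap) (intro sum.cong refl, metis K_sym)
  then have trace_drift': "(\<Sum>a\<in>coords n. \<Sum>b\<in>coords n. K a b * D b a) = - (\<gamma> * real n + \<gamma>')"
    using trace_drift by simp
  have noise: "2 \<le> (\<Sum>a\<in>coords n. \<Sum>b\<in>coords n. K a b * exchange_noise N y a b)" if y: "y < n" for y
  proof -
    let ?x = "Mom y" and ?y = "Mom (Suc y)"
    have xy: "?x \<in> coords n" "?y \<in> coords n" "?x \<noteq> ?y" using y by auto
    have mean_eq: "m ?y = m ?x"
    proof -
      have "drift n \<gamma> \<gamma>' \<tau> (Elong (Suc y)) m = 0" using ms y unfolding moment_system_def by auto
      then show ?thesis by (simp add: drift_def force_def damping_def exchange_degree_def)
    qed
    \<comment> \<open>The noise is built from uncentered moments. Since all momenta share one mean,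
      its excess over the centered block is \<open>(m ?x)\<^sup>2\<close> times the form of
      \<open>K\<close> on the difference of two unit vectors, which is nonnegative.\<close>
    have NC: "N ?x ?x = C ?x ?x + (m ?x)\<^sup>2" "N ?y ?y = C ?y ?y + (m ?x)\<^sup>2" "N ?x ?y = C ?x ?y + (m ?x)\<^sup>2"
      unfolding N_def C_def cov1_def mean_eq by (simp_all add: power2_eq_square)
    have "0 \<le> K ?x ?x + 2 * (- 1) * K ?x ?y + K ?y ?y"
      using inverse_form_lower_bound[OF finite_coords C_sym K_sym K psd xy, of 1 0 "-1" 0] by simp
    then have "0 \<le> (m ?x)\<^sup>2 * (K ?x ?x - 2 * K ?x ?y + K ?y ?y)" by simp
    moreover have "2 \<le> C ?y ?y * K ?x ?x - 2 * C ?x ?y * K ?x ?y + C ?x ?x * K ?y ?y"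
      using cov1_block[OF ms xy] unfolding C_def[symmetric] by (intro block(2)[OF _ _ xy]) auto
    ultimately show ?thesis
      unfolding exchange_noise_trace[OF y K_sym] NC by (simp add: algebra_simps)
  qed
  have "0 = (\<Sum>a\<in>coords n. \<Sum>b\<in>coords n. K a b * (D a b + D b a
      + \<gamma> * (\<Sum>y<n. exchange_noise N y a b) + \<gamma>' * bath_noise n (Tm + 1) (Tp + 1) a b))"
    using cov1_balance[OF n ms] unfolding D_def C_def N_def by (intro sum.neutral[symmetric] ballI) simp
  also have "\<dots> = (\<Sum>a\<in>coords n. \<Sum>b\<in>coords n. K a b * D a b) + (\<Sum>a\<in>coords n. \<Sum>b\<in>coords n. K a b * D b a)
      + \<gamma> * (\<Sum>a\<in>coords n. \<Sum>b\<in>coords n. \<Sum>y<n. K a b * exchange_noise N y a b)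
      + \<gamma>' * (\<Sum>a\<in>coords n. \<Sum>b\<in>coords n. K a b * bath_noise n (Tm + 1) (Tp + 1) a b)"
    by (simp add: algebra_simps sum.distrib sum_distrib_left)
  also have "(\<Sum>a\<in>coords n. \<Sum>b\<in>coords n. \<Sum>y<n. K a b * exchange_noise N y a b) =
      (\<Sum>y<n. \<Sum>a\<in>coords n. \<Sum>b\<in>coords n. K a b * exchange_noise N y a b)"
    by (simp only: sum.swap[of _ "{..<n}"])
  finally have bal: "0 = - 2 * (\<gamma> * real n + \<gamma>')
      + \<gamma> * (\<Sum>y<n. \<Sum>a\<in>coords n. \<Sum>b\<in>coords n. K a b * exchange_noise N y a b)
      + \<gamma>' * ((Tm + 1) * K (Mom 0) (Mom 0) + (Tp + 1) * K (Mom n) (Mom n))"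
    unfolding trace_drift trace_drift' bath_noise_trace[OF n] by simp
  have "(\<Sum>y<n. 2) \<le> (\<Sum>y<n. \<Sum>a\<in>coords n. \<Sum>b\<in>coords n. K a b * exchange_noise N y a b)"
    using noise by (intro sum_mono) auto
  then have "\<gamma> * (2 * real n) \<le> \<gamma> * (\<Sum>y<n. \<Sum>a\<in>coords n. \<Sum>b\<in>coords n. K a b * exchange_noise N y a b)"
    using \<gamma> by (intro mult_left_mono) auto
  then have "\<gamma>' * ((Tm + 1) * K (Mom 0) (Mom 0) + (Tp + 1) * K (Mom n) (Mom n)) \<le> \<gamma>' * 2"
    using bal by (simp add: algebra_simps)
  then have le2: "(Tm + 1) * K (Mom 0) (Mom 0) + (Tp + 1) * K (Mom n) (Mom n) \<le> 2"
    using \<gamma> by simp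
  have "C y y / (C (Mom 0) (Mom 0) * C y y - (C (Mom 0) y)\<^sup>2) \<le> K (Mom 0) (Mom 0)"
    using y cov1_block[OF ms, of "Mom 0" y] unfolding C_def[symmetric] by (intro block(1)) auto
  moreover have "C z z / (C (Mom n) (Mom n) * C z z - (C (Mom n) z)\<^sup>2) \<le> K (Mom n) (Mom n)"
    using z cov1_block[OF ms, of "Mom n" z] unfolding C_def[symmetric] by (intro block(1)) auto
  ultimately have "(Tm + 1) * (C y y / (C (Mom 0) (Mom 0) * C y y - (C (Mom 0) y)\<^sup>2))
    + (Tp + 1) * (C z z / (C (Mom n) (Mom n) * C z z - (C (Mom n) z)\<^sup>2))
    \<le> (Tm + 1) * K (Mom 0) (Mom 0) + (Tp + 1) * K (Mom n) (Mom n)"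
    using T by (intro add_mono mult_left_mono) auto
  then show ?thesis using le2 by linarith
qed

section \<open>Covariances along the chain\<close>

lemma sum_exchange_noise_diag:
  assumes "x \<le> n"
  shows "(\<Sum>y<n. exchange_noise M y (Mom x) (Mom x)) =
    (if x < n then M (Mom (Suc x)) (Mom (Suc x)) else 0) + (if x > 0 then M (Mom (x - 1)) (Mom (x - 1)) else 0)"
proof -
  have "(\<Sum>y<n. exchange_noise M y (Mom x) (Mom x)) =
     (\<Sum>y<n. if x = y then M (Mom (Suc y)) (Mom (Suc y)) else 0) + (\<Sum>y<n. if x > 0 \<and> x - 1 = y then M (Mom y) (Mom y) else 0)"
    unfolding sum.distrib[symmetric] by (intro sum.cong) (auto simp: exchange_noise_def)
  also have "(\<Sum>y<n. if x > 0 \<and> x - 1 = y then M (Mom y) (Mom y) else 0) = (if x > 0 then M (Mom (x - 1)) (Mom (x - 1)) else 0)"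
    using assms by (cases "x > 0") (auto simp: sum.delta)
  finally show ?thesis by (simp add: sum.delta)
qed

lemma sum_exchange_noise_next:
  assumes "x < n"
  shows "(\<Sum>y<n. exchange_noise M y (Mom x) (Mom (Suc x))) = - M (Mom x) (Mom (Suc x))"
proof -
  have "(\<Sum>y<n. exchange_noise M y (Mom x) (Mom (Suc x))) = (\<Sum>y<n. if x = y then - M (Mom y) (Mom (Suc y)) else 0)"
    by (intro sum.cong) (auto simp: exchange_noise_def)
  then show ?thesis using assms by (simp add: sum.delta)
qed

lemma exchange_noise_Elong: "exchange_noise M y (Elong x) b = 0" "exchange_noise M y b (Elong x) = 0"
  unfolding exchange_noise_def by auto

text \<open>The moment equations at exchange rate 1. With \<open>n \<ge> 3\<close> the sites 1 and
  \<open>n - 1\<close> are distinct bulk sites, and \<open>real n \<le> 3 / 2 * (real n - 1)\<close>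
  holds in \<open>cur_bound\<close>.\<close>

locale chain_moments =
  fixes n :: nat and \<gamma>' Tm Tp \<tau> :: real and m :: "coord \<Rightarrow> real" and M :: "coord \<Rightarrow> coord \<Rightarrow> real"
  assumes n: "n \<ge> 3" and \<gamma>': "\<gamma>' > 0" and Tm: "Tm > 0" and Tp: "Tp > 0"
    and ms: "moment_system n 1 \<gamma>' Tm Tp \<tau> m M"
begin

definition kin :: "nat \<Rightarrow> real" where "kin x = M (Mom x) (Mom x)"
definition pot :: "nat \<Rightarrow> real" where "pot x = M (Elong x) (Elong x)"
definition mom_corr :: "nat \<Rightarrow> real" where "mom_corr x = M (Mom x) (Mom (Suc x))"
definition cross :: "nat \<Rightarrow> real" where "cross x = M (Elong x) (Mom x)"
definition far_cross :: "nat \<Rightarrow> real" where "far_cross x = M (Elong (Suc x)) (Mom (x - 1))"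
definition pbar :: real where "pbar = m (Mom 0)"
text \<open>The mean rate, in the time unit without the factor \<open>n\<^sup>2\<close>, at which
  the left bath feeds energy into the chain.\<close>

definition cur :: real where "cur = \<gamma>' / 2 * (Tm - kin 0)"

lemma M_sym: "M a b = M b a"
  using ms unfolding moment_system_def by blast

lemma mean_eq: "a \<in> coords n \<Longrightarrow> drift n 1 \<gamma>' \<tau> a m = 0"
  using ms unfolding moment_system_def by blast

lemma second_eq:
  "a \<in> coords n \<Longrightarrow> b \<in> coords n \<Longrightarrow>
   drift n 1 \<gamma>' (\<tau> * m b) a (\<lambda>d. M d b) + drift n 1 \<gamma>' (\<tau> * m a) b (\<lambda>d. M d a)
        + (\<Sum>y<n. exchange_noise M y a b) + \<gamma>' * bath_noise n Tm Tp a b = 0"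
  using ms unfolding moment_system_def by auto

lemma mean_Mom: "x \<le> n \<Longrightarrow> m (Mom x) = pbar"
proof (induction x)
  case (Suc x)
  then show ?case
    using mean_eq[of "Elong (Suc x)"] by (simp add: drift_def force_def damping_def exchange_degree_def)
qed (simp add: pbar_def)

lemma mean_Elong: "1 \<le> x \<Longrightarrow> x \<le> n \<Longrightarrow> m (Elong x) = pbar * (real x - 1 / 2 + \<gamma>' / 2)"
proof (induction x)
  case (Suc x)
  show ?case
  proof (cases "x = 0")
    case True
    have "m (Elong (Suc 0)) = (1 / 2 + \<gamma>' / 2) * m (Mom 0)"
      using mean_eq[of "Mom 0"] n by (simp add: drift_def force_def damping_def exchange_degree_def)
    then show ?thesis using True mean_Mom[of 0] by (simp add: algebra_simps)
  next
    case False
    have "m (Elong (Suc x)) = m (Elong x) + m (Mom x)"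
      using mean_eq[of "Mom x"] Suc.prems False
      by (simp add: drift_def force_def damping_def exchange_degree_def)
    then show ?thesis using Suc False mean_Mom[of x] by (simp add: algebra_simps)
  qed
qed simp

lemma pbar_eq: "pbar * (real n + \<gamma>') = \<tau>"
proof -
  have "\<tau> - m (Elong n) = (1 / 2 + \<gamma>' / 2) * m (Mom n)"
    using mean_eq[of "Mom n"] n by (simp add: drift_def force_def damping_def exchange_degree_def)
  then show ?thesis using mean_Elong[of n] mean_Mom[of n] n by (simp add: algebra_simps)
qed

text \<open>Stationarity of the mean of \<open>r_x\<^sup>2\<close>: no noise acts on elongations, so
  the momenta at both ends of a spring have the same moment with it.\<close>

lemma cross_alt: "1 \<le> x \<Longrightarrow> x \<le> n \<Longrightarrow> M (Elong x) (Mom (x - 1)) = cross x"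
  using second_eq[of "Elong x" "Elong x"] M_sym[of "Mom x" "Elong x"] M_sym[of "Mom (x - 1)" "Elong x"]
  by (simp add: drift_def force_def damping_def exchange_degree_def exchange_noise_Elong bath_noise_def cross_def)

lemma kin_bulk: "1 \<le> x \<Longrightarrow> x < n \<Longrightarrow>
  2 * (cross (Suc x) - cross x - kin x) + kin (Suc x) + kin (x - 1) = 0"
  using second_eq[of "Mom x" "Mom x"] cross_alt[of "Suc x"] sum_exchange_noise_diag[of x n M]
  by (simp add: drift_def force_def damping_def exchange_degree_def bath_noise_def kin_def cross_def)

lemma kin_left: "2 * cross 1 - (1 + \<gamma>') * kin 0 + kin 1 + \<gamma>' * Tm = 0"
  using second_eq[of "Mom 0" "Mom 0"] cross_alt[of 1] sum_exchange_noise_diag[of 0 n M] n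
  by (simp add: drift_def force_def damping_def exchange_degree_def bath_noise_def kin_def algebra_simps)

lemma kin_right: "2 * (\<tau> * pbar - cross n) - (1 + \<gamma>') * kin n + kin (n - 1) + \<gamma>' * Tp = 0"
  using second_eq[of "Mom n" "Mom n"] sum_exchange_noise_diag[of n n M] n mean_Mom[of n]
  by (simp add: drift_def force_def damping_def exchange_degree_def bath_noise_def kin_def cross_def algebra_simps)

text \<open>The energy flux through a bond has a Hamiltonian part \<open>- cross (Suc x)\<close> and
  an exchange part, half the difference of the kinetic moments. \<open>kin_left\<close> starts and
  \<open>kin_bulk\<close> propagates its constancy.\<close>

lemma current: "x < n \<Longrightarrow> cross (Suc x) = - cur + (kin x - kin (Suc x)) / 2"
proof (induction x)
  case 0
  then show ?case using kin_left unfolding cur_def by (simp add: field_simps)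
next
  case (Suc x)
  then show ?case using kin_bulk[of "Suc x"] by (simp add: field_simps)
qed

lemma cur_right: "- cur = \<tau> * pbar + \<gamma>' / 2 * (Tp - kin n)"
  using kin_right current[of "n - 1"] n by (simp add: field_simps)

text \<open>The equations for \<open>r_x p_x\<close> and \<open>r_(x+1) p_x\<close> are added: this
  removes \<open>kin x\<close> and the correlation of neighbouring elongations, for which no
  separate control exists.\<close>

lemma pot_bulk:
  assumes "1 \<le> x" "x < n"
  shows "pot (Suc x) - pot x + mom_corr x - mom_corr (x - 1) = cross x + cross (Suc x)"
proof -
  have "kin x - mom_corr (x - 1) + M (Elong (Suc x)) (Elong x) - pot x - cross x = 0"
    using second_eq[of "Elong x" "Mom x"] assms M_sym[of "Mom x" "Elong x"]
    by (simp add: drift_def force_def damping_def exchange_degree_def exchange_noise_Elong bath_noise_def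
        kin_def cross_def pot_def mom_corr_def)
  moreover have "mom_corr x - kin x + pot (Suc x) - M (Elong (Suc x)) (Elong x) - cross (Suc x) = 0"
    using second_eq[of "Elong (Suc x)" "Mom x"] assms M_sym[of "Mom x" "Elong (Suc x)"] cross_alt[of "Suc x"]
      M_sym[of "Elong x" "Elong (Suc x)"] M_sym[of "Mom x" "Mom (Suc x)"]
    by (simp add: drift_def force_def damping_def exchange_degree_def exchange_noise_Elong bath_noise_def
        kin_def cross_def pot_def mom_corr_def)
  ultimately show ?thesis by linarith
qed

lemma pot_left: "pot 1 + mom_corr 0 = kin 0 + (1 + \<gamma>') / 2 * cross 1"
  using second_eq[of "Elong 1" "Mom 0"] n M_sym[of "Mom 0" "Elong 1"] cross_alt[of 1]
    M_sym[of "Mom 0" "Mom (Suc 0)"]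
  by (simp add: drift_def force_def damping_def exchange_degree_def exchange_noise_Elong bath_noise_def
      kin_def pot_def mom_corr_def field_simps)

lemma pot_right: "pot n + mom_corr (n - 1) = kin n + \<tau> * m (Elong n) - (1 + \<gamma>') / 2 * cross n"
  using second_eq[of "Elong n" "Mom n"] n M_sym[of "Mom n" "Elong n"]
  by (simp add: drift_def force_def damping_def exchange_degree_def exchange_noise_Elong bath_noise_def
      kin_def pot_def mom_corr_def cross_def field_simps)

lemma next_cross:
  assumes "1 \<le> x" "x < n"
  shows "M (Elong x) (Mom (Suc x)) = cross x + far_cross x - cross (Suc x)"
  using second_eq[of "Elong x" "Elong (Suc x)"] assms M_sym[of "Mom x" "Elong (Suc x)"]
    M_sym[of "Mom (x - 1)" "Elong (Suc x)"] M_sym[of "Mom (Suc x)" "Elong x"] M_sym[of "Mom x" "Elong x"]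
    cross_alt[of "Suc x"]
  by (simp add: drift_def force_def damping_def exchange_degree_def exchange_noise_Elong bath_noise_def
      cross_def far_cross_def)

text \<open>The coefficient 3 is the damping 1 of each of the two momenta plus 1 from the noise of
  the bond they share. \<open>next_cross\<close>, the stationarity of \<open>r_x r_(x+1)\<close>,
  turns the force terms into an increment.\<close>

lemma mom_corr_bulk:
  assumes "1 \<le> x" "x + 2 \<le> n"
  shows "3 * mom_corr x = (cross (Suc x) + far_cross (Suc x)) - (cross x + far_cross x)"
  using second_eq[of "Mom x" "Mom (Suc x)"] assms sum_exchange_noise_next[of x n M] next_cross[of x]
    cross_alt[of "Suc x"] M_sym[of "Mom (Suc x)" "Mom x"]
  by (simp add: drift_def force_def damping_def exchange_degree_def bath_noise_def
      cross_def far_cross_def mom_corr_def)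

text \<open>\<open>(5 + \<gamma>') / 2\<close> collects the damping
  \<open>(1 + \<gamma>') / 2\<close> at the end, 1 at its neighbour, and 1 from the noise of the
  shared bond.\<close>

lemma mom_corr_left: "far_cross 1 = (5 + \<gamma>') / 2 * mom_corr 0"
  using second_eq[of "Mom 0" "Mom (Suc 0)"] n sum_exchange_noise_next[of 0 n M]
    cross_alt[of 1] M_sym[of "Mom (Suc 0)" "Mom 0"]
  by (simp add: drift_def force_def damping_def exchange_degree_def bath_noise_def
      cross_def far_cross_def mom_corr_def field_simps)

lemma mom_corr_right:
  "cross (n - 1) + far_cross (n - 1) = \<tau> * pbar + cross n - (5 + \<gamma>') / 2 * mom_corr (n - 1)"
proof -
  obtain k where k: "n = Suc k" "k \<ge> 2" using n by (cases n) auto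
  show ?thesis
    using second_eq[of "Mom k" "Mom n"] k sum_exchange_noise_next[of k n M] next_cross[of k]
      cross_alt[of n] M_sym[of "Mom n" "Mom k"] mean_Mom[of k]
    by (simp add: drift_def force_def damping_def exchange_degree_def bath_noise_def
        cross_def far_cross_def mom_corr_def field_simps)
qed

definition lin_profile :: "nat \<Rightarrow> real" where
  "lin_profile x = pot x + mom_corr (x - 1) + (kin x + kin (x - 1)) / 2"

text \<open>By \<open>current\<close> at two neighbouring bonds,
  \<open>cross x + cross (Suc x)\<close> is \<open>- 2 * cur\<close> plus half of
  \<open>kin (x - 1) - kin (Suc x)\<close>, and the averaged kinetic term of the profile absorbs
  this difference.\<close>

lemma lin_profile_step: "1 \<le> x \<Longrightarrow> x < n \<Longrightarrow> lin_profile (Suc x) = lin_profile x - 2 * cur"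
proof -
  assume x: "1 \<le> x" "x < n"
  then have "cross x = - cur + (kin (x - 1) - kin x) / 2" using current[of "x - 1"] by simp
  moreover have "lin_profile (Suc x) = pot (Suc x) + mom_corr x + (kin (Suc x) + kin x) / 2"
    unfolding lin_profile_def by simp
  ultimately show ?thesis
    using pot_bulk[OF x] current[OF x(2)] unfolding lin_profile_def[of x] add_divide_distrib diff_divide_distrib
    by linarith
qed

lemma lin_profile_eq: "1 \<le> x \<Longrightarrow> x \<le> n \<Longrightarrow> lin_profile x = lin_profile 1 - 2 * (real x - 1) * cur"
proof (induction x)
  case (Suc x)
  then show ?case using lin_profile_step[of x] by (cases "x = 0") (auto simp: algebra_simps)
qed simp

text \<open>The end momentum is damped at rate \<open>(1 + \<gamma>') / 2\<close>, whereas
  \<open>cross 1\<close> would cancel at rate 1; the mismatch leaves the coefficient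
  \<open>(\<gamma>' - 1) / 2\<close>.\<close>

lemma lin_profile_left: "lin_profile 1 = 2 * kin 0 - cur + (\<gamma>' - 1) / 2 * cross 1"
proof -
  have "(1 + \<gamma>') / 2 * cross 1 = (\<gamma>' - 1) / 2 * cross 1 + cross 1" by (simp add: field_simps)
  moreover have "cross 1 = - cur + (kin 0 - kin 1) / 2" using current[of 0] n by simp
  moreover have "lin_profile 1 = pot 1 + mom_corr 0 + (kin 1 + kin 0) / 2"
    unfolding lin_profile_def by simp
  ultimately show ?thesis using pot_left unfolding add_divide_distrib diff_divide_distrib by argo
qed

lemma lin_profile_right:
  "lin_profile n = 2 * kin n + \<tau> * m (Elong n) + cur + (1 - \<gamma>') / 2 * cross n"
proof -
  have "(1 + \<gamma>') / 2 * cross n = cross n - (1 - \<gamma>') / 2 * cross n" by (simp add: field_simps)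
  moreover have "cross n = - cur + (kin (n - 1) - kin n) / 2" using current[of "n - 1"] n by simp
  ultimately show ?thesis
    using pot_right unfolding lin_profile_def add_divide_distrib diff_divide_distrib by argo
qed

text \<open>The uncentered moments exceed the covariance by the square of a linear form, so they
  inherit its positivity.\<close>

lemma form_nonneg:
  assumes "a \<in> coords n" "b \<in> coords n" "a \<noteq> b"
  shows "0 \<le> p\<^sup>2 * M a a + 2 * p * q * M a b + q\<^sup>2 * M b b"
proof -
  let ?w = "\<lambda>c. if c = a then p else if c = b then q else 0"
  have "0 \<le> quad_form (coords n) (\<lambda>a b. M a b - m a * m b) ?w"
  proof -
    have "\<forall>w. 0 \<le> (\<Sum>a\<in>coords n. \<Sum>b\<in>coords n. w a * w b * (M a b - m a * m b))"
      using ms unfolding moment_system_def by (elim conjE)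
    from spec[OF this, of ?w] show ?thesis unfolding quad_form_def .
  qed
  also have "\<dots> = p\<^sup>2 * M a a + 2 * p * q * M a b + q\<^sup>2 * M b b - (p * m a + q * m b)\<^sup>2"
    unfolding quad_form_two[OF finite_coords assms] M_sym[of b a]
    by (simp add: power2_eq_square algebra_simps)
  finally show ?thesis using zero_le_power2[of "p * m a + q * m b"] by linarith
qed

lemma diag_nonneg: "a \<in> coords n \<Longrightarrow> 0 \<le> M a a"
  using form_nonneg[of a "if a = Mom 0 then Mom 1 else Mom 0" 1 0] n by (auto split: if_splits)

lemma abs_moment_le:
  assumes "a \<in> coords n" "b \<in> coords n" "a \<noteq> b"
  shows "2 * t * \<bar>M a b\<bar> \<le> M a a + t\<^sup>2 * M b b"
  using form_nonneg[OF assms, of 1 t] form_nonneg[OF assms, of 1 "- t"]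
  by (cases "M a b \<ge> 0") (simp_all add: algebra_simps)

text \<open>\<open>\<tau> * pbar\<close> is the power supplied by the tension; by
  \<open>pbar_eq\<close> it equals \<open>\<tau>\<^sup>2 / (real n + \<gamma>')\<close>.\<close>

lemma tension_work: "0 \<le> \<tau> * pbar" "\<tau> * pbar \<le> \<tau>\<^sup>2 / real n" "pbar\<^sup>2 \<le> \<tau>\<^sup>2 / real n"
  "\<bar>\<tau> * m (Elong n)\<bar> \<le> \<tau>\<^sup>2"
proof -
  have pos: "real n + \<gamma>' > 0" using n \<gamma>' by simp
  have p: "pbar = \<tau> / (real n + \<gamma>')" using pbar_eq pos by (simp add: field_simps)
  have tp: "\<tau> * pbar = \<tau>\<^sup>2 / (real n + \<gamma>')" unfolding p by (simp add: power2_eq_square)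
  then show "0 \<le> \<tau> * pbar" using pos by simp
  show le: "\<tau> * pbar \<le> \<tau>\<^sup>2 / real n"
    unfolding tp using n \<gamma>' by (intro divide_left_mono) auto
  have "pbar\<^sup>2 = \<tau>\<^sup>2 / (real n + \<gamma>')\<^sup>2" unfolding p by (simp add: power_divide)
  also have "\<dots> \<le> \<tau>\<^sup>2 / real n"
  proof (rule divide_left_mono)
    have "real n * 1 \<le> (real n + \<gamma>') * (real n + \<gamma>')" using n \<gamma>' by (intro mult_mono) auto
    then show "real n \<le> (real n + \<gamma>')\<^sup>2" by (simp add: power2_eq_square)
  qed (use n pos in auto)
  finally show "pbar\<^sup>2 \<le> \<tau>\<^sup>2 / real n" .
  have "\<tau> * m (Elong n) = \<tau>\<^sup>2 * ((real n - 1 / 2 + \<gamma>' / 2) / (real n + \<gamma>'))"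
    using mean_Elong[of n] n unfolding p by (simp add: power2_eq_square)
  moreover have "0 \<le> (real n - 1 / 2 + \<gamma>' / 2) / (real n + \<gamma>')" "(real n - 1 / 2 + \<gamma>' / 2) / (real n + \<gamma>') \<le> 1"
    using n \<gamma>' by (auto simp: field_simps)
  ultimately show "\<bar>\<tau> * m (Elong n)\<bar> \<le> \<tau>\<^sup>2"
    by (simp only: abs_mult abs_power2 abs_of_nonneg mult_left_le zero_le_power2)
qed

end

section \<open>Scalar inequalities for the two ends\<close>

text \<open>At the left end \<open>P0\<close>, \<open>P1\<close>, \<open>R\<close>,
  \<open>a\<close>, \<open>s\<close> stand for \<open>kin 0\<close>, \<open>kin 1\<close>,
  \<open>pot 1\<close>, \<open>cross 1\<close>, \<open>mom_corr 0\<close>; the right end is the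
  mirror image. \<open>R\<close> is bounded through \<open>a\<close> and \<open>a\<close> through
  \<open>R\<close>. The loop closes with the weight \<open>t = c + 1\<close> in Cauchy-Schwarz, for
  which \<open>(c + 1) * \<bar>a\<bar>\<close> costs only half of \<open>R\<close>.\<close>

lemma boundary_estimate:
  fixes P0 P1 R a s e J c \<sigma> K :: real
  assumes P: "0 \<le> P0" "P0 \<le> K" "0 \<le> P1" and J: "2 * \<bar>J\<bar> \<le> K" and e: "\<bar>e\<bar> \<le> K"
    and \<sigma>: "\<bar>\<sigma>\<bar> \<le> c"
    and R: "R + s = P0 + e + \<sigma> * a" and diff: "P1 \<le> P0 + 2 * \<bar>J\<bar> + 2 * \<bar>a\<bar>"
    and s: "2 * \<bar>s\<bar> \<le> P0 + P1" and a: "\<And>t. 2 * t * \<bar>a\<bar> \<le> R + t\<^sup>2 * P0"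
  shows "R \<le> (12 + (c + 1)\<^sup>2) * K" "\<bar>a\<bar> \<le> (12 + (c + 1)\<^sup>2) * K"
    "P1 \<le> (12 + (c + 1)\<^sup>2) * K" "\<bar>s\<bar> \<le> (12 + (c + 1)\<^sup>2) * K" "K \<le> (12 + (c + 1)\<^sup>2) * K"
proof -
  have K: "K \<ge> 0" using P by linarith
  have "\<bar>\<sigma> * a\<bar> \<le> c * \<bar>a\<bar>" unfolding abs_mult using \<sigma> by (intro mult_right_mono) auto
  then have 1: "R \<le> 4 * K + (c + 1) * \<bar>a\<bar>"
    using R P e s diff J by (simp add: distrib_right)
  have "2 * (c + 1) * \<bar>a\<bar> \<le> R + (c + 1)\<^sup>2 * P0" by (rule a)
  moreover have sq: "(c + 1)\<^sup>2 * P0 \<le> (c + 1)\<^sup>2 * K" using P by (intro mult_left_mono) auto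
  ultimately have R_le: "R \<le> 8 * K + (c + 1)\<^sup>2 * K" using 1 by linarith
  have cK: "0 \<le> (c + 1)\<^sup>2 * K" using K by simp
  have L: "(12 + (c + 1)\<^sup>2) * K = 12 * K + (c + 1)\<^sup>2 * K" by (simp add: distrib_right)
  have a_le: "2 * \<bar>a\<bar> \<le> 9 * K + (c + 1)\<^sup>2 * K" using a[of 1] R_le P by simp
  show "R \<le> (12 + (c + 1)\<^sup>2) * K" "\<bar>a\<bar> \<le> (12 + (c + 1)\<^sup>2) * K" "P1 \<le> (12 + (c + 1)\<^sup>2) * K"
    "\<bar>s\<bar> \<le> (12 + (c + 1)\<^sup>2) * K" "K \<le> (12 + (c + 1)\<^sup>2) * K"
    unfolding L using R_le a_le P diff J s K cK by linarith+
qed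

text \<open>\<open>v - \<alpha>\<^sup>2 / r\<close> is the residual variance, after regression on a
  variable of variance \<open>r\<close>, of a variable of variance \<open>v\<close> with covariance
  \<open>\<alpha>\<close>. It is at most \<open>T + \<eta>\<close>, and
  \<open>T / (T + \<eta>) \<ge> 1 - \<eta> / T\<close>.\<close>

lemma precision_lower_bound:
  fixes T v r \<alpha> \<delta> B :: real
  assumes T: "T > 0" and v: "v \<le> T + \<delta>" and r: "0 < r" "r \<le> B" and D: "v * r - \<alpha>\<^sup>2 > 0"
  shows "1 - (\<delta> - \<alpha>\<^sup>2 / B) / T \<le> T * (r / (v * r - \<alpha>\<^sup>2))"
proof -
  define \<eta> where "\<eta> = \<delta> - \<alpha>\<^sup>2 / B"
  have "\<alpha>\<^sup>2 / B \<le> \<alpha>\<^sup>2 / r" using r by (intro divide_left_mono) auto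
  then have le: "v - \<alpha>\<^sup>2 / r \<le> T + \<eta>" using v unfolding \<eta>_def by linarith
  have pos: "v - \<alpha>\<^sup>2 / r > 0" using D r by (simp add: field_simps)
  have "r / (v * r - \<alpha>\<^sup>2) = 1 / (v - \<alpha>\<^sup>2 / r)" using D r by (simp add: field_simps)
  also have "\<dots> \<ge> 1 / (T + \<eta>)" using le pos by (intro divide_left_mono) auto
  finally have "T * (r / (v * r - \<alpha>\<^sup>2)) \<ge> T * (1 / (T + \<eta>))" using T by (intro mult_left_mono) auto
  moreover have "1 - \<eta> / T \<le> T * (1 / (T + \<eta>))"
  proof -
    have T\<eta>: "T + \<eta> > 0" using le pos by linarith
    have "(T - \<eta>) * (T + \<eta>) \<le> T * T" using zero_le_power2[of \<eta>] by (simp add: algebra_simps power2_eq_square)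
    then have "(T - \<eta>) / T \<le> T / (T + \<eta>)" using T T\<eta> by (simp add: divide_le_eq le_divide_eq mult.commute)
    then show ?thesis using T by (simp add: diff_divide_distrib)
  qed
  ultimately show ?thesis unfolding \<eta>_def by linarith
qed

text \<open>Each term is at least 1 up to its temperature excess, and larger if there is
  correlation, while the sum is at most 2; hence neither correlation can exceed what the two
  excesses \<open>\<delta>\<close> allow.\<close>

lemma precision_correlation_bound:
  fixes T T' v v' r r' \<alpha> \<beta> \<delta> B :: real
  assumes T: "T \<ge> 1" "T' \<ge> 1" and v: "v \<le> T + \<delta>" "v' \<le> T' + \<delta>"
    and r: "0 < r" "r \<le> B" "0 < r'" "r' \<le> B" and D: "v * r - \<alpha>\<^sup>2 > 0" "v' * r' - \<beta>\<^sup>2 > 0" and \<delta>: "\<delta> \<ge> 0"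
    and le: "T * (r / (v * r - \<alpha>\<^sup>2)) + T' * (r' / (v' * r' - \<beta>\<^sup>2)) \<le> 2"
  shows "\<alpha>\<^sup>2 \<le> 2 * \<delta> * B * T" "\<beta>\<^sup>2 \<le> 2 * \<delta> * B * T'"
proof -
  have T0: "T > 0" "T' > 0" "B > 0" using T r by auto
  have "0 \<le> (\<delta> - \<alpha>\<^sup>2 / B) / T + (\<delta> - \<beta>\<^sup>2 / B) / T'"
    using precision_lower_bound[OF T0(1) v(1) r(1,2) D(1)]
      precision_lower_bound[OF T0(2) v(2) r(3,4) D(2)] le by linarith
  then have "\<alpha>\<^sup>2 / B / T + \<beta>\<^sup>2 / B / T' \<le> \<delta> / T + \<delta> / T'"
    by (simp add: diff_divide_distrib)
  moreover have "\<delta> / T \<le> \<delta>" "\<delta> / T' \<le> \<delta>"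
    using \<delta> T by (auto simp: divide_le_eq mult_left_le_one_le mult_le_cancel_left1)
  ultimately have *: "\<alpha>\<^sup>2 / B / T + \<beta>\<^sup>2 / B / T' \<le> 2 * \<delta>" by linarith
  moreover have "\<alpha>\<^sup>2 / B / T \<ge> 0" "\<beta>\<^sup>2 / B / T' \<ge> 0" using T0 by auto
  ultimately have "\<alpha>\<^sup>2 / B / T \<le> 2 * \<delta>" "\<beta>\<^sup>2 / B / T' \<le> 2 * \<delta>" by linarith+
  then show "\<alpha>\<^sup>2 \<le> 2 * \<delta> * B * T" "\<beta>\<^sup>2 \<le> 2 * \<delta> * B * T'"
    using T0 by (simp_all add: divide_le_eq mult_ac)
qed

lemma abs_twice_mult: "y \<ge> 0 \<Longrightarrow> \<bar>2 * y * c\<bar> = 2 * (y * \<bar>c\<bar>)" for y c :: real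
  by (simp add: abs_mult mult.assoc)

lemma twice_abs_add_le:
  fixes a b A B :: real
  assumes "2 * \<bar>a\<bar> \<le> A" "2 * \<bar>b\<bar> \<le> B"
  shows "2 * \<bar>a + b\<bar> \<le> A + B"
proof -
  have "2 * \<bar>a + b\<bar> \<le> 2 * (\<bar>a\<bar> + \<bar>b\<bar>)" by (intro mult_left_mono abs_triangle_ineq) simp
  also have "\<dots> \<le> A + B" using add_mono[OF assms] by simp
  finally show ?thesis .
qed

lemma abs_profile_le:
  fixes p s k k' B :: real
  assumes "0 \<le> p" "p \<le> B" "\<bar>s\<bar> \<le> B" "0 \<le> k" "k \<le> B" "0 \<le> k'" "k' \<le> B"
  shows "\<bar>p + s + (k + k') / 2\<bar> \<le> 3 * B"
  using assms unfolding add_divide_distrib abs_le_iff by linarith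

lemma abs_dev_interior_le:
  fixes k k' s g g' X B D :: real
  assumes "0 \<le> k" "0 \<le> k'" "k' \<le> B" "\<bar>s\<bar> \<le> B" "2 * \<bar>g\<bar> \<le> k + X" "0 \<le> X" "\<bar>g'\<bar> \<le> D"
  shows "\<bar>(k - k') / 2 - (s + (g - g') / 3)\<bar> \<le> k + X + 2 * B + D"
proof -
  have "- B \<le> s" "s \<le> B" "- (k + X) \<le> 2 * g" "2 * g \<le> k + X" "- D \<le> g'" "g' \<le> D"
    using assms(4,5,7) unfolding abs_le_iff by auto
  then show ?thesis
    using assms(1,2,3,6) unfolding diff_divide_distrib abs_le_iff by (intro conjI) linarith+
qed

lemma abs_dev_total_le:
  fixes k k' s s' g g' B D D' :: real
  assumes "0 \<le> k" "k \<le> B" "0 \<le> k'" "k' \<le> B" "\<bar>s\<bar> \<le> B" "\<bar>s'\<bar> \<le> B" "\<bar>g\<bar> \<le> D" "\<bar>g'\<bar> \<le> D'"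
  shows "\<bar>(k - k') / 2 - (s + (g - g') / 3 + s')\<bar> \<le> 3 * B + D / 3 + D' / 3"
proof -
  have "- B \<le> s" "s \<le> B" "- B \<le> s'" "s' \<le> B" "- D \<le> g" "g \<le> D" "- D' \<le> g'" "g' \<le> D'"
    using assms(5-8) unfolding abs_le_iff by auto
  then show ?thesis
    using assms(1-4) unfolding diff_divide_distrib abs_le_iff by (intro conjI) linarith+
qed

text \<open>The last factor bounds the end kinetic moments, twice the current and
  \<open>\<tau> * m (Elong n)\<close>; the first is the loss in \<open>boundary_estimate\<close> for
  \<open>c = (1 + \<gamma>') / 2\<close>.\<close>

definition chain_bound :: "real \<Rightarrow> real \<Rightarrow> real \<Rightarrow> real \<Rightarrow> real" where
  "chain_bound \<gamma>' Tm Tp \<tau> =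
     (12 + ((1 + \<gamma>') / 2 + 1)\<^sup>2) * ((1 + \<gamma>') * (Tm + Tp + 2 * \<tau>\<^sup>2 / \<gamma>') + \<tau>\<^sup>2)"

context chain_moments
begin

abbreviation L :: real where "L \<equiv> chain_bound \<gamma>' Tm Tp \<tau>"

lemma kin_nonneg: "x \<le> n \<Longrightarrow> kin x \<ge> 0"
  unfolding kin_def by (intro diag_nonneg) auto

lemma pot_nonneg: "1 \<le> x \<Longrightarrow> x \<le> n \<Longrightarrow> pot x \<ge> 0"
  unfolding pot_def by (intro diag_nonneg) auto

lemma boundary_bounds:
  "kin 0 \<le> L" "kin 1 \<le> L" "kin n \<le> L" "kin (n - 1) \<le> L" "pot 1 \<le> L" "pot n \<le> L"
  "\<bar>cross 1\<bar> \<le> L" "\<bar>cross n\<bar> \<le> L" "\<bar>mom_corr 0\<bar> \<le> L" "\<bar>mom_corr (n - 1)\<bar> \<le> L" "\<tau>\<^sup>2 \<le> L" "0 \<le> L"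
proof -
  define K0 where "K0 = Tm + Tp + 2 * \<tau>\<^sup>2 / \<gamma>'"
  define K where "K = (1 + \<gamma>') * K0 + \<tau>\<^sup>2"
  define c where "c = (1 + \<gamma>') / 2"
  have L_eq: "L = (12 + (c + 1)\<^sup>2) * K" unfolding chain_bound_def K_def K0_def c_def ..
  have K0: "K0 \<ge> 0" unfolding K0_def using Tm Tp \<gamma>' by simp
  have K: "K = K0 + \<gamma>' * K0 + \<tau>\<^sup>2" unfolding K_def by (simp add: distrib_right)
  have gK0: "\<gamma>' * K0 \<ge> 0" using \<gamma>' K0 by simp
  have "\<tau> * pbar \<le> \<tau>\<^sup>2 / real n" by (rule tension_work)
  also have "\<dots> \<le> \<tau>\<^sup>2" using n by (auto simp: divide_le_eq mult_le_cancel_left1)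
  finally have work: "\<tau> * pbar \<le> \<tau>\<^sup>2" .
  \<comment> \<open>Global energy balance: the inputs of the two baths and the power of the tension
    add up to 0.\<close>
  have "kin 0 + kin n = Tm + Tp + 2 * (\<tau> * pbar) / \<gamma>'"
    using cur_right \<gamma>' unfolding cur_def by (simp add: field_simps)
  moreover have "2 * (\<tau> * pbar) / \<gamma>' \<le> 2 * \<tau>\<^sup>2 / \<gamma>'" using work \<gamma>' by (simp add: divide_right_mono)
  ultimately have kin_le: "kin 0 \<le> K0" "kin n \<le> K0"
    using kin_nonneg[of 0] kin_nonneg[of n] unfolding K0_def by linarith+
  have "\<bar>Tm - kin 0\<bar> \<le> K0"
  proof -
    have "2 * \<tau>\<^sup>2 / \<gamma>' \<ge> 0" using \<gamma>' by simp
    then have "Tm \<le> K0" unfolding K0_def using Tp by linarith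
    then show ?thesis using kin_le kin_nonneg[of 0] Tm by (simp add: abs_le_iff)
  qed
  then have J0: "\<gamma>' * \<bar>Tm - kin 0\<bar> \<le> \<gamma>' * K0" using \<gamma>' by (intro mult_left_mono) auto
  have J: "2 * \<bar>cur\<bar> \<le> K"
  proof -
    have "2 * \<bar>cur\<bar> = \<gamma>' * \<bar>Tm - kin 0\<bar>" unfolding cur_def abs_mult using \<gamma>' by simp
    then show ?thesis using J0 K K0 zero_le_power2[of \<tau>] by linarith
  qed
  have kin_K: "kin 0 \<le> K" "kin n \<le> K" using kin_le K gK0 zero_le_power2[of \<tau>] by linarith+
  have c0: "c \<ge> 0" unfolding c_def using \<gamma>' by simp
  have kin1: "kin 1 = kin 0 - 2 * cur - 2 * cross 1" using current[of 0] n by (simp add: field_simps)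
  have kinn: "kin (n - 1) = kin n + 2 * cur + 2 * cross n" using current[of "n - 1"] n by (simp add: field_simps)
  have corr: "2 * \<bar>mom_corr x\<bar> \<le> kin x + kin (Suc x)" if "x < n" for x
    using abs_moment_le[of "Mom x" "Mom (Suc x)" 1] that unfolding mom_corr_def kin_def by simp
  have cr1: "2 * t * \<bar>cross 1\<bar> \<le> pot 1 + t\<^sup>2 * kin 0" for t
    using abs_moment_le[of "Elong 1" "Mom 0" t] cross_alt[of 1] n unfolding pot_def kin_def by simp
  have crn: "2 * t * \<bar>cross n\<bar> \<le> pot n + t\<^sup>2 * kin n" for t
    using abs_moment_le[of "Elong n" "Mom n" t] n unfolding cross_def pot_def kin_def by simp
  have left: "2 * \<bar>mom_corr 0\<bar> \<le> kin 0 + kin 1" using corr[of 0] n by simp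
  have right: "2 * \<bar>mom_corr (n - 1)\<bar> \<le> kin n + kin (n - 1)" using corr[of "n - 1"] n by simp
  have nonneg: "0 \<le> kin 0" "0 \<le> kin 1" "0 \<le> kin n" "0 \<le> kin (n - 1)"
    using n by (auto intro: kin_nonneg)
  have c: "\<bar>c\<bar> \<le> c" "\<bar>- c\<bar> \<le> c" using c0 by auto
  have zero: "\<bar>0::real\<bar> \<le> K" using K K0 gK0 by simp
  have l: "pot 1 + mom_corr 0 = kin 0 + 0 + c * cross 1" using pot_left unfolding c_def by simp
  have ld: "kin 1 \<le> kin 0 + 2 * \<bar>cur\<bar> + 2 * \<bar>cross 1\<bar>"
    unfolding kin1 using abs_ge_minus_self[of cur] abs_ge_minus_self[of "cross 1"] by linarith
  have KL: "K \<le> L" unfolding L_eq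
    by (rule boundary_estimate(5)[OF nonneg(1) kin_K(1) nonneg(2) J zero c(1) l ld left cr1])
  show "kin 1 \<le> L" "pot 1 \<le> L" "\<bar>cross 1\<bar> \<le> L" "\<bar>mom_corr 0\<bar> \<le> L"
    unfolding L_eq by (rule boundary_estimate[OF nonneg(1) kin_K(1) nonneg(2) J zero c(1) l ld left cr1])+
  show "kin 0 \<le> L" "kin n \<le> L" "\<tau>\<^sup>2 \<le> L" "0 \<le> L"
    using KL kin_K K K0 gK0 zero_le_power2[of \<tau>] by linarith+
  have e: "\<bar>\<tau> * m (Elong n)\<bar> \<le> K" using tension_work(4) K K0 gK0 by linarith
  have r: "pot n + mom_corr (n - 1) = kin n + \<tau> * m (Elong n) + (- c) * cross n"
    using pot_right unfolding c_def by simp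
  have rd: "kin (n - 1) \<le> kin n + 2 * \<bar>cur\<bar> + 2 * \<bar>cross n\<bar>"
    unfolding kinn using abs_ge_self[of cur] abs_ge_self[of "cross n"] by linarith
  show "kin (n - 1) \<le> L" "pot n \<le> L" "\<bar>cross n\<bar> \<le> L" "\<bar>mom_corr (n - 1)\<bar> \<le> L"
    unfolding L_eq by (rule boundary_estimate[OF nonneg(3) kin_K(2) nonneg(4) J e c(2) r rd right crn])+
qed

text \<open>An affine profile of slope \<open>- 2 * cur\<close> whose two end values are bounded
  independently of \<open>n\<close> can only have a slope of order 1/n.\<close>

lemma cur_bound: "real n * \<bar>cur\<bar> \<le> 9 / 2 * L"
proof -
  note b = boundary_bounds
  have l: "lin_profile 1 = pot 1 + mom_corr 0 + (kin 1 + kin 0) / 2" unfolding lin_profile_def by simp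
  have 1: "\<bar>lin_profile 1\<bar> \<le> 3 * L" "\<bar>lin_profile n\<bar> \<le> 3 * L"
    unfolding l unfolding lin_profile_def
    using b n by (auto intro!: abs_profile_le kin_nonneg pot_nonneg)
  have "\<bar>2 * (real n - 1) * cur\<bar> \<le> 6 * L" using lin_profile_eq[of n] 1 n by (simp add: abs_le_iff)
  moreover have "\<bar>2 * (real n - 1) * cur\<bar> = 2 * ((real n - 1) * \<bar>cur\<bar>)"
    using n by (intro abs_twice_mult) auto
  ultimately have "2 * ((real n - 1) * \<bar>cur\<bar>) \<le> 6 * L" by linarith
  moreover have "real n * \<bar>cur\<bar> \<le> (3 / 2 * (real n - 1)) * \<bar>cur\<bar>" using n by (intro mult_right_mono) auto
  ultimately show ?thesis unfolding mult.assoc by linarith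
qed

lemma lin_profile_bound:
  assumes "1 \<le> x" "x \<le> n"
  shows "\<bar>lin_profile x\<bar> \<le> 12 * L"
proof -
  note b = boundary_bounds
  have l: "lin_profile 1 = pot 1 + mom_corr 0 + (kin 1 + kin 0) / 2" unfolding lin_profile_def by simp
  have 1: "\<bar>lin_profile 1\<bar> \<le> 3 * L"
    unfolding l using b n by (auto intro!: abs_profile_le kin_nonneg pot_nonneg)
  have "(real x - 1) * \<bar>cur\<bar> \<le> real n * \<bar>cur\<bar>" using assms by (intro mult_right_mono) auto
  moreover have "\<bar>2 * (real x - 1) * cur\<bar> = 2 * ((real x - 1) * \<bar>cur\<bar>)"
    using assms by (intro abs_twice_mult) auto
  ultimately have "\<bar>2 * (real x - 1) * cur\<bar> \<le> 9 * L" using cur_bound by linarith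
  then show ?thesis using lin_profile_eq[OF assms] 1 by linarith
qed

section \<open>Deviation of the energy from the affine profile\<close>

definition dev :: "nat \<Rightarrow> real" where "dev x = kin x + pot x - lin_profile x"
definition cumdev :: "nat \<Rightarrow> real" where "cumdev k = (\<Sum>x = 1..k. dev x)"
definition grad :: "nat \<Rightarrow> real" where "grad x = cross x + far_cross x"

lemma cumdev_eq: "cumdev k = (kin k - kin 0) / 2 - (\<Sum>y<k. mom_corr y)"
  unfolding cumdev_def
  by (induction k) (auto simp: dev_def lin_profile_def field_simps)

lemma sum_mom_corr:
  assumes "1 \<le> k" "k < n"
  shows "(\<Sum>y<k. mom_corr y) = mom_corr 0 + (grad k - grad 1) / 3"
  using assms
proof (induction k)
  case (Suc k)
  show ?case
  proof (cases "k = 0")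
    case False
    then show ?thesis using Suc mom_corr_bulk[of k] unfolding grad_def by (simp add: field_simps)
  qed simp
qed simp

lemma grad_bound:
  assumes "1 \<le> k" "k < n"
  shows "2 * \<bar>grad k\<bar> \<le> kin k + pot k + kin (k - 1) + pot (Suc k)"
proof -
  have k: "k - 1 \<le> n" using assms by simp
  have "2 * \<bar>cross k\<bar> \<le> pot k + kin k" "2 * \<bar>far_cross k\<bar> \<le> pot (Suc k) + kin (k - 1)"
    unfolding cross_def far_cross_def kin_def pot_def
    using abs_moment_le[of "Elong k" "Mom k" 1] abs_moment_le[of "Elong (Suc k)" "Mom (k - 1)" 1] assms k
    by simp_all
  from twice_abs_add_le[OF this] show ?thesis unfolding grad_def by (simp add: add_ac)
qed

lemma grad_boundary: "\<bar>grad 1\<bar> \<le> (4 + \<gamma>') * L" "\<bar>grad (n - 1)\<bar> \<le> (5 + \<gamma>') * L"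
proof -
  note b = boundary_bounds
  have s: "\<bar>(5 + \<gamma>') / 2 * x\<bar> \<le> (5 + \<gamma>') / 2 * L" if "\<bar>x\<bar> \<le> L" for x
    unfolding abs_mult using that \<gamma>' by (intro mult_mono) auto
  have gL: "\<gamma>' * L \<ge> 0" using \<gamma>' b by simp
  have split: "(5 + \<gamma>') / 2 * L = 5 / 2 * L + \<gamma>' * L / 2" "(4 + \<gamma>') * L = 4 * L + \<gamma>' * L"
    "(5 + \<gamma>') * L = 5 * L + \<gamma>' * L" by (simp_all add: field_simps)
  have "\<bar>far_cross 1\<bar> \<le> (5 + \<gamma>') / 2 * L" unfolding mom_corr_left by (rule s) (rule b)
  then show "\<bar>grad 1\<bar> \<le> (4 + \<gamma>') * L" unfolding grad_def using b(7,12) gL unfolding split by linarith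
  have "\<tau> * pbar \<le> \<tau>\<^sup>2 / real n" by (rule tension_work)
  also have "\<dots> \<le> \<tau>\<^sup>2" using n by (auto simp: divide_le_eq mult_le_cancel_left1)
  finally have "\<bar>\<tau> * pbar\<bar> \<le> L" using tension_work(1) b(11) by linarith
  moreover have "\<bar>(5 + \<gamma>') / 2 * mom_corr (n - 1)\<bar> \<le> (5 + \<gamma>') / 2 * L" by (rule s) (rule b)
  ultimately show "\<bar>grad (n - 1)\<bar> \<le> (5 + \<gamma>') * L"
    unfolding grad_def mom_corr_right using b(8,12) gL unfolding split by linarith
qed

text \<open>Local energies remain on the right because no bound on them is known site by site; the
  estimate becomes useful only when summed over \<open>k\<close>.\<close>

lemma cumdev_interior:
  assumes "1 \<le> k" "k < n"
  shows "\<bar>cumdev k\<bar> \<le> kin k + pot k + kin (k - 1) + pot (Suc k) + (6 + \<gamma>') * L"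
proof -
  note b = boundary_bounds
  have "\<bar>cumdev k\<bar> \<le> kin k + (pot k + kin (k - 1) + pot (Suc k)) + 2 * L + (4 + \<gamma>') * L"
    unfolding cumdev_eq sum_mom_corr[OF assms]
    using assms b(1,9) grad_bound[OF assms] grad_boundary(1)
    by (intro abs_dev_interior_le add_nonneg_nonneg kin_nonneg pot_nonneg) auto
  then show ?thesis by (simp add: distrib_right)
qed

lemma cumdev_total: "\<bar>cumdev n\<bar> \<le> (8 + \<gamma>') * L"
proof -
  note b = boundary_bounds
  have gL: "\<gamma>' * L \<ge> 0" using \<gamma>' b by simp
  have "(\<Sum>y<n. mom_corr y) = (\<Sum>y<n - 1. mom_corr y) + mom_corr (n - 1)"
    using n by (cases n) auto
  then have "cumdev n = (kin n - kin 0) / 2 - (mom_corr 0 + (grad (n - 1) - grad 1) / 3 + mom_corr (n - 1))"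
    unfolding cumdev_eq using sum_mom_corr[of "n - 1"] n by simp
  also have "\<bar>\<dots>\<bar> \<le> 3 * L + (5 + \<gamma>') * L / 3 + (4 + \<gamma>') * L / 3"
    by (rule abs_dev_total_le[OF kin_nonneg b(3) kin_nonneg b(1) b(9,10) grad_boundary(2,1)]) simp_all
  also have "\<dots> = 6 * L + 2 / 3 * (\<gamma>' * L)" by (simp add: field_simps)
  also have "\<dots> \<le> 8 * L + \<gamma>' * L" using gL b(12) by linarith
  finally show ?thesis by (simp add: distrib_right)
qed

text \<open>Not circular: over the whole chain the deviations telescope to moments at the ends, so
  \<open>cumdev n\<close> is bounded before anything is known inside.\<close>

lemma total_energy_bound: "(\<Sum>x = 1..n. kin x + pot x) \<le> (20 + \<gamma>') * L * real n"
proof -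
  have "(\<Sum>x = 1..n. kin x + pot x) = cumdev n + (\<Sum>x = 1..n. lin_profile x)"
    unfolding cumdev_def dev_def by (simp add: sum_subtractf)
  also have "(\<Sum>x = 1..n. lin_profile x) \<le> (\<Sum>x = 1..n. 12 * L)"
    using lin_profile_bound by (intro sum_mono) (auto simp: abs_le_iff)
  also have "(\<Sum>x = 1..n. 12 * L) = 12 * L * real n" by simp
  finally have "(\<Sum>x = 1..n. kin x + pot x) \<le> (8 + \<gamma>') * L + 12 * L * real n"
    using cumdev_total abs_ge_self[of "cumdev n"] by linarith
  moreover have "(8 + \<gamma>') * L * 1 \<le> (8 + \<gamma>') * L * real n"
    using n boundary_bounds(12) \<gamma>' by (intro mult_left_mono) auto
  ultimately show ?thesis by (simp add: algebra_simps)
qed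

text \<open>The shifted local energies add up to at most twice the total energy plus
  \<open>kin 0\<close>, so the constant is
  \<open>2 * (20 + \<gamma>') + 1 + (6 + \<gamma>')\<close>.\<close>

lemma cumdev_sum: "(\<Sum>k = 1..<n. \<bar>cumdev k\<bar>) \<le> (47 + 3 * \<gamma>') * L * real n"
proof -
  let ?E = "\<Sum>x = 1..n. kin x + pot x"
  note b = boundary_bounds
  have "(\<Sum>k = 1..<n. \<bar>cumdev k\<bar>) \<le> (\<Sum>k = 1..<n. (kin k + pot k) + kin (k - 1) + pot (Suc k) + (6 + \<gamma>') * L)"
    by (intro sum_mono) (use cumdev_interior in auto)
  also have "\<dots> = (\<Sum>k = 1..<n. kin k + pot k) + (\<Sum>k = 1..<n. kin (k - 1)) + (\<Sum>k = 1..<n. pot (Suc k))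
      + (\<Sum>k = 1..<n. (6 + \<gamma>') * L)"
    by (simp only: sum.distrib)
  finally have 1: "(\<Sum>k = 1..<n. \<bar>cumdev k\<bar>) \<le> (\<Sum>k = 1..<n. kin k + pot k) + (\<Sum>k = 1..<n. kin (k - 1))
      + (\<Sum>k = 1..<n. pot (Suc k)) + (\<Sum>k = 1..<n. (6 + \<gamma>') * L)" .
  have nn: "kin x + pot x \<ge> 0" if "x \<in> {1..n}" for x using kin_nonneg[of x] pot_nonneg[of x] that by simp
  have 2: "(\<Sum>k = 1..<n. kin k + pot k) \<le> ?E"
    using nn by (intro sum_mono2) auto
  have "(\<Sum>k = 1..<n. kin (k - 1)) = (\<Sum>k = 0..<n - 1. kin k)"
    using sum.shift_bounds_nat_ivl[of "\<lambda>k. kin (k - 1)" 0 1 "n - 1"] n by simp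
  also have "\<dots> = kin 0 + (\<Sum>k = 1..<n - 1. kin k)"
    using n by (simp add: sum.atLeast_Suc_lessThan)
  also have "(\<Sum>k = 1..<n - 1. kin k) \<le> (\<Sum>k = 1..n. kin k)"
    using kin_nonneg by (intro sum_mono2) auto
  finally have 3: "(\<Sum>k = 1..<n. kin (k - 1)) \<le> L + (\<Sum>k = 1..n. kin k)" using b(1) by linarith
  have "(\<Sum>k = 1..<n. pot (Suc k)) = (\<Sum>k = 2..<Suc n. pot k)"
    using sum.shift_bounds_Suc_ivl[of pot 1 n] by (simp add: numeral_2_eq_2)
  also have "\<dots> \<le> (\<Sum>k = 1..n. pot k)"
    using pot_nonneg by (intro sum_mono2) auto
  finally have 4: "(\<Sum>k = 1..<n. pot (Suc k)) \<le> (\<Sum>k = 1..n. pot k)" .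
  have "(6 + \<gamma>') * L * real (n - 1) \<le> (6 + \<gamma>') * L * real n"
    using b(12) \<gamma>' by (intro mult_left_mono) auto
  then have 5: "(\<Sum>k = 1..<n. (6 + \<gamma>') * L) \<le> (6 + \<gamma>') * L * real n" by (simp add: mult.commute)
  have "L * 1 \<le> L * real n" using b(12) n by (intro mult_left_mono) auto
  then have "(\<Sum>k = 1..<n. \<bar>cumdev k\<bar>) \<le> 2 * ((20 + \<gamma>') * L * real n) + L * real n + (6 + \<gamma>') * L * real n"
    using 1 2 3 4 5 total_energy_bound by (simp add: sum.distrib)
  then show ?thesis by (simp add: algebra_simps)
qed

section \<open>Decorrelation of the end momenta\<close>

text \<open>The precision bound is used with partners \<open>Elong 1\<close> and
  \<open>Elong n\<close>. The temperatures \<open>Tm + 1\<close> and \<open>Tp + 1\<close> belong to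
  \<open>cov1\<close>; both are at least 1, as \<open>precision_correlation_bound\<close>
  demands.\<close>

lemma boundary_cross_bounds:
  defines "B \<equiv> 22 * L * (L + 1) / \<gamma>'"
  shows "(cross 1 - pbar * m (Elong 1))\<^sup>2 \<le> B * (Tm + 1) / real n"
    "(cross n - pbar * m (Elong n))\<^sup>2 \<le> B * (Tp + 1) / real n"
proof -
  note b = boundary_bounds
  let ?C = "cov1 m M"
  \<comment> \<open>The possible excess of the end kinetic moments over the bath temperatures:
    \<open>9 * L\<close> comes from twice the current and \<open>2 * L\<close> from twice the power
    of the tension. The 22 in \<open>B\<close> is twice this 11.\<close>
  define \<delta> where "\<delta> = 11 * L / \<gamma>' / real n"
  have n0: "real n > 0" using n by simp
  have d: "(2 * \<bar>cur\<bar> + 2 * (\<tau> * pbar)) / \<gamma>' \<le> \<delta>"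
  proof -
    have "\<bar>cur\<bar> \<le> 9 / 2 * L / real n" using cur_bound n0 by (simp add: field_simps)
    moreover have "\<tau> * pbar \<le> L / real n"
      by (rule order_trans[OF tension_work(2) divide_right_mono[OF b(11)]]) simp
    ultimately have "2 * \<bar>cur\<bar> + 2 * (\<tau> * pbar) \<le> 11 * L / real n" by simp
    then show ?thesis unfolding \<delta>_def using \<gamma>' by (simp add: divide_right_mono divide_divide_eq_left' mult.commute field_simps)
  qed
  have diag: "?C a a \<le> M a a + 1" for a
  proof -
    have "?C a a = M a a - m a * m a + 1" unfolding cov1_def by simp
    then show ?thesis using zero_le_square[of "m a"] by linarith
  qed
  have v0: "?C (Mom 0) (Mom 0) \<le> (Tm + 1) + \<delta>"
  proof -
    have "kin 0 = Tm - 2 * cur / \<gamma>'" unfolding cur_def using \<gamma>' by (simp add: field_simps)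
    also have "\<dots> = Tm + (- 2 * cur) / \<gamma>'" by simp
    also have "\<dots> \<le> Tm + (2 * \<bar>cur\<bar> + 2 * (\<tau> * pbar)) / \<gamma>'"
      using tension_work(1) \<gamma>' by (intro add_left_mono divide_right_mono) auto
    finally have "kin 0 \<le> Tm + \<delta>" using d by linarith
    then show ?thesis using diag[of "Mom 0"] unfolding kin_def by linarith
  qed
  have vn: "?C (Mom n) (Mom n) \<le> (Tp + 1) + \<delta>"
  proof -
    have "kin n = Tp + (2 * cur + 2 * (\<tau> * pbar)) / \<gamma>'" using cur_right \<gamma>' by (simp add: field_simps)
    also have "\<dots> \<le> Tp + (2 * \<bar>cur\<bar> + 2 * (\<tau> * pbar)) / \<gamma>'"
      using \<gamma>' by (intro add_left_mono divide_right_mono) auto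
    finally have "kin n \<le> Tp + \<delta>" using d by linarith
    then show ?thesis using diag[of "Mom n"] unfolding kin_def by linarith
  qed
  have r: "?C (Elong 1) (Elong 1) \<le> L + 1" "?C (Elong n) (Elong n) \<le> L + 1"
    using b(5,6) diag[of "Elong 1"] diag[of "Elong n"] unfolding pot_def by linarith+
  note blk0 = cov1_block[OF ms, of "Mom 0" "Elong 1"] and blkn = cov1_block[OF ms, of "Mom n" "Elong n"]
  have "\<delta> \<ge> 0" unfolding \<delta>_def using b(12) \<gamma>' n by simp
  moreover have "(1::real) > 0" "1 \<le> Tm + 1" "1 \<le> Tp + 1" using Tm Tp by auto
  moreover note boundary_precision_bound[OF _ _ \<gamma>' Tm Tp ms, of "Elong 1" "Elong n"]
  ultimately have A: "(?C (Mom 0) (Elong 1))\<^sup>2 \<le> 2 * \<delta> * (L + 1) * (Tm + 1)"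
    "(?C (Mom n) (Elong n))\<^sup>2 \<le> 2 * \<delta> * (L + 1) * (Tp + 1)"
    using n v0 vn r blk0 blkn
      precision_correlation_bound[of "Tm + 1" "Tp + 1" "?C (Mom 0) (Mom 0)" \<delta> "?C (Mom n) (Mom n)"
        "?C (Elong 1) (Elong 1)" "L + 1" "?C (Elong n) (Elong n)" "?C (Mom 0) (Elong 1)" "?C (Mom n) (Elong n)"]
    by simp_all
  have "?C (Mom 0) (Elong 1) = cross 1 - pbar * m (Elong 1)"
    using cross_alt[of 1] n M_sym[of "Mom 0" "Elong 1"] unfolding cov1_def pbar_def by simp
  moreover have "?C (Mom n) (Elong n) = cross n - pbar * m (Elong n)"
    using mean_Mom[of n] M_sym[of "Mom n" "Elong n"] unfolding cov1_def cross_def by simp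
  moreover have "2 * \<delta> * (L + 1) = B / real n"
    unfolding \<delta>_def B_def by simp
  ultimately show "(cross 1 - pbar * m (Elong 1))\<^sup>2 \<le> B * (Tm + 1) / real n"
    "(cross n - pbar * m (Elong n))\<^sup>2 \<le> B * (Tp + 1) / real n"
    using A by simp_all
qed

end

section \<open>Riemann sums and summation by parts\<close>

lemma integral_right_endpoint_error:
  fixes g :: "real \<Rightarrow> real"
  assumes "a \<le> b" "continuous_on {a..b} g" "\<And>u. u \<in> {a..b} \<Longrightarrow> \<bar>g u - g b\<bar> \<le> e"
  shows "\<bar>integral {a..b} g - g b * (b - a)\<bar> \<le> e * (b - a)"
proof -
  have "integral {a..b} (\<lambda>u. g u - g b) = integral {a..b} g - g b * (b - a)"
    using assms(1,2) by (subst Henstock_Kurzweil_Integration.integral_diff)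
      (auto intro: integrable_continuous_interval)
  moreover have "norm (integral {a..b} (\<lambda>u. g u - g b)) \<le> e * (b - a)"
    using assms by (intro integral_bound) (auto intro!: continuous_intros)
  ultimately show ?thesis by simp
qed

lemma riemann_sum_tendsto:
  fixes g :: "real \<Rightarrow> real"
  assumes g: "continuous_on {0..1} g"
  shows "(\<lambda>n. 1 / real n * (\<Sum>x = 1..n. g (real x / real n))) \<longlonglongrightarrow> integral {0..1} g"
proof (rule LIMSEQ_I)
  fix r :: real assume r: "r > 0"
  have "uniformly_continuous_on {0..1} g" using g by (intro compact_uniformly_continuous) auto
  then obtain d where d: "d > 0" "\<And>u v. u \<in> {0..1} \<Longrightarrow> v \<in> {0..1} \<Longrightarrow> dist v u < d \<Longrightarrow> dist (g v) (g u) < r / 2"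
    unfolding uniformly_continuous_on_def using r by (metis half_gt_zero)
  obtain N where N: "1 / d < real N" using reals_Archimedean2 by blast
  show "\<exists>no. \<forall>n\<ge>no. norm (1 / real n * (\<Sum>x = 1..n. g (real x / real n)) - integral {0..1} g) < r"
  proof (intro exI allI impI)
    fix n assume "n \<ge> max 1 N"
    then have n: "n \<ge> 1" "1 / real n < d"
      using N d(1) by (auto simp: field_simps intro: less_le_trans)
    \<comment> \<open>The error is kept proportional to the length covered so far, which is what
      adds up cell by cell.\<close>
    have "\<bar>integral {0..real k / real n} g - 1 / real n * (\<Sum>x = 1..k. g (real x / real n))\<bar> \<le> r / 2 * (real k / real n)"
      if "k \<le> n" for k
      using that
    proof (induction k)
      case (Suc k)
      let ?a = "real k / real n" and ?b = "real (Suc k) / real n"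
      have ab: "0 \<le> ?a" "?a \<le> ?b" "?b \<le> 1" "?b - ?a = 1 / real n"
        using Suc.prems n by (auto simp: field_simps)
      have "\<bar>integral {?a..?b} g - g ?b * (?b - ?a)\<bar> \<le> r / 2 * (?b - ?a)"
      proof (rule integral_right_endpoint_error[OF ab(2)])
        show "continuous_on {?a..?b} g" using g ab by (elim continuous_on_subset) auto
        show "\<bar>g u - g ?b\<bar> \<le> r / 2" if "u \<in> {?a..?b}" for u
        proof -
          have u: "?a \<le> u" "u \<le> ?b" using that by auto
          have "0 \<le> u" "u \<le> 1" using u ab by linarith+
          moreover have "dist u ?b < d" unfolding dist_real_def using u ab(4) n(2) by linarith
          moreover have "0 \<le> ?b" using ab by linarith
          ultimately show ?thesis using d(2)[of ?b u] ab(3) by (simp add: dist_real_def)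
        qed
      qed
      moreover have "integral {0..?a} g + integral {?a..?b} g = integral {0..?b} g"
        using ab g by (intro Henstock_Kurzweil_Integration.integral_combine integrable_continuous_interval)
          (auto elim: continuous_on_subset)
      moreover have "\<bar>integral {0..?a} g - 1 / real n * (\<Sum>x = 1..k. g (real x / real n))\<bar> \<le> r / 2 * ?a"
        using Suc by simp
      moreover have "1 / real n * (\<Sum>x = 1..Suc k. g (real x / real n)) =
          1 / real n * (\<Sum>x = 1..k. g (real x / real n)) + g ?b * (1 / real n)"
        by (simp add: add_divide_distrib)
      moreover have "r / 2 * ?b = r / 2 * ?a + r / 2 * (1 / real n)"
        using n by (simp add: field_simps)
      ultimately show ?case unfolding ab(4) by linarith
    qed simp
    from this[of n] have "\<bar>integral {0..1} g - 1 / real n * (\<Sum>x = 1..n. g (real x / real n))\<bar> \<le> r / 2"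
      using n by simp
    then show "norm (1 / real n * (\<Sum>x = 1..n. g (real x / real n)) - integral {0..1} g) < r"
      using r by (simp add: abs_minus_commute)
  qed
qed

lemma riemann_sum_perturbed:
  fixes G h :: "real \<Rightarrow> real" and f :: "nat \<Rightarrow> nat \<Rightarrow> real"
  assumes G: "continuous_on {0..1} G" and h: "continuous_on {0..1} h"
    and f: "\<And>n x. n \<ge> N \<Longrightarrow> 1 \<le> x \<Longrightarrow> x \<le> n \<Longrightarrow> \<bar>f n x - h (real x / real n)\<bar> \<le> e n"
    and e: "e \<longlonglongrightarrow> 0"
  shows "(\<lambda>n. 1 / real n * (\<Sum>x = 1..n. G (real x / real n) * f n x)) \<longlonglongrightarrow> integral {0..1} (\<lambda>u. G u * h u)"
proof -
  have "bounded (G ` {0..1})" using G by (intro compact_imp_bounded compact_continuous_image) auto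
  then obtain B where "\<forall>y\<in>G ` {0..1}. norm y \<le> B" unfolding bounded_iff by blast
  then have B: "\<bar>G u\<bar> \<le> B" if "u \<in> {0..1}" for u using that by auto
  have "(\<lambda>n. 1 / real n * (\<Sum>x = 1..n. G (real x / real n) * (f n x - h (real x / real n)))) \<longlonglongrightarrow> 0"
  proof (rule Lim_null_comparison)
    show "(\<lambda>n. B * e n) \<longlonglongrightarrow> 0" using tendsto_mult[OF tendsto_const e, of B] by simp
    show "\<forall>\<^sub>F n in sequentially. norm (1 / real n * (\<Sum>x = 1..n. G (real x / real n) * (f n x - h (real x / real n)))) \<le> B * e n"
    proof (rule eventually_sequentiallyI[of "max 1 N"])
      fix n assume n: "n \<ge> max 1 N"
      have "\<bar>\<Sum>x = 1..n. G (real x / real n) * (f n x - h (real x / real n))\<bar> \<le> (\<Sum>x = 1..n. B * e n)"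
      proof (rule order_trans[OF sum_abs sum_mono])
        fix x assume "x \<in> {1..n}"
        then show "\<bar>G (real x / real n) * (f n x - h (real x / real n))\<bar> \<le> B * e n"
          using n by (intro abs_mult_le B f) auto
      qed
      then have "\<bar>\<Sum>x = 1..n. G (real x / real n) * (f n x - h (real x / real n))\<bar> \<le> real n * (B * e n)" by simp
      then show "norm (1 / real n * (\<Sum>x = 1..n. G (real x / real n) * (f n x - h (real x / real n)))) \<le> B * e n"
        using n by (simp add: abs_mult divide_le_eq mult.commute)
    qed
  qed
  moreover have "(\<lambda>n. 1 / real n * (\<Sum>x = 1..n. G (real x / real n) * h (real x / real n)))
      \<longlonglongrightarrow> integral {0..1} (\<lambda>u. G u * h u)"
    by (rule riemann_sum_tendsto) (intro continuous_intros G h)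
  ultimately have "(\<lambda>n. 1 / real n * (\<Sum>x = 1..n. G (real x / real n) * (f n x - h (real x / real n)))
      + 1 / real n * (\<Sum>x = 1..n. G (real x / real n) * h (real x / real n)))
      \<longlonglongrightarrow> 0 + integral {0..1} (\<lambda>u. G u * h u)" by (rule tendsto_add)
  moreover have "1 / real n * (\<Sum>x = 1..n. G (real x / real n) * (f n x - h (real x / real n)))
      + 1 / real n * (\<Sum>x = 1..n. G (real x / real n) * h (real x / real n)) =
      1 / real n * (\<Sum>x = 1..n. G (real x / real n) * f n x)" for n
    unfolding distrib_left[symmetric] sum.distrib[symmetric] by (simp add: algebra_simps)
  ultimately show ?thesis by simp
qed

lemma summation_by_parts:
  fixes g w :: "nat \<Rightarrow> real"
  shows "(\<Sum>x = 1..n. g x * w x) =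
    g n * (\<Sum>x = 1..n. w x) - (\<Sum>k = 1..<n. (g (Suc k) - g k) * (\<Sum>x = 1..k. w x))"
proof (induction n)
  case (Suc n)
  then show ?case by (cases "n = 0") (simp_all add: algebra_simps)
qed simp

text \<open>
  No regularity of \<open>G\<close> beyond continuity is needed: after summation by parts only its modulus of
  continuity at scale \<open>1 / n\<close> enters.
\<close>

lemma weak_negligible:
  fixes G :: "real \<Rightarrow> real" and w :: "nat \<Rightarrow> nat \<Rightarrow> real"
  assumes G: "continuous_on {0..1} G"
    and total: "\<And>n. n \<ge> N \<Longrightarrow> \<bar>\<Sum>x = 1..n. w n x\<bar> \<le> C"
    and avg: "\<And>n. n \<ge> N \<Longrightarrow> (\<Sum>k = 1..<n. \<bar>\<Sum>x = 1..k. w n x\<bar>) \<le> C * real n"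
  shows "(\<lambda>n. 1 / real n * (\<Sum>x = 1..n. G (real x / real n) * w n x)) \<longlonglongrightarrow> 0"
proof (rule LIMSEQ_I)
  fix r :: real assume r: "r > 0"
  have C: "C \<ge> 0" using total[of N] by linarith
  \<comment> \<open>Admissible increment of \<open>G\<close> over one step: with the averaged bound
    \<open>C * real n\<close> it yields at most \<open>r / 2 * real n\<close>; the summand 1 covers
    \<open>C = 0\<close>.\<close>
  define s where "s = r / (2 * (C + 1))"
  have s: "s > 0" unfolding s_def using r C by simp
  have "uniformly_continuous_on {0..1} G" using G by (intro compact_uniformly_continuous) auto
  then obtain d where d: "d > 0" "\<And>u v. u \<in> {0..1} \<Longrightarrow> v \<in> {0..1} \<Longrightarrow> dist v u < d \<Longrightarrow> dist (G v) (G u) < s"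
    unfolding uniformly_continuous_on_def using s by metis
  define D where "D = \<bar>G 1\<bar> * C"
  obtain K where K: "max (1 / d) (2 * (D + 1) / r) < real K" using reals_Archimedean2 by blast
  show "\<exists>no. \<forall>n\<ge>no. norm (1 / real n * (\<Sum>x = 1..n. G (real x / real n) * w n x) - 0) < r"
  proof (intro exI allI impI)
    fix n assume "n \<ge> max 1 (max N K)"
    then have n: "n \<ge> 1" "n \<ge> N" "n \<ge> K" by auto
    have "1 / d < real n" "2 * (D + 1) / r < real n" using K n by linarith+
    then have nd: "1 / real n < d" "2 * (D + 1) < r * real n"
      using d r n by (auto simp: field_simps)
    have "\<bar>\<Sum>k = 1..<n. (G (real (Suc k) / real n) - G (real k / real n)) * (\<Sum>x = 1..k. w n x)\<bar>
        \<le> (\<Sum>k = 1..<n. s * \<bar>\<Sum>x = 1..k. w n x\<bar>)"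
    proof (rule order_trans[OF sum_abs sum_mono])
      fix k assume k: "k \<in> {1..<n}"
      have "\<bar>G (real (Suc k) / real n) - G (real k / real n)\<bar> \<le> s"
        using d(2)[of "real k / real n" "real (Suc k) / real n"] k nd n
        by (auto simp: dist_real_def diff_divide_distrib[symmetric])
      then show "\<bar>(G (real (Suc k) / real n) - G (real k / real n)) * (\<Sum>x = 1..k. w n x)\<bar>
          \<le> s * \<bar>\<Sum>x = 1..k. w n x\<bar>" by (rule abs_mult_le) simp
    qed
    also have "\<dots> \<le> s * (C * real n)"
      unfolding sum_distrib_left[symmetric] using avg[OF n(2)] s by (intro mult_left_mono) auto
    also have "\<dots> \<le> s * ((C + 1) * real n)" using s by (intro mult_left_mono mult_right_mono) auto
    also have "\<dots> = r / 2 * real n" unfolding s_def using C by (simp add: field_simps)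
    finally have 1: "\<bar>\<Sum>k = 1..<n. (G (real (Suc k) / real n) - G (real k / real n)) * (\<Sum>x = 1..k. w n x)\<bar> \<le> r / 2 * real n" .
    have "\<bar>G (real n / real n) * (\<Sum>x = 1..n. w n x)\<bar> \<le> D"
      unfolding D_def using n total[OF n(2)] by (intro abs_mult_le) auto
    then have "\<bar>\<Sum>x = 1..n. G (real x / real n) * w n x\<bar> \<le> D + r / 2 * real n"
      using 1 unfolding summation_by_parts[of "\<lambda>x. G (real x / real n)"] by linarith
    also have "\<dots> < r * real n"
      using nd(2) by (simp add: field_simps)
    finally show "norm (1 / real n * (\<Sum>x = 1..n. G (real x / real n) * w n x) - 0) < r"
      using n by (simp add: abs_mult field_simps)
  qed
qed

section \<open>Quantitative approximation of the profiles\<close>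

text \<open>The part of order 1/n collects, in this order, the current, the power of the tension,
  the error of the last mean elongation, the products of means in the cross moments, and the shift
  of the interpolation points. The square root comes from
  \<open>boundary_cross_bounds\<close>.\<close>

definition chain_error :: "real \<Rightarrow> real \<Rightarrow> real \<Rightarrow> real \<Rightarrow> nat \<Rightarrow> real" where
  "chain_error \<gamma>' Tm Tp \<tau> n =
     ((1 + 4 / \<gamma>') * (9 / 2 * chain_bound \<gamma>' Tm Tp \<tau>) + 4 * \<tau>\<^sup>2 / \<gamma>' + \<tau>\<^sup>2 * (1 + 2 * \<gamma>')
       + (1 + \<gamma>') * (\<tau>\<^sup>2 * (1 + \<gamma>')) + \<bar>2 * Tp + \<tau>\<^sup>2 - 2 * Tm\<bar>) / real n
     + (1 + \<gamma>') * sqrt (22 * chain_bound \<gamma>' Tm Tp \<tau> * (chain_bound \<gamma>' Tm Tp \<tau> + 1) / \<gamma>' * (Tm + Tp + 1) / real n)"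

lemma chain_error_tendsto: "chain_error \<gamma>' Tm Tp \<tau> \<longlonglongrightarrow> 0"
proof -
  have "(\<lambda>n. a / real n + b * sqrt (c / real n)) \<longlonglongrightarrow> 0 + b * sqrt 0" for a b c :: real
    by (intro tendsto_intros lim_const_over_n)
  then have lim: "(\<lambda>n. a / real n + b * sqrt (c / real n)) \<longlonglongrightarrow> 0" for a b c :: real by simp
  show ?thesis unfolding chain_error_def[abs_def] by (rule lim)
qed

lemma abs_add3_le:
  fixes a b c A B C :: real
  assumes "\<bar>a\<bar> \<le> A" "\<bar>b\<bar> \<le> B" "\<bar>c\<bar> \<le> C"
  shows "\<bar>a + (b + c)\<bar> \<le> A + (B + C)"
  using assms by (simp add: abs_le_iff)

context chain_moments
begin

lemma mean_Elong_approx: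
  assumes "1 \<le> x" "x \<le> n"
  shows "\<bar>m (Elong x) - \<tau> * (real x / real n)\<bar> \<le> \<bar>\<tau>\<bar> * (1 + 2 * \<gamma>') / real n"
proof -
  have pos: "real n > 0" "real n + \<gamma>' > 0" using n \<gamma>' by auto
  have "m (Elong x) - \<tau> * (real x / real n) =
      \<tau> * (((real x - 1 / 2 + \<gamma>' / 2) * real n - real x * (real n + \<gamma>')) / ((real n + \<gamma>') * real n))"
  proof -
    have "m (Elong x) = \<tau> * ((real x - 1 / 2 + \<gamma>' / 2) / (real n + \<gamma>'))"
      unfolding mean_Elong[OF assms] pbar_eq[symmetric] using pos by simp
    then have "m (Elong x) - \<tau> * (real x / real n) =
        \<tau> * ((real x - 1 / 2 + \<gamma>' / 2) / (real n + \<gamma>') - real x / real n)"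
      by (simp only: right_diff_distrib)
    then show ?thesis using pos by (simp only: diff_frac_eq)
  qed
  also have "(real x - 1 / 2 + \<gamma>' / 2) * real n - real x * (real n + \<gamma>') = (\<gamma>' - 1) / 2 * real n - real x * \<gamma>'"
    by (simp add: field_simps)
  finally have eq: "m (Elong x) - \<tau> * (real x / real n) =
      \<tau> * (((\<gamma>' - 1) / 2 * real n - real x * \<gamma>') / ((real n + \<gamma>') * real n))" .
  have "0 \<le> real x * \<gamma>'" "real x * \<gamma>' \<le> real n * \<gamma>'" "0 \<le> \<gamma>' * real n"
    using assms \<gamma>' by (auto intro: mult_right_mono)
  then have "\<bar>(\<gamma>' - 1) / 2 * real n - real x * \<gamma>'\<bar> \<le> (1 + 2 * \<gamma>') * real n"
    unfolding abs_le_iff by (auto simp: field_simps)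
  then have "\<bar>(\<gamma>' - 1) / 2 * real n - real x * \<gamma>'\<bar> / ((real n + \<gamma>') * real n)
      \<le> ((1 + 2 * \<gamma>') * real n) / (real n * real n)"
    using pos \<gamma>' by (intro frac_le mult_right_mono) auto
  then have "\<bar>((\<gamma>' - 1) / 2 * real n - real x * \<gamma>') / ((real n + \<gamma>') * real n)\<bar> \<le> (1 + 2 * \<gamma>') / real n"
    using pos by (simp add: abs_mult)
  from abs_mult_le[OF order_refl this, of \<tau>] show ?thesis unfolding eq by simp
qed

text \<open>The moment is the covariance plus a product of means. Although
  \<open>m (Elong n)\<close> is of order 1, the factor \<open>pbar\<close> makes this product of
  order 1/n at both ends.\<close>

lemma cross_boundary:
  defines "S \<equiv> sqrt (22 * L * (L + 1) / \<gamma>' * (Tm + Tp + 1) / real n)"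
  shows "\<bar>cross 1\<bar> \<le> S + \<tau>\<^sup>2 * (1 + \<gamma>') / real n" "\<bar>cross n\<bar> \<le> S + \<tau>\<^sup>2 * (1 + \<gamma>') / real n"
proof -
  have n0: "real n > 0" using n by simp
  define B where "B = 22 * L * (L + 1) / \<gamma>'"
  have B: "B \<ge> 0" unfolding B_def using boundary_bounds(12) \<gamma>' by simp
  have S: "\<bar>y\<bar> \<le> S" if "y\<^sup>2 \<le> B * T / real n" "T \<le> Tm + Tp + 1" for y T
  proof -
    have "B * T / real n \<le> B * (Tm + Tp + 1) / real n"
      using B that n0 by (intro divide_right_mono mult_left_mono) auto
    then have "y\<^sup>2 \<le> B * (Tm + Tp + 1) / real n" using that by linarith
    then show ?thesis unfolding S_def B_def using real_sqrt_le_mono by fastforce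
  qed
  have tb: "0 \<le> \<tau>\<^sup>2 / real n" using n0 by simp
  have gt: "\<tau>\<^sup>2 / real n \<le> \<tau>\<^sup>2 * (1 + \<gamma>') / real n"
    using n0 \<gamma>' by (intro divide_right_mono) (auto simp: algebra_simps)
  have e1: "pbar * m (Elong 1) = pbar\<^sup>2 * ((1 + \<gamma>') / 2)"
    using mean_Elong[of 1] n by (simp add: power2_eq_square field_simps)
  have "\<bar>pbar * m (Elong 1)\<bar> = pbar\<^sup>2 * ((1 + \<gamma>') / 2)"
    unfolding e1 using \<gamma>' by (simp add: abs_mult)
  also have "\<dots> \<le> \<tau>\<^sup>2 / real n * (1 + \<gamma>')"
    using tension_work(3) tb \<gamma>' by (intro mult_mono) auto
  finally have 1: "\<bar>pbar * m (Elong 1)\<bar> \<le> \<tau>\<^sup>2 * (1 + \<gamma>') / real n" by simp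
  have en: "pbar * m (Elong n) = pbar\<^sup>2 * (real n - 1 / 2 + \<gamma>' / 2)"
    using mean_Elong[of n] n by (simp add: power2_eq_square mult.assoc)
  have "\<bar>pbar * m (Elong n)\<bar> = pbar\<^sup>2 * (real n - 1 / 2 + \<gamma>' / 2)"
    unfolding en using \<gamma>' n by (simp add: abs_mult)
  also have "\<dots> \<le> pbar\<^sup>2 * (real n + \<gamma>')" using \<gamma>' by (intro mult_left_mono) auto
  also have "\<dots> = \<tau> * pbar" using pbar_eq by (simp add: power2_eq_square mult.assoc mult.commute)
  also have "\<dots> \<le> \<tau>\<^sup>2 * (1 + \<gamma>') / real n" using tension_work(2) gt by linarith
  finally have 2: "\<bar>pbar * m (Elong n)\<bar> \<le> \<tau>\<^sup>2 * (1 + \<gamma>') / real n" .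
  have tri: "\<bar>c\<bar> \<le> s + t" if "\<bar>c - d\<bar> \<le> s" "\<bar>d\<bar> \<le> t" for c d s t :: real
    using that by (simp add: abs_le_iff)
  show "\<bar>cross 1\<bar> \<le> S + \<tau>\<^sup>2 * (1 + \<gamma>') / real n"
    using S[OF boundary_cross_bounds(1)[folded B_def]] 1 Tp by (intro tri[of _ "pbar * m (Elong 1)"]) auto
  show "\<bar>cross n\<bar> \<le> S + \<tau>\<^sup>2 * (1 + \<gamma>') / real n"
    using S[OF boundary_cross_bounds(2)[folded B_def]] 2 Tm by (intro tri[of _ "pbar * m (Elong n)"]) auto
qed

lemma lin_profile_boundary:
  "\<bar>lin_profile 1 - 2 * Tm\<bar> + \<bar>2 * Tp + \<tau>\<^sup>2 - 2 * Tm\<bar> / real n \<le> chain_error \<gamma>' Tm Tp \<tau> n"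
  "\<bar>lin_profile n - (2 * Tp + \<tau>\<^sup>2)\<bar> \<le> chain_error \<gamma>' Tm Tp \<tau> n"
proof -
  have n0: "real n > 0" using n by simp
  define S where "S = sqrt (22 * L * (L + 1) / \<gamma>' * (Tm + Tp + 1) / real n)"
  define X where "X = S + \<tau>\<^sup>2 * (1 + \<gamma>') / real n"
  define J where "J = (1 + 4 / \<gamma>') * (9 / 2 * L) / real n"
  have err: "chain_error \<gamma>' Tm Tp \<tau> n = J + 4 * \<tau>\<^sup>2 / \<gamma>' / real n + \<tau>\<^sup>2 * (1 + 2 * \<gamma>') / real n
      + (1 + \<gamma>') * X + \<bar>2 * Tp + \<tau>\<^sup>2 - 2 * Tm\<bar> / real n"
    unfolding chain_error_def J_def X_def S_def by (simp add: add_divide_distrib algebra_simps)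
  have cr: "\<bar>cross 1\<bar> \<le> X" "\<bar>cross n\<bar> \<le> X" unfolding X_def S_def by (rule cross_boundary)+
  have X: "\<bar>a * c\<bar> \<le> (1 + \<gamma>') * X" if "\<bar>a\<bar> \<le> 1 + \<gamma>'" "\<bar>c\<bar> \<le> X" for a c using that by (rule abs_mult_le)
  have a: "\<bar>(\<gamma>' - 1) / 2\<bar> \<le> 1 + \<gamma>'" "\<bar>(1 - \<gamma>') / 2\<bar> \<le> 1 + \<gamma>'" using \<gamma>' by (auto simp: abs_le_iff)
  note Xl = X[OF a(1) cr(1)] and Xr = X[OF a(2) cr(2)]
  have J: "(1 + 4 / \<gamma>') * \<bar>cur\<bar> \<le> J"
  proof -
    have "\<bar>cur\<bar> \<le> 9 / 2 * L / real n" using cur_bound n0 by (simp add: field_simps)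
    then have "(1 + 4 / \<gamma>') * \<bar>cur\<bar> \<le> (1 + 4 / \<gamma>') * (9 / 2 * L / real n)"
      using \<gamma>' by (intro mult_left_mono) auto
    then show ?thesis unfolding J_def by simp
  qed
  have nonneg: "0 \<le> 4 * \<tau>\<^sup>2 / \<gamma>' / real n" "0 \<le> \<tau>\<^sup>2 * (1 + 2 * \<gamma>') / real n" "0 \<le> \<bar>2 * Tp + \<tau>\<^sup>2 - 2 * Tm\<bar> / real n"
    using \<gamma>' n0 by auto
  have cJ: "\<bar>(1 + 4 / \<gamma>') * cur\<bar> \<le> J" using J \<gamma>' by (simp add: abs_mult)
  have k0: "kin 0 = Tm - 2 / \<gamma>' * cur" unfolding cur_def using \<gamma>' by (simp add: field_simps)
  have "lin_profile 1 - 2 * Tm = - ((1 + 4 / \<gamma>') * cur) + (\<gamma>' - 1) / 2 * cross 1"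
    unfolding lin_profile_left k0 by (simp add: algebra_simps)
  then have "\<bar>lin_profile 1 - 2 * Tm\<bar> \<le> J + (1 + \<gamma>') * X"
    using cJ Xl abs_triangle_ineq[of "- ((1 + 4 / \<gamma>') * cur)" "(\<gamma>' - 1) / 2 * cross 1"] by simp
  then show "\<bar>lin_profile 1 - 2 * Tm\<bar> + \<bar>2 * Tp + \<tau>\<^sup>2 - 2 * Tm\<bar> / real n \<le> chain_error \<gamma>' Tm Tp \<tau> n"
    unfolding err using nonneg by linarith
  have kn: "kin n = Tp + 2 / \<gamma>' * cur + 2 * (\<tau> * pbar) / \<gamma>'" using cur_right \<gamma>' by (simp add: field_simps)
  have split: "lin_profile n - (2 * Tp + \<tau>\<^sup>2) = ((1 + 4 / \<gamma>') * cur + (1 - \<gamma>') / 2 * cross n)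
      + (4 * (\<tau> * pbar) / \<gamma>' + (\<tau> * m (Elong n) - \<tau>\<^sup>2))"
    unfolding lin_profile_right kn by (simp add: algebra_simps)
  have b1: "\<bar>(1 + 4 / \<gamma>') * cur + (1 - \<gamma>') / 2 * cross n\<bar> \<le> J + (1 + \<gamma>') * X"
    using cJ Xr abs_triangle_ineq[of "(1 + 4 / \<gamma>') * cur" "(1 - \<gamma>') / 2 * cross n"] by linarith
  have b2: "\<bar>4 * (\<tau> * pbar) / \<gamma>'\<bar> \<le> 4 * \<tau>\<^sup>2 / \<gamma>' / real n"
  proof -
    have "4 * (\<tau> * pbar) / \<gamma>' \<le> 4 * (\<tau>\<^sup>2 / real n) / \<gamma>'"
      using tension_work(2) \<gamma>' by (intro divide_right_mono mult_left_mono) auto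
    then show ?thesis using tension_work(1) \<gamma>' by (simp add: mult.commute)
  qed
  have b3: "\<bar>\<tau> * m (Elong n) - \<tau>\<^sup>2\<bar> \<le> \<tau>\<^sup>2 * (1 + 2 * \<gamma>') / real n"
  proof -
    have "\<tau> * m (Elong n) - \<tau>\<^sup>2 = \<tau> * (m (Elong n) - \<tau> * (real n / real n))"
      using n by (simp add: power2_eq_square algebra_simps)
    also have "\<bar>\<dots>\<bar> \<le> \<bar>\<tau>\<bar> * (\<bar>\<tau>\<bar> * (1 + 2 * \<gamma>') / real n)"
      using n by (intro abs_mult_le order_refl mean_Elong_approx) auto
    also have "\<dots> = \<tau>\<^sup>2 * (1 + 2 * \<gamma>') / real n"
      by (simp add: power2_eq_square mult.assoc[symmetric] abs_mult_self_eq)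
    finally show ?thesis .
  qed
  have "\<bar>lin_profile n - (2 * Tp + \<tau>\<^sup>2)\<bar> \<le>
      (J + (1 + \<gamma>') * X) + (4 * \<tau>\<^sup>2 / \<gamma>' / real n + \<tau>\<^sup>2 * (1 + 2 * \<gamma>') / real n)"
    unfolding split by (rule abs_add3_le[OF b1 b2 b3])
  then show "\<bar>lin_profile n - (2 * Tp + \<tau>\<^sup>2)\<bar> \<le> chain_error \<gamma>' Tm Tp \<tau> n"
    unfolding err using nonneg by linarith
qed

lemma lin_profile_approx:
  assumes "1 \<le> x" "x \<le> n"
  shows "\<bar>lin_profile x - (2 * Tm + (2 * Tp + \<tau>\<^sup>2 - 2 * Tm) * (real x / real n))\<bar> \<le> 2 * chain_error \<gamma>' Tm Tp \<tau> n"
proof -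
  define A where "A = 2 * Tm"
  define B where "B = 2 * Tp + \<tau>\<^sup>2"
  \<comment> \<open>Interpolation runs between the sites 1 and \<open>n\<close>; replacing
    \<open>t\<close> by \<open>real x / real n\<close> costs at most \<open>1 / real n\<close>, the
    last 1/n term of \<open>chain_error\<close>.\<close>
  define t where "t = (real x - 1) / (real n - 1)"
  have t: "0 \<le> t" "t \<le> 1" unfolding t_def using assms n by auto
  have n1: "real n - 1 > 0" "real n > 0" using n by auto
  have "lin_profile n - lin_profile 1 = - 2 * cur * (real n - 1)"
    using lin_profile_eq[of n] n by (simp add: algebra_simps)
  then have "t * (lin_profile n - lin_profile 1) = - 2 * cur * (t * (real n - 1))"
    by (simp add: mult_ac)
  also have "t * (real n - 1) = real x - 1" unfolding t_def using n1 by simp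
  finally have "t * (lin_profile n - lin_profile 1) = - 2 * cur * (real x - 1)" .
  then have "lin_profile x = lin_profile 1 + t * (lin_profile n - lin_profile 1)"
    using lin_profile_eq[OF assms] by (simp add: algebra_simps)
  then have eq: "lin_profile x - (A + (B - A) * (real x / real n)) =
      (1 - t) * (lin_profile 1 - A) + (t * (lin_profile n - B) + (B - A) * (t - real x / real n))"
    by (simp add: algebra_simps)
  have "t - real x / real n = (real x - real n) / ((real n - 1) * real n)"
    unfolding t_def using n1 by (simp add: field_simps)
  also have "\<bar>\<dots>\<bar> \<le> 1 / real n"
  proof -
    have "\<bar>real x - real n\<bar> \<le> real n - 1" using assms by simp
    then show ?thesis using n1 by (simp add: abs_mult divide_le_eq)
  qed
  finally have b3: "\<bar>(B - A) * (t - real x / real n)\<bar> \<le> \<bar>B - A\<bar> * (1 / real n)" by (intro abs_mult_le) auto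
  have b1: "\<bar>(1 - t) * (lin_profile 1 - A)\<bar> \<le> 1 * \<bar>lin_profile 1 - A\<bar>"
    using t by (intro abs_mult_le) auto
  have b2: "\<bar>t * (lin_profile n - B)\<bar> \<le> 1 * \<bar>lin_profile n - B\<bar>"
    using t by (intro abs_mult_le) auto
  have "\<bar>lin_profile x - (A + (B - A) * (real x / real n))\<bar> \<le>
     \<bar>lin_profile 1 - A\<bar> + (\<bar>lin_profile n - B\<bar> + \<bar>B - A\<bar> * (1 / real n))"
    unfolding eq using abs_add3_le[OF b1 b2 b3] by simp
  also have "\<dots> \<le> 2 * chain_error \<gamma>' Tm Tp \<tau> n"
    using lin_profile_boundary unfolding A_def B_def by simp
  finally show ?thesis unfolding A_def B_def .
qed

end

section \<open>Passage to the limit\<close>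

lemma dev_weak_limit:
  fixes M :: "nat \<Rightarrow> coord \<Rightarrow> coord \<Rightarrow> real"
  assumes cm: "\<And>n. n \<ge> 3 \<Longrightarrow> chain_moments n \<gamma>' Tm Tp \<tau> (m n) (M n)"
    and G: "continuous_on {0..1} G"
  shows "(\<lambda>n. 1 / real n * (\<Sum>x = 1..n. G (real x / real n) * chain_moments.dev (M n) x)) \<longlonglongrightarrow> 0"
proof (rule weak_negligible[OF G])
  fix n :: nat assume "n \<ge> 3"
  then interpret c: chain_moments n \<gamma>' Tm Tp \<tau> "m n" "M n" by (rule cm)
  have "(8 + \<gamma>') * c.L \<le> (47 + 3 * \<gamma>') * c.L"
    using c.\<gamma>' c.boundary_bounds(12) by (intro mult_right_mono) auto
  then show "\<bar>\<Sum>x = 1..n. c.dev x\<bar> \<le> (47 + 3 * \<gamma>') * c.L"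
    using c.cumdev_total unfolding c.cumdev_def by linarith
  show "(\<Sum>k = 1..<n. \<bar>\<Sum>x = 1..k. c.dev x\<bar>) \<le> (47 + 3 * \<gamma>') * c.L * real n"
    using c.cumdev_sum unfolding c.cumdev_def .
qed

text \<open>The energy is half of \<open>lin_profile\<close> plus half of \<open>dev\<close>: the
  first converges uniformly to the affine function from \<open>Tm\<close> to
  \<open>Tp + \<tau>\<^sup>2 / 2\<close>, the second only weakly, to 0.\<close>

lemma energy_limit:
  fixes M :: "nat \<Rightarrow> coord \<Rightarrow> coord \<Rightarrow> real"
  assumes cm: "\<And>n. n \<ge> 3 \<Longrightarrow> chain_moments n \<gamma>' Tm Tp \<tau> (m n) (M n)"
    and G: "continuous_on {0..1} G"
  shows "(\<lambda>n. 1 / real n * (\<Sum>x = 1..n. G (real x / real n) *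
            (1 / 2 * M n (Mom x) (Mom x) + 1 / 2 * M n (Elong x) (Elong x))))
    \<longlonglongrightarrow> integral {0..1} (\<lambda>u. G u * (Tm + (Tp + \<tau>\<^sup>2 / 2 - Tm) * u))"
proof -
  have "(\<lambda>n. 1 / real n * (\<Sum>x = 1..n. G (real x / real n) * (1 / 2 * chain_moments.lin_profile (M n) x)))
    \<longlonglongrightarrow> integral {0..1} (\<lambda>u. G u * (Tm + (Tp + \<tau>\<^sup>2 / 2 - Tm) * u))"
  proof (rule riemann_sum_perturbed[OF G _ _ chain_error_tendsto])
    show "continuous_on {0..1} (\<lambda>u. Tm + (Tp + \<tau>\<^sup>2 / 2 - Tm) * u)" by (intro continuous_intros)
    fix n x :: nat assume n: "n \<ge> 3" and x: "1 \<le> x" "x \<le> n"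
    interpret c: chain_moments n \<gamma>' Tm Tp \<tau> "m n" "M n" by (rule cm[OF n])
    have "1 / 2 * c.lin_profile x - (Tm + (Tp + \<tau>\<^sup>2 / 2 - Tm) * (real x / real n)) =
        1 / 2 * (c.lin_profile x - (2 * Tm + (2 * Tp + \<tau>\<^sup>2 - 2 * Tm) * (real x / real n)))"
    proof -
      have "1 / 2 * y - (Tm + (Tp + \<tau>\<^sup>2 / 2 - Tm) * r) =
          1 / 2 * (y - (2 * Tm + (2 * Tp + \<tau>\<^sup>2 - 2 * Tm) * r))" for y r
        by (simp add: field_simps)
      then show ?thesis .
    qed
    also have "\<bar>\<dots>\<bar> \<le> 1 / 2 * (2 * chain_error \<gamma>' Tm Tp \<tau> n)"
      by (intro abs_mult_le c.lin_profile_approx x) auto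
    finally show "\<bar>1 / 2 * c.lin_profile x - (Tm + (Tp + \<tau>\<^sup>2 / 2 - Tm) * (real x / real n))\<bar>
        \<le> chain_error \<gamma>' Tm Tp \<tau> n" by simp
  qed
  moreover have "(\<lambda>n. 1 / 2 * (1 / real n * (\<Sum>x = 1..n. G (real x / real n) * chain_moments.dev (M n) x)))
      \<longlonglongrightarrow> 1 / 2 * 0"
    by (intro tendsto_mult tendsto_const dev_weak_limit[OF cm G])
  ultimately have "(\<lambda>n. 1 / real n * (\<Sum>x = 1..n. G (real x / real n) * (1 / 2 * chain_moments.lin_profile (M n) x))
      + 1 / 2 * (1 / real n * (\<Sum>x = 1..n. G (real x / real n) * chain_moments.dev (M n) x)))
    \<longlonglongrightarrow> integral {0..1} (\<lambda>u. G u * (Tm + (Tp + \<tau>\<^sup>2 / 2 - Tm) * u)) + 1 / 2 * 0"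
    by (rule tendsto_add)
  then have lim: "(\<lambda>n. 1 / real n * (\<Sum>x = 1..n. G (real x / real n) * (1 / 2 * chain_moments.lin_profile (M n) x))
      + 1 / 2 * (1 / real n * (\<Sum>x = 1..n. G (real x / real n) * chain_moments.dev (M n) x)))
    \<longlonglongrightarrow> integral {0..1} (\<lambda>u. G u * (Tm + (Tp + \<tau>\<^sup>2 / 2 - Tm) * u))" by simp
  show ?thesis
  proof (rule Lim_transform_eventually[OF lim eventually_sequentiallyI[of 3]])
    fix n :: nat assume n: "n \<ge> 3"
    interpret c: chain_moments n \<gamma>' Tm Tp \<tau> "m n" "M n" by (rule cm[OF n])
    show "1 / real n * (\<Sum>x = 1..n. G (real x / real n) * (1 / 2 * c.lin_profile x))
      + 1 / 2 * (1 / real n * (\<Sum>x = 1..n. G (real x / real n) * c.dev x)) =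
      1 / real n * (\<Sum>x = 1..n. G (real x / real n) *
            (1 / 2 * M n (Mom x) (Mom x) + 1 / 2 * M n (Elong x) (Elong x)))"
      unfolding mult.left_commute[of "1 / 2" "1 / real n"] distrib_left[symmetric]
        sum_distrib_left[of "1 / 2"] sum.distrib[symmetric]
      by (intro arg_cong2[where f = "(*)"] sum.cong refl) (simp add: c.dev_def c.kin_def c.pot_def algebra_simps)
  qed
qed

lemma mech_limit:
  assumes cm: "\<And>n. n \<ge> 3 \<Longrightarrow> chain_moments n \<gamma>' Tm Tp \<tau> (m n) (M n)"
    and G: "continuous_on {0..1} G"
  shows "(\<lambda>n. 1 / real n * (\<Sum>x = 1..n. G (real x / real n) * (1 / 2 * (m n (Elong x))\<^sup>2)))
    \<longlonglongrightarrow> integral {0..1} (\<lambda>u. G u * (1 / 2 * (\<tau> * u)\<^sup>2))"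
proof (rule riemann_sum_perturbed[OF G])
  define e where "e n = \<bar>\<tau>\<bar> * (1 + 2 * \<gamma>') / real n" for n
  show "continuous_on {0..1} (\<lambda>u. 1 / 2 * (\<tau> * u)\<^sup>2)" by (intro continuous_intros)
  have "e \<longlonglongrightarrow> 0" unfolding e_def[abs_def] by (rule lim_const_over_n)
  then have "(\<lambda>n. 1 / 2 * (e n * (e n + 2 * \<bar>\<tau>\<bar>))) \<longlonglongrightarrow> 1 / 2 * (0 * (0 + 2 * \<bar>\<tau>\<bar>))"
    by (intro tendsto_intros)
  then show "(\<lambda>n. 1 / 2 * (e n * (e n + 2 * \<bar>\<tau>\<bar>))) \<longlonglongrightarrow> 0" by simp
  fix n x :: nat assume n: "n \<ge> 3" and x: "1 \<le> x" "x \<le> n"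
  interpret c: chain_moments n \<gamma>' Tm Tp \<tau> "m n" "M n" by (rule cm[OF n])
  define s where "s = \<tau> * (real x / real n)"
  have d: "\<bar>m n (Elong x) - s\<bar> \<le> e n" unfolding s_def e_def by (rule c.mean_Elong_approx[OF x])
  have "\<bar>s\<bar> \<le> \<bar>\<tau>\<bar> * 1" unfolding s_def using x n by (intro abs_mult_le) auto
  moreover have "m n (Elong x) + s = (m n (Elong x) - s) + 2 * s" by simp
  ultimately have p: "\<bar>m n (Elong x) + s\<bar> \<le> e n + 2 * \<bar>\<tau>\<bar>"
    using d abs_triangle_ineq[of "m n (Elong x) - s" "2 * s"] by (simp add: abs_mult)
  have "1 / 2 * (m n (Elong x))\<^sup>2 - 1 / 2 * s\<^sup>2 = 1 / 2 * ((m n (Elong x) - s) * (m n (Elong x) + s))"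
    by (simp add: power2_eq_square algebra_simps)
  also have "\<bar>\<dots>\<bar> \<le> 1 / 2 * (e n * (e n + 2 * \<bar>\<tau>\<bar>))"
    by (intro abs_mult_le d p) simp
  finally show "\<bar>1 / 2 * (m n (Elong x))\<^sup>2 - 1 / 2 * (\<tau> * (real x / real n))\<^sup>2\<bar> \<le> 1 / 2 * (e n * (e n + 2 * \<bar>\<tau>\<bar>))"
    unfolding s_def .
qed

theorem theorem3p3:
  fixes \<gamma> \<gamma>' Tm Tp \<tau> :: real
    and P :: "nat \<Rightarrow> real \<Rightarrow> config \<Rightarrow> config measure"
    and \<mu> :: "nat \<Rightarrow> config measure"
    and G :: "real \<Rightarrow> real"
  assumes "\<gamma> > 0" and "\<gamma>' > 0" and "Tm > 0" and "Tp > 0"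
    and "\<And>n. n \<ge> 1 \<Longrightarrow> diffusion_semigroup n (generator \<gamma> \<gamma>' Tm Tp \<tau> n) (P n)"
    and "\<And>n. n \<ge> 1 \<Longrightarrow> stationary_measure n (P n) (\<mu> n)"
    and "\<And>n. n \<ge> 1 \<Longrightarrow> finite_second_moments n (\<mu> n)"
    and "\<gamma> = 1"
    and "continuous_on {0..1} G"
  shows "((\<lambda>n. 1 / real n * (\<Sum>x = 1..n. G (real x / real n) * mech_energy (\<mu> n) x))
            \<longlonglongrightarrow> integral {0..1} (\<lambda>u. G u * (1 / 2 * (r_ss \<tau> u)\<^sup>2)))
       \<and> ((\<lambda>n. 1 / real n * (\<Sum>x = 1..n. G (real x / real n) * (\<integral>z. thermal_energy (\<mu> n) x z \<partial>\<mu> n)))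
            \<longlonglongrightarrow> integral {0..1} (\<lambda>u. G u * e_th_ss \<tau> Tm Tp u))
       \<and> ((\<lambda>n. 1 / real n * (\<Sum>x = 1..n. G (real x / real n) * (\<integral>z. energy x z \<partial>\<mu> n)))
            \<longlonglongrightarrow> integral {0..1} (\<lambda>u. G u * (e_th_ss \<tau> Tm Tp u + 1 / 2 * (r_ss \<tau> u)\<^sup>2)))"
proof -
  note G = assms(9)
  define m where "m n a = (\<integral>z. z a \<partial>\<mu> n)" for n and a :: coord
  define M where "M n a b = (\<integral>z. z a * z b \<partial>\<mu> n)" for n and a b :: coord
  have cm: "chain_moments n \<gamma>' Tm Tp \<tau> (m n) (M n)" if "n \<ge> 3" for n
  proof
    show "moment_system n 1 \<gamma>' Tm Tp \<tau> (m n) (M n)"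
      unfolding m_def M_def using assms(5-8) that
      by (intro stationary_moment_system[where P = "P n"]) auto
  qed (use that assms in auto)
  have sq: "integrable (\<mu> n) (\<lambda>z. (z c)\<^sup>2)" if "n \<ge> 1" "c \<in> coords n" for n c
    using assms(7)[OF that(1)] that(2) unfolding finite_second_moments_def by blast
  have energy_integrable: "integrable (\<mu> n) (energy x)" if "n \<ge> 1" "1 \<le> x" "x \<le> n" for n x
    unfolding energy_def[abs_def] using that sq[of n "Mom x"] sq[of n "Elong x"] by auto
  have energy_eq: "(\<integral>z. energy x z \<partial>\<mu> n) = 1 / 2 * M n (Mom x) (Mom x) + 1 / 2 * M n (Elong x) (Elong x)"
    if "n \<ge> 1" "1 \<le> x" "x \<le> n" for n x
    unfolding energy_def M_def using that sq[of n "Mom x"] sq[of n "Elong x"]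
    by (simp add: power2_eq_square)
  have thermal_eq: "(\<integral>z. thermal_energy (\<mu> n) x z \<partial>\<mu> n) = (\<integral>z. energy x z \<partial>\<mu> n) - mech_energy (\<mu> n) x"
    if "n \<ge> 1" "1 \<le> x" "x \<le> n" for n x
  proof -
    interpret prob_space "\<mu> n" using assms(6)[OF that(1)] unfolding stationary_measure_def by blast
    show ?thesis unfolding thermal_energy_def using energy_integrable[OF that] by (simp add: prob_space)
  qed
  have mech: "(\<lambda>n. 1 / real n * (\<Sum>x = 1..n. G (real x / real n) * mech_energy (\<mu> n) x))
      \<longlonglongrightarrow> integral {0..1} (\<lambda>u. G u * (1 / 2 * (r_ss \<tau> u)\<^sup>2))"
    unfolding mech_energy_def r_ss_def m_def[symmetric] by (rule mech_limit[OF cm G])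
  \<comment> \<open>The total energy profile is affine, so the parabola in \<open>e_th_ss\<close> is
    exactly what subtracting the mechanical energy leaves; the thermal limit is therefore a
    difference of the other two.\<close>
  have profile: "e_th_ss \<tau> Tm Tp u + 1 / 2 * (r_ss \<tau> u)\<^sup>2 = Tm + (Tp + \<tau>\<^sup>2 / 2 - Tm) * u" for u
    unfolding e_th_ss_def r_ss_def by (simp add: power2_eq_square field_simps)
  have sum_energy: "(\<Sum>x = 1..n. G (real x / real n) * (\<integral>z. energy x z \<partial>\<mu> n)) =
      (\<Sum>x = 1..n. G (real x / real n) * (1 / 2 * M n (Mom x) (Mom x) + 1 / 2 * M n (Elong x) (Elong x)))" for n
    by (intro sum.cong) (auto simp: energy_eq)
  have total: "(\<lambda>n. 1 / real n * (\<Sum>x = 1..n. G (real x / real n) * (\<integral>z. energy x z \<partial>\<mu> n)))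
      \<longlonglongrightarrow> integral {0..1} (\<lambda>u. G u * (e_th_ss \<tau> Tm Tp u + 1 / 2 * (r_ss \<tau> u)\<^sup>2))"
    unfolding profile sum_energy by (rule energy_limit[OF cm G])
  have sum_thermal: "1 / real n * (\<Sum>x = 1..n. G (real x / real n) * (\<integral>z. thermal_energy (\<mu> n) x z \<partial>\<mu> n)) =
      1 / real n * (\<Sum>x = 1..n. G (real x / real n) * (\<integral>z. energy x z \<partial>\<mu> n))
      - 1 / real n * (\<Sum>x = 1..n. G (real x / real n) * mech_energy (\<mu> n) x)" for n
    unfolding right_diff_distrib[symmetric] sum_subtractf[symmetric]
    by (intro arg_cong2[where f = "(*)"] sum.cong refl) (auto simp: thermal_eq)
  have "integral {0..1} (\<lambda>u. G u * (e_th_ss \<tau> Tm Tp u + 1 / 2 * (r_ss \<tau> u)\<^sup>2))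
      - integral {0..1} (\<lambda>u. G u * (1 / 2 * (r_ss \<tau> u)\<^sup>2)) =
      integral {0..1} (\<lambda>u. G u * (e_th_ss \<tau> Tm Tp u + 1 / 2 * (r_ss \<tau> u)\<^sup>2) - G u * (1 / 2 * (r_ss \<tau> u)\<^sup>2))"
    unfolding e_th_ss_def r_ss_def
    by (intro Henstock_Kurzweil_Integration.integral_diff[symmetric] integrable_continuous_interval
        continuous_intros G)
  also have "\<dots> = integral {0..1} (\<lambda>u. G u * e_th_ss \<tau> Tm Tp u)"
    by (simp add: algebra_simps)
  finally have "(\<lambda>n. 1 / real n * (\<Sum>x = 1..n. G (real x / real n) * (\<integral>z. thermal_energy (\<mu> n) x z \<partial>\<mu> n)))
      \<longlonglongrightarrow> integral {0..1} (\<lambda>u. G u * e_th_ss \<tau> Tm Tp u)"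
    unfolding sum_thermal using tendsto_diff[OF total mech] by simp
  then show ?thesis using mech total by blast
qed

end
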